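(* Suppose that $\lambda>\Lambda$. Then for any $N>0$ there is an $\varepsilon_0>0$ such that if $0<\varepsilon<\varepsilon_0$ and if $M$ is any positive integer with $M\le N$, then $\varepsilon^2u''=u^3-\lambda u+\cos t$ has a periodic solution with exactly $M$ local maxima in $(0,\pi]$, the last being at $\pi$. Also, these periodic solutions have a local minimum at $t=0$ and satisfy $-\sqrt\lambda<u(0)<U_0(\pi)$ and $U_0(\pi)<u(\pi)<\bar U(\pi)$.
   Context: Let $\lambda_0=3/2^{2/3}$. For $\lambda>\lambda_0$ let $\bar U(t)>U_0(t)>\underline U(t)$ be the three real roots of $u^3-\lambda u+\cos t=0$. For $\lambda>\lambda_0$ let $V_1$ be the (homoclinic) solution of $\ddot V=V^3-\lambda V+1$ with $\lim_{\tau\to\pm\infty}V_1(\tau)=\bar U(0)$, $\dot V_1(0)=0$, $V_1$ not constant. Define $$\Lambda=\inf\{\lambda>\lambda_0:\ V_1(0)<U_0(\pi)\},$$ where $V_1$ and $U_0$ depend on $\lambda$. *)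

theory Defs
  imports "HOL-Analysis.Analysis"
begin

definition lambda0 :: real where
  "lambda0 = 3 / 2 powr (2/3)"

definition cubic_roots :: "real \<Rightarrow> real \<Rightarrow> real set" where
  "cubic_roots lam t = {u. u^3 - lam * u + cos t = 0}"

(* For lam > lambda0 there are exactly three real roots, see cubic_roots_three below. *)

definition U_upper :: "real \<Rightarrow> real \<Rightarrow> real" where
  "U_upper lam t = Max (cubic_roots lam t)"

definition U_lower :: "real \<Rightarrow> real \<Rightarrow> real" where
  "U_lower lam t = Min (cubic_roots lam t)"

definition U_mid :: "real \<Rightarrow> real \<Rightarrow> real" where
  "U_mid lam t = (THE u. u \<in> cubic_roots lam t \<and> U_lower lam t < u \<and> u < U_upper lam t)"

definition is_homoclinic :: "real \<Rightarrow> (real \<Rightarrow> real) \<Rightarrow> bool" where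
  "is_homoclinic lam V \<longleftrightarrow>
     (\<exists>V'. (\<forall>\<tau>. (V has_real_derivative V' \<tau>) (at \<tau>)) \<and>
           (\<forall>\<tau>. (V' has_real_derivative (V \<tau> ^ 3 - lam * V \<tau> + 1)) (at \<tau>)) \<and>
           V' 0 = 0) \<and>
     (V \<longlongrightarrow> U_upper lam 0) at_top \<and>
     (V \<longlongrightarrow> U_upper lam 0) at_bot \<and>
     \<not> V constant_on UNIV"

(* For lam > lambda0 the solution is unique: homoclinic orbits to the equilibrium
   U_upper lam 0 agree up to translation, and V' 0 = 0 fixes the translation. *)

definition V1 :: "real \<Rightarrow> real \<Rightarrow> real" where
  "V1 lam = (THE V. is_homoclinic lam V)"

definition Lambda_crit :: real where
  "Lambda_crit = Inf {lam. lam > lambda0 \<and> V1 lam 0 < U_mid lam pi}"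

definition forced_solution :: "real \<Rightarrow> real \<Rightarrow> (real \<Rightarrow> real) \<Rightarrow> bool" where
  "forced_solution \<epsilon> lam u \<longleftrightarrow>
     (\<exists>u' u''. (\<forall>t. (u has_real_derivative u' t) (at t)) \<and>
               (\<forall>t. (u' has_real_derivative u'' t) (at t)) \<and>
               (\<forall>t. \<epsilon>^2 * u'' t = u t ^ 3 - lam * u t + cos t))"

definition local_max_at :: "(real \<Rightarrow> real) \<Rightarrow> real \<Rightarrow> bool" where
  "local_max_at u t \<longleftrightarrow> (\<forall>\<^sub>F s in nhds t. u s \<le> u t)"

definition local_min_at :: "(real \<Rightarrow> real) \<Rightarrow> real \<Rightarrow> bool" where
  "local_min_at u t \<longleftrightarrow> (\<forall>\<^sub>F s in nhds t. u t \<le> u s)"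

lemma lambda0_pos: "lambda0 > 0"
  unfolding lambda0_def by simp

lemma lambda0_cubed: "lambda0 ^ 3 = 27 / 4"
proof -
  have "((2::real) powr (2/3)) ^ 3 = 2 powr (real 3 * (2/3))"
    by (subst powr_realpow [symmetric]) (simp_all add: powr_powr)
  then show ?thesis
    unfolding lambda0_def by (simp add: power_divide)
qed

lemma cubic_roots_three:
  assumes "lam > lambda0"
  shows "\<exists>a b c. a < b \<and> b < c \<and> cubic_roots lam t = {a, b, c}"
proof -
  define s where "s = sqrt (lam / 3)"
  define p where "p = (\<lambda>u::real. u^3 - lam * u + cos t)"
  have lpos: "lam > 0" using assms lambda0_pos by linarith
  have s0: "s > 0" unfolding s_def using lpos by simp
  have lam: "lam = 3 * s^2" unfolding s_def using lpos by simp
  have "27/4 < lam ^ 3"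
    using power_strict_mono[OF assms, of 3] lambda0_pos lambda0_cubed by simp
  then have "1 < (2 * s^3)^2" unfolding lam by (simp add: power_mult_distrib)
  then have big: "2 * s^3 > 1"
    using s0 power_less_imp_less_base[of 1 2 "2 * s^3"] by simp
  have cont: "continuous_on A p" for A unfolding p_def by (intro continuous_intros)
  have p1: "p (-2 * s) < 0" "p s < 0" and p2: "p (-s) > 0" "p (2 * s) > 0"
  proof -
    have "p (-2 * s) = cos t - 2 * s^3" "p s = cos t - 2 * s^3"
      "p (-s) = cos t + 2 * s^3" "p (2 * s) = cos t + 2 * s^3"
      unfolding p_def lam by (simp_all add: power3_eq_cube power2_eq_square)
    then show "p (-2 * s) < 0" "p s < 0" "p (-s) > 0" "p (2 * s) > 0"
      using big cos_le_one[of t] cos_ge_minus_one[of t] by linarith+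
  qed
  obtain a where a: "-2 * s \<le> a" "a \<le> -s" "p a = 0"
    using IVT'[of p "-2 * s" 0 "-s"] p1 p2 s0 cont by auto
  obtain b where b: "-s \<le> b" "b \<le> s" "p b = 0"
    using IVT2'[of p s 0 "-s"] p1 p2 s0 cont by auto
  obtain d where d: "s \<le> d" "d \<le> 2 * s" "p d = 0"
    using IVT'[of p s 0 "2 * s"] p1 p2 s0 cont by auto
  have "a \<noteq> -s" "d \<noteq> s" using a d p1 p2 by auto
  then have ord: "a < b" "b < d" using a b d by linarith+
  have fac: "x = y \<or> x^2 + x*y + y^2 = lam" if "p x = 0" "p y = 0" for x y
  proof -
    have "(x - y) * (x^2 + x*y + y^2 - lam) = p x - p y"
      unfolding p_def by (simp add: power3_eq_cube power2_eq_square algebra_simps)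
    then show ?thesis using that by auto
  qed
  have "x \<in> {a, b, d}" if x: "p x = 0" for x
  proof (rule ccontr)
    assume n: "x \<notin> {a, b, d}"
    have "x^2 + x*a + a^2 = lam" "x^2 + x*b + b^2 = lam" "x^2 + x*d + d^2 = lam"
      using fac[OF x a(3)] fac[OF x b(3)] fac[OF x d(3)] n by auto
    then have "(a - b) * (x + a + b) = 0" "(b - d) * (x + b + d) = 0"
      by (simp_all add: power2_eq_square algebra_simps)
    then show False using ord by auto
  qed
  then have "cubic_roots lam t = {a, b, d}"
    unfolding cubic_roots_def using a b d p_def by auto
  then show ?thesis using ord by blast
qed

lemma U_ordered_roots:
  assumes "lam > lambda0"
  shows "U_lower lam t < U_mid lam t" "U_mid lam t < U_upper lam t"
    and "cubic_roots lam t = {U_lower lam t, U_mid lam t, U_upper lam t}"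
proof -
  obtain a b c where o: "a < b" "b < c" and R: "cubic_roots lam t = {a, b, c}"
    using cubic_roots_three[OF assms] by blast
  have lo: "U_lower lam t = a" unfolding U_lower_def R using o by simp
  have up: "U_upper lam t = c" unfolding U_upper_def R using o by simp
  have mid: "U_mid lam t = b" unfolding U_mid_def lo up R using o by (intro the_equality) auto
  show "U_lower lam t < U_mid lam t" "U_mid lam t < U_upper lam t"
    "cubic_roots lam t = {U_lower lam t, U_mid lam t, U_upper lam t}"
    using o R lo up mid by auto
qed

end

(*
  In the time scale s = t / eps the equation reads v'' = v^3 - lam v + cos (eps s); a solution with
  v'(0) = v'(pi / eps) = 0 is even about both points, hence gives a 2 pi - periodic u.  So one shoots
  from v(0) = al, v'(0) = 0 and varies al in [- sqrt lam, al*], where al* lies between the minimum of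
  the homoclinic orbit and - b = U_mid lam pi; such an al* exists exactly because lam > Lambda_crit.

  The planar curve (- b - v, v') never vanishes on (0, pi / eps]: comparing energies with the lowest
  previous minimum shows that a critical point above - b lies strictly between U_mid and U_upper,
  so it is a strict local maximum.  Its angle is therefore continuous in (al, s) and crosses each level
  (2 j - 1) pi once and upwards, exactly at the maxima above - b.  For al = - sqrt lam the solution
  increases without a critical point, while for al = al* it follows a periodic orbit of the frozen
  equation and turns more than N times if eps is small.  The intermediate value theorem in al gives an
  orbit whose angle at pi / eps equals (2 M - 1) pi.  Maxima below - b cannot occur, because after one
  the solution would decrease up to s = pi / eps.
*)

theory Submission
  imports Defs
begin

section \<open>Second-order differential equations with Lipschitz right-hand side\<close>

text \<open>With \<open>a > b > - (a + b)\<close> the roots at time 0, Vieta gives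
  \<open>a * b * (a + b) = 1\<close> and \<open>lam = a^2 + a * b + b^2\<close>, and the roots at pi
  are the negatives. The homoclinic orbit is explicit with turning point
  \<open>- a + sqrt (2 * b * (a + b))\<close>, so the condition in \<open>Lambda_crit\<close>
  becomes \<open>4 * a * b + b^2 < a^2\<close>. It passes from some \<open>l < lam\<close> to
  \<open>lam\<close> because \<open>a\<close> grows and \<open>b\<close> shrinks with the parameter.
  It is used twice: directly, to leave room for the right end of the shooting interval, and through
  \<open>4 * b < a\<close> in the energy comparison. Zeros of v' themselves are not counted, since
  below \<open>- b\<close> critical points may be degenerate and their number is not controlled as
  \<alpha> varies. The angle needs only that the curve misses the origin, and only its passages at
  \<open>v > - b\<close> need a direction. The energy comparison works up to \<open>rho\<close>,
  where \<open>f\<close> stops decreasing. Above \<open>rho\<close> another reason takes over: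
  \<open>f\<close> increases in v and the forcing decreases in time, so an orbit convex at a
  critical point, traced backwards, could never come down to \<alpha>. The left end
  \<open>- sqrt lam\<close> is the bottom of a well of \<open>G\<close>.\<close>

lemma second_order_gronwall:
  fixes w w' w'' :: "real \<Rightarrow> real"
  assumes w: "\<And>t. 0 \<le> t \<Longrightarrow> t \<le> T \<Longrightarrow> (w has_real_derivative w' t) (at t)"
    and w': "\<And>t. 0 \<le> t \<Longrightarrow> t \<le> T \<Longrightarrow> (w' has_real_derivative w'' t) (at t)"
    and bound: "\<And>t. 0 \<le> t \<Longrightarrow> t \<le> T \<Longrightarrow> \<bar>w'' t\<bar> \<le> L * \<bar>w t\<bar> + d"
    and L: "0 \<le> L" and d: "0 \<le> d" and t: "0 \<le> t" "t \<le> T"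
  shows "(w t)^2 + (w' t)^2 \<le> ((w 0)^2 + (w' 0)^2 + d^2) * exp ((L + 2) * t)"
proof -
  \<comment> \<open>Carrying \<open>d^2\<close> along makes the inequality homogeneous;
    \<open>L + 2\<close> is what the three estimates of the form
    \<open>2 * p * q \<le> p^2 + q^2\<close> add up to.\<close>
  define e where "e = (\<lambda>s. ((w s)^2 + (w' s)^2 + d^2) * exp (- (L + 2) * s))"
  have "e t \<le> e 0"
  proof (rule DERIV_nonpos_imp_nonincreasing[OF t(1)])
    fix s assume s: "0 \<le> s" "s \<le> t"
    let ?D = "(2 * w s * w' s + 2 * w' s * w'' s - (L + 2) * ((w s)^2 + (w' s)^2 + d^2))
      * exp (- (L + 2) * s)"
    have D: "(e has_real_derivative ?D) (at s)"
      unfolding e_def using s t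
      by (auto intro!: derivative_eq_intros w w' simp: algebra_simps)
    have "2 * w s * w' s \<le> (w s)^2 + (w' s)^2"
      using sum_squares_bound[of "w s" "w' s"] by simp
    moreover have "2 * w' s * w'' s \<le> 2 * \<bar>w' s\<bar> * (L * \<bar>w s\<bar> + d)"
    proof -
      have "2 * w' s * w'' s \<le> 2 * (\<bar>w' s\<bar> * \<bar>w'' s\<bar>)"
        by (simp add: abs_mult[symmetric])
      also have "\<dots> \<le> 2 * (\<bar>w' s\<bar> * (L * \<bar>w s\<bar> + d))"
        using bound[of s] s t by (intro mult_left_mono) auto
      finally show ?thesis by (simp add: algebra_simps)
    qed
    moreover have "2 * \<bar>w' s\<bar> * \<bar>w s\<bar> \<le> (w s)^2 + (w' s)^2"
      using sum_squares_bound[of "\<bar>w' s\<bar>" "\<bar>w s\<bar>"] by simp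
    then have "L * (2 * \<bar>w' s\<bar> * \<bar>w s\<bar>) \<le> L * ((w s)^2 + (w' s)^2)"
      using L by (rule mult_left_mono)
    moreover have "2 * \<bar>w' s\<bar> * d \<le> (w' s)^2 + d^2"
      using sum_squares_bound[of "\<bar>w' s\<bar>" d] by simp
    moreover have "0 \<le> L * d^2" "0 \<le> (w s)^2" "0 \<le> d^2" using L by auto
    moreover have "(L + 2) * ((w s)^2 + (w' s)^2 + d^2) = L * ((w s)^2 + (w' s)^2) + L * d^2
        + 2 * (w s)^2 + 2 * (w' s)^2 + 2 * d^2"
      by (simp add: algebra_simps)
    moreover have "2 * \<bar>w' s\<bar> * (L * \<bar>w s\<bar> + d) = L * (2 * \<bar>w' s\<bar> * \<bar>w s\<bar>) + 2 * \<bar>w' s\<bar> * d"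
      by (simp add: algebra_simps)
    ultimately have "2 * w s * w' s + 2 * w' s * w'' s - (L + 2) * ((w s)^2 + (w' s)^2 + d^2) \<le> 0"
      by linarith
    then have "?D \<le> 0" by (simp add: mult_nonpos_nonneg)
    with D show "\<exists>y. (e has_real_derivative y) (at s) \<and> y \<le> 0" by blast
  qed
  then have "((w t)^2 + (w' t)^2 + d^2) * exp (- (L + 2) * t) * exp ((L + 2) * t)
      \<le> ((w 0)^2 + (w' 0)^2 + d^2) * exp ((L + 2) * t)"
    unfolding e_def by (intro mult_right_mono) auto
  then have "(w t)^2 + (w' t)^2 + d^2 \<le> ((w 0)^2 + (w' 0)^2 + d^2) * exp ((L + 2) * t)"
    by (simp add: mult.assoc exp_add[symmetric] algebra_simps)
  then show ?thesis using zero_le_power2[of d] by linarith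
qed

lemma antiderivative_exists:
  fixes h :: "real \<Rightarrow> real"
  assumes "continuous_on UNIV h"
  shows "\<exists>H. H 0 = 0 \<and> (\<forall>t. (H has_real_derivative h t) (at t))"
proof -
  have "\<exists>F. \<forall>x :: real. -\<infinity> < ereal x \<longrightarrow> ereal x < \<infinity> \<longrightarrow> (F has_vector_derivative h x) (at x)"
    using assms by (intro einterval_antiderivative) (auto simp: continuous_on_eq_continuous_at)
  then obtain F where F: "\<And>x. (F has_real_derivative h x) (at x)"
    by (auto simp: has_real_derivative_iff_has_vector_derivative)
  show ?thesis
    by (rule exI[of _ "\<lambda>t. F t - F 0"]) (auto intro!: derivative_eq_intros F)
qed

lemma antiderivative_exp_bound_pos:
  fixes h H :: "real \<Rightarrow> real"
  assumes H: "\<And>t. (H has_real_derivative h t) (at t)" and H0: "H 0 = 0"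
    and K: "K > 0" and C: "0 \<le> C"
    and b: "\<And>t. h t \<le> C * exp (K * \<bar>t\<bar>)" and t: "0 \<le> t"
  shows "H t \<le> C / K * exp (K * t)"
proof -
  have "H t - C / K * exp (K * t) \<le> H 0 - C / K * exp (K * 0)"
  proof (rule DERIV_nonpos_imp_nonincreasing[OF t])
    fix s assume s: "0 \<le> s" "s \<le> t"
    have "((\<lambda>s. H s - C / K * exp (K * s)) has_real_derivative h s - C * exp (K * s)) (at s)"
      using K by (auto intro!: derivative_eq_intros H)
    then show "\<exists>y. ((\<lambda>s. H s - C / K * exp (K * s)) has_real_derivative y) (at s) \<and> y \<le> 0"
      using b[of s] s by (intro exI[of _ "h s - C * exp (K * s)"]) auto
  qed
  then show ?thesis using H0 K C by (simp add: divide_nonneg_pos) (smt (verit) divide_nonneg_pos)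
qed

text \<open>In the norm weighted by \<open>exp (K * \<bar>t\<bar>)\<close> an integration gains the
  factor \<open>1 / K\<close>, which makes the Picard map contract on the whole line at once, in
  both time directions.\<close>

lemma antiderivative_exp_bound:
  fixes h H :: "real \<Rightarrow> real"
  assumes H: "\<And>t. (H has_real_derivative h t) (at t)" and H0: "H 0 = 0"
    and K: "K > 0" and C: "0 \<le> C"
    and b: "\<And>t. \<bar>h t\<bar> \<le> C * exp (K * \<bar>t\<bar>)"
  shows "\<bar>H t\<bar> \<le> C / K * exp (K * \<bar>t\<bar>)"
proof -
  have H': "((\<lambda>t. H (- t)) has_real_derivative - h (- t)) (at t)" for t
    using H DERIV_mirror by blast
  have b1: "h t \<le> C * exp (K * \<bar>t\<bar>)" "- h t \<le> C * exp (K * \<bar>t\<bar>)" 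
    "h (- t) \<le> C * exp (K * \<bar>t\<bar>)" "- h (- t) \<le> C * exp (K * \<bar>t\<bar>)" for t
    using b[of t] b[of "-t"] by auto
  show ?thesis
  proof (cases "0 \<le> t")
    case True
    have "H t \<le> C / K * exp (K * t)"
      by (rule antiderivative_exp_bound_pos[OF H H0 K C b1(1) True])
    moreover have "- H t \<le> C / K * exp (K * t)"
      by (rule antiderivative_exp_bound_pos[OF DERIV_minus[OF H] _ K C b1(2) True]) (use H0 in simp)
    ultimately show ?thesis using True by auto
  next
    case False
    then have n: "0 \<le> - t" by simp
    have "H (- (- t)) \<le> C / K * exp (K * (- t))"
      by (rule antiderivative_exp_bound_pos[OF H' _ K C b1(4) n]) (use H0 in simp)
    moreover have "- H (- (- t)) \<le> C / K * exp (K * (- t))"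
      by (rule antiderivative_exp_bound_pos[OF DERIV_minus[OF H'] _ K C _ n]) (use H0 b1(3) in auto)
    ultimately show ?thesis using False by auto
  qed
qed

text \<open>Two integrations in the weighted norm give the contraction factor
  \<open>L / K^2\<close>, and \<open>K^2 = 2 * (L + 1)\<close> brings it below 1/2. The bound
  \<open>B\<close> makes the first step of the iteration finite in this norm.\<close>

lemma second_order_picard:
  fixes g :: "real \<Rightarrow> real \<Rightarrow> real" and x0 :: real
  assumes cont: "continuous_on UNIV (\<lambda>(t, x). g t x)"
    and lip: "\<And>t x y. \<bar>g t x - g t y\<bar> \<le> L * \<bar>x - y\<bar>"
    and bdd: "\<And>t x. \<bar>g t x\<bar> \<le> B"
  obtains y y' where "y 0 = x0" "y' 0 = 0"
    "\<And>t. (y has_real_derivative y' t) (at t)"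
    "\<And>t. (y' has_real_derivative g t (y t)) (at t)"
proof -
  obtain I :: "(real \<Rightarrow> real) \<Rightarrow> real \<Rightarrow> real" where
    I: "\<And>h. continuous_on UNIV h \<Longrightarrow> I h 0 = 0 \<and> (\<forall>t. (I h has_real_derivative h t) (at t))"
    using antiderivative_exists by metis
  have Ic: "continuous_on UNIV (I h)" if "continuous_on UNIV h" for h
    using I[OF that] by (meson DERIV_isCont continuous_at_imp_continuous_on)
  have gc: "continuous_on UNIV (\<lambda>s. g s (y s))" if "continuous_on UNIV y" for y
    using continuous_on_compose2[OF cont, of UNIV "\<lambda>s. (s, y s)"] that
    by (simp add: continuous_on_Pair continuous_on_id)
  have L0: "0 \<le> L" using lip[of 0 1 0] by simp
  have B0: "0 \<le> B" using bdd[of 0 0] by linarith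
  define K where "K = sqrt (2 * (L + 1))"
  have K0: "K > 0" and K2: "K * K = 2 * (L + 1)" using L0 by (auto simp: K_def)
  define P where "P = (\<lambda>y t. x0 + I (I (\<lambda>s. g s (y s))) t)"
  have Pc: "continuous_on UNIV (P y)" if "continuous_on UNIV y" for y
    unfolding P_def using that by (intro continuous_intros Ic gc)
  have contr: "\<bar>P y t - P z t\<bar> \<le> (C / 2) * exp (K * \<bar>t\<bar>)"
    if yc: "continuous_on UNIV y" and zc: "continuous_on UNIV z" and C: "0 \<le> C"
      and yz: "\<And>s. \<bar>y s - z s\<bar> \<le> C * exp (K * \<bar>s\<bar>)" for y z C t
  proof -
    let ?gy = "\<lambda>s. g s (y s)" and ?gz = "\<lambda>s. g s (z s)"
    have 1: "\<bar>I ?gy t - I ?gz t\<bar> \<le> (L * C) / K * exp (K * \<bar>t\<bar>)" for t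
    proof (rule antiderivative_exp_bound[where h = "\<lambda>s. ?gy s - ?gz s"])
      show "((\<lambda>t. I ?gy t - I ?gz t) has_real_derivative ?gy t - ?gz t) (at t)" for t
        using I[OF gc[OF yc]] I[OF gc[OF zc]] by (auto intro!: derivative_eq_intros)
      show "\<bar>?gy t - ?gz t\<bar> \<le> L * C * exp (K * \<bar>t\<bar>)" for t
        using order_trans[OF lip mult_left_mono[OF yz[of t] L0]] by (simp add: mult.assoc)
    qed (use I[OF gc[OF yc]] I[OF gc[OF zc]] K0 L0 C in auto)
    have "\<bar>I (I ?gy) t - I (I ?gz) t\<bar> \<le> (L * C / K) / K * exp (K * \<bar>t\<bar>)"
    proof (rule antiderivative_exp_bound[where h = "\<lambda>s. I ?gy s - I ?gz s"])
      show "((\<lambda>t. I (I ?gy) t - I (I ?gz) t) has_real_derivative I ?gy t - I ?gz t) (at t)" for t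
        using I[OF Ic[OF gc[OF yc]]] I[OF Ic[OF gc[OF zc]]] by (auto intro!: derivative_eq_intros)
    qed (use I[OF Ic[OF gc[OF yc]]] I[OF Ic[OF gc[OF zc]]] K0 L0 C 1 in auto)
    moreover have "(L * C / K) / K \<le> C / 2"
      using K0 L0 C K2 by (simp add: divide_divide_eq_left field_simps)
    then have "(L * C / K) / K * exp (K * \<bar>t\<bar>) \<le> C / 2 * exp (K * \<bar>t\<bar>)"
      by (rule mult_right_mono) simp
    ultimately show ?thesis unfolding P_def by linarith
  qed
  define y where "y = rec_nat (\<lambda>_. x0) (\<lambda>_ yn. P yn)"
  have y0: "y 0 = (\<lambda>_. x0)" and ySuc: "\<And>n. y (Suc n) = P (y n)" by (auto simp: y_def)
  have yc: "continuous_on UNIV (y n)" for n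
    by (induction n) (auto simp: y0 ySuc Pc)
  define D where "D = B / K / K"
  have D0: "0 \<le> D" using B0 K0 by (simp add: D_def)
  have step: "\<bar>y (Suc n) t - y n t\<bar> \<le> D * (1/2)^n * exp (K * \<bar>t\<bar>)" for n t
  proof (induction n arbitrary: t)
    case 0
    let ?g = "\<lambda>s. g s x0"
    have gc0: "continuous_on UNIV ?g" using gc[of "\<lambda>_. x0"] by simp
    have 1: "\<bar>I ?g t\<bar> \<le> B / K * exp (K * \<bar>t\<bar>)" for t
    proof (rule antiderivative_exp_bound)
      show "\<bar>g t x0\<bar> \<le> B * exp (K * \<bar>t\<bar>)" for t
      proof -
        have "B * 1 \<le> B * exp (K * \<bar>t\<bar>)" using B0 K0 by (intro mult_left_mono) auto
        then show ?thesis using bdd[of t x0] by linarith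
      qed
    qed (use I[OF gc0] B0 K0 in auto)
    have "\<bar>I (I ?g) t\<bar> \<le> B / K / K * exp (K * \<bar>t\<bar>)"
      by (rule antiderivative_exp_bound) (use I[OF Ic[OF gc0]] B0 K0 1 in auto)
    then show ?case by (simp add: y0 ySuc P_def D_def)
  next
    case (Suc n)
    show ?case
      using contr[OF yc yc _ Suc, of t] D0 by (simp add: ySuc)
  qed
  define lim where "lim = (\<lambda>t. x0 + (\<Sum>n. y (Suc n) t - y n t))"
  have sm: "summable (\<lambda>n. y (Suc n) t - y n t)" for t
  proof (rule summable_comparison_test')
    show "summable (\<lambda>n. D * (1/2)^n * exp (K * \<bar>t\<bar>))"
      by (intro summable_mult summable_mult2 summable_geometric) auto
    show "norm (y (Suc n) t - y n t) \<le> D * (1/2)^n * exp (K * \<bar>t\<bar>)" if "n \<ge> 0" for n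
      using step[of n t] by simp
  qed
  have psum: "(\<Sum>i<n. y (Suc i) t - y i t) = y n t - x0" for n t
    by (induction n) (auto simp: y0)
  have close: "\<bar>y n t - lim t\<bar> \<le> 2 * D * (1/2)^n * exp (K * \<bar>t\<bar>)" for n t
  proof -
    have s2: "summable (\<lambda>i. D * (1/2)^(i+n) * exp (K * \<bar>t\<bar>))"
      by (intro summable_mult summable_mult2 summable_ignore_initial_segment summable_geometric) auto
    have "lim t - y n t = (\<Sum>i. y (Suc (i + n)) t - y (i + n) t)"
      using suminf_split_initial_segment[OF sm[of t], of n] psum by (simp add: lim_def)
    then have "\<bar>y n t - lim t\<bar> = \<bar>\<Sum>i. y (Suc (i + n)) t - y (i + n) t\<bar>" by linarith
    also have "\<dots> \<le> (\<Sum>i. D * (1/2)^(i+n) * exp (K * \<bar>t\<bar>))"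
      using norm_suminf_le[of "\<lambda>i. y (Suc (i + n)) t - y (i + n) t", OF _ s2] step by simp
    also have "\<dots> = (\<Sum>i. (1/2)^i * (D * (1/2)^n * exp (K * \<bar>t\<bar>)))"
      by (simp add: power_add mult_ac)
    also have "\<dots> = (\<Sum>i. (1/2)^i) * (D * (1/2)^n * exp (K * \<bar>t\<bar>))"
      by (rule suminf_mult2[symmetric]) (simp add: summable_geometric)
    also have "(\<Sum>i. (1/2::real)^i) = 2" by (subst suminf_geometric) auto
    finally show ?thesis by (simp add: mult_ac)
  qed
  have vanish: "(\<lambda>n. C * (1/2)^n) \<longlonglongrightarrow> (0::real)" for C
    using tendsto_mult_right_zero[OF LIMSEQ_power_zero[of "1/2::real"], of C] by simp
  \<comment> \<open>Convergence is uniform only where the weight is bounded, hence the detour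
    through the intervals \<open>{t-1..t+1}\<close>.\<close>
  have limc: "continuous_on UNIV lim"
  proof -
    have "isCont lim t" for t
    proof -
      have "continuous_on {t-1..t+1} lim"
      proof (rule uniform_limit_theorem[where F = sequentially])
        show "\<forall>\<^sub>F n in sequentially. continuous_on {t-1..t+1} (y n)"
          using yc continuous_on_subset by (intro always_eventually) blast
        show "uniform_limit {t-1..t+1} y lim sequentially"
        proof (rule uniform_limitI)
          fix e :: real assume e: "e > 0"
          define C where "C = 2 * D * exp (K * (\<bar>t\<bar> + 1))"
          have "\<forall>\<^sub>F n in sequentially. C * (1/2)^n < e"
            using order_tendstoD(2)[OF vanish e] .
          then show "\<forall>\<^sub>F n in sequentially. \<forall>x\<in>{t-1..t+1}. dist (y n x) (lim x) < e"
          proof eventually_elim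
            case (elim n)
            show ?case
            proof
              fix x assume "x \<in> {t-1..t+1}"
              then have "K * \<bar>x\<bar> \<le> K * (\<bar>t\<bar> + 1)" using K0 by (intro mult_left_mono) auto
              then have "2 * D * (1/2)^n * exp (K * \<bar>x\<bar>) \<le> 2 * D * (1/2)^n * exp (K * (\<bar>t\<bar> + 1))"
                using D0 by (intro mult_left_mono) auto
              then show "dist (y n x) (lim x) < e"
                using close[of n x] elim by (simp add: dist_real_def C_def mult_ac)
            qed
          qed
        qed
      qed auto
      then show ?thesis by (rule continuous_on_interior) auto
    qed
    then show ?thesis by (simp add: continuous_at_imp_continuous_on)
  qed
  have fp: "lim t = P lim t" for t
  proof -
    have "(\<lambda>n. y n t) \<longlonglongrightarrow> lim t"
    proof (rule LIM_zero_cancel, rule tendsto_rabs_zero_cancel, rule tendsto_sandwich[where f = "\<lambda>_. 0"])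
      show "\<forall>\<^sub>F n in sequentially. \<bar>y n t - lim t\<bar> \<le> (2 * D * exp (K * \<bar>t\<bar>)) * (1/2)^n"
        using close by (intro always_eventually) (auto simp: mult_ac)
    qed (auto intro: vanish)
    then have A: "(\<lambda>n. y (Suc n) t) \<longlonglongrightarrow> lim t" by (rule LIMSEQ_Suc)
    have "(\<lambda>n. P (y n) t) \<longlonglongrightarrow> P lim t"
    proof (rule LIM_zero_cancel, rule tendsto_rabs_zero_cancel, rule tendsto_sandwich[where f = "\<lambda>_. 0"])
      show "\<forall>\<^sub>F n in sequentially. \<bar>P (y n) t - P lim t\<bar> \<le> (D * exp (K * \<bar>t\<bar>)) * (1/2)^n"
        using contr[OF yc limc _ close] D0 by (intro always_eventually) (auto simp: mult_ac)
    qed (auto intro: vanish)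
    then show ?thesis using A by (auto simp: ySuc intro: LIMSEQ_unique)
  qed
  show thesis
  proof (rule that)
    let ?g = "\<lambda>s. g s (lim s)"
    note I1 = I[OF gc[OF limc]] and I2 = I[OF Ic[OF gc[OF limc]]]
    show "lim 0 = x0" using fp[of 0] I2 by (simp add: P_def)
    show "I ?g 0 = 0" using I1 by simp
    show "(I ?g has_real_derivative g t (lim t)) (at t)" for t using I1 by simp
    have "(P lim has_real_derivative I ?g t) (at t)" for t
      unfolding P_def using I2 by (auto intro!: derivative_eq_intros)
    moreover have "P lim = lim" using fp by auto
    ultimately show "(lim has_real_derivative I ?g t) (at t)" for t by simp
  qed
qed

section \<open>Critical points of functions on the line\<close>

text \<open>One-sided on purpose: the extrema to be refuted may sit at the right end of an interval,
  where only earlier times are available for comparison.\<close>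

lemma convex_left_of_critical:
  fixes v v' :: "real \<Rightarrow> real"
  assumes v: "\<And>t. (v has_real_derivative v' t) (at t)"
    and v': "(v' has_real_derivative l) (at \<tau>)" "v' \<tau> = 0" "l > 0"
  shows "\<exists>d>0. \<forall>s. \<tau> - d < s \<and> s < \<tau> \<longrightarrow> v \<tau> < v s"
proof -
  obtain d where d: "d > 0" "\<And>h. 0 < h \<Longrightarrow> h < d \<Longrightarrow> v' (\<tau> - h) < v' \<tau>"
    using DERIV_pos_inc_left[OF v'(1) v'(3)] by blast
  have "v \<tau> < v s" if s: "\<tau> - d < s" "s < \<tau>" for s
  proof (rule DERIV_neg_imp_decreasing_open[OF s(2)])
    show "\<exists>y. (v has_real_derivative y) (at x) \<and> y < 0" if "s < x" "x < \<tau>" for x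
      using d(2)[of "\<tau> - x"] that s v v'(2) by auto
    show "continuous_on {s..\<tau>} v"
      using v DERIV_isCont continuous_at_imp_continuous_on by blast
  qed
  then show ?thesis using d(1) by blast
qed

lemma convex_right_of_critical:
  fixes v v' :: "real \<Rightarrow> real"
  assumes v: "\<And>t. (v has_real_derivative v' t) (at t)"
    and v': "(v' has_real_derivative l) (at \<tau>)" "v' \<tau> = 0" "l > 0"
  shows "\<exists>d>0. \<forall>s. \<tau> < s \<and> s < \<tau> + d \<longrightarrow> v \<tau> < v s"
proof -
  obtain d where d: "d > 0" "\<And>h. 0 < h \<Longrightarrow> h < d \<Longrightarrow> v' (\<tau> + h) > v' \<tau>"
    using DERIV_pos_inc_right[OF v'(1) v'(3)] by blast
  have "v \<tau> < v s" if s: "\<tau> < s" "s < \<tau> + d" for s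
  proof (rule DERIV_pos_imp_increasing_open[OF s(1)])
    show "\<exists>y. (v has_real_derivative y) (at x) \<and> y > 0" if "\<tau> < x" "x < s" for x
      using d(2)[of "x - \<tau>"] that s v v'(2) by auto
    show "continuous_on {\<tau>..s} v"
      using v DERIV_isCont continuous_at_imp_continuous_on by blast
  qed
  then show ?thesis using d(1) by blast
qed

text \<open>As long as \<open>w\<close> is nonnegative its slope increases from 0. To become
  negative later it would have to turn at a positive maximum, where convexity is violated.
  Nonnegativity on \<open>{0..r}\<close> is assumed separately because \<open>w''\<close> may vanish
  at 0.\<close>

lemma escape_above:
  fixes w w' w'' :: "real \<Rightarrow> real"
  assumes w: "\<And>t. (w has_real_derivative w' t) (at t)"
    and w': "\<And>t. (w' has_real_derivative w'' t) (at t)"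
    and init: "w 0 = 0" "w' 0 = 0" and r: "0 < r" "\<And>s. 0 \<le> s \<Longrightarrow> s \<le> r \<Longrightarrow> 0 \<le> w s"
    and convex: "\<And>s. 0 < s \<Longrightarrow> s \<le> T \<Longrightarrow> 0 \<le> w s \<Longrightarrow> 0 < w'' s"
    and t: "0 < t" "t \<le> T"
  shows "0 < w' t"
proof -
  have wc: "continuous_on A w" for A
    using w DERIV_isCont continuous_at_imp_continuous_on by blast
  have wc': "continuous_on A w'" for A
    using w' DERIV_isCont continuous_at_imp_continuous_on by blast
  have inc: "0 < w' s" if s: "0 < s" "s \<le> T" and nn: "\<And>x. 0 < x \<Longrightarrow> x \<le> s \<Longrightarrow> 0 \<le> w x" for s
  proof -
    have "w' 0 < w' s"
    proof (rule DERIV_pos_imp_increasing_open[OF s(1) _ wc'])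
      fix x assume x: "0 < x" "x < s"
      have "0 < w'' x" by (rule convex) (use x s nn in auto)
      then show "\<exists>y. (w' has_real_derivative y) (at x) \<and> 0 < y" using w' by blast
    qed
    then show ?thesis using init by simp
  qed
  have nonneg: "0 \<le> w s" if s: "0 < s" "s \<le> T" for s
  proof (rule ccontr)
    assume neg: "\<not> 0 \<le> w s"
    with r(2)[of s] s have rs: "r < s" by force
    have "w 0 < w r"
    proof (rule DERIV_pos_imp_increasing_open[OF r(1) _ wc])
      fix x assume x: "0 < x" "x < r"
      have "0 < w' x" by (rule inc) (use x rs s r(2) in auto)
      then show "\<exists>y. (w has_real_derivative y) (at x) \<and> 0 < y" using w by blast
    qed
    then have wr: "0 < w r" using init by simp
    obtain m where m: "0 \<le> m" "m \<le> s" and max: "\<And>x. 0 \<le> x \<Longrightarrow> x \<le> s \<Longrightarrow> w x \<le> w m"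
      using continuous_attains_sup[of "{0..s}" w] wc s by auto
    have wm: "0 < w m" using max[of r] wr rs r by auto
    have mi: "0 < m" "m < s" using m neg wm init by (auto simp: less_le)
    have "w' m = 0"
      by (rule DERIV_local_max[OF w, of "min m (s - m)"]) (use mi max in auto)
    then obtain d where "d > 0" "\<And>x. m - d < x \<Longrightarrow> x < m \<Longrightarrow> w m < w x"
      using convex_left_of_critical[OF w w', of m] convex[of m] wm mi s by (meson less_imp_le order_trans)
    then have "w m < w (max 0 (m - d/2))" using mi by auto
    moreover have "w (max 0 (m - d/2)) \<le> w m" by (rule max) (use mi \<open>d > 0\<close> in auto)
    ultimately show False by linarith
  qed
  show ?thesis by (rule inc[OF t]) (use nonneg t in auto)
qed

lemma first_nonpositive:
  fixes h :: "real \<Rightarrow> real"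
  assumes c: "continuous_on {s..t} h" and hs: "h s > 0" and st: "s \<le> t" "h t \<le> 0"
  obtains z where "s < z" "z \<le> t" "h z = 0" "\<And>x. s \<le> x \<Longrightarrow> x < z \<Longrightarrow> 0 < h x"
proof -
  let ?Z = "{z \<in> {s..t}. h z \<le> 0}"
  have "closed ?Z" by (intro continuous_on_closed_Collect_le c continuous_intros closed_real_atLeastAtMost)
  then have "compact ?Z"
    by (metis (no_types, lifting) bounded_closed_interval bounded_subset compact_eq_bounded_closed mem_Collect_eq subsetI)
  moreover have "t \<in> ?Z" using st by auto
  ultimately obtain z where z: "z \<in> ?Z" and zmin: "\<And>y. y \<in> ?Z \<Longrightarrow> z \<le> y"
    using compact_attains_inf[of ?Z] by blast
  have sz: "s < z" using z hs by (auto simp: less_le)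
  have pos: "h y > 0" if "s \<le> y" "y < z" for y
    using zmin[of y] that z by force
  have "h z = 0"
  proof (rule ccontr)
    assume "h z \<noteq> 0"
    then have "h z < 0" using z by auto
    then obtain y where "s \<le> y" "y \<le> z" "h y = 0"
      using IVT2'[of h z 0 s] hs sz z continuous_on_subset[OF c, of "{s..z}"] by auto
    then show False using pos[of y] \<open>h z < 0\<close> by (cases "y = z") auto
  qed
  then show thesis using that sz z pos by auto
qed

text \<open>The first zero after \<open>s\<close> would be approached through positive values,
  whereas \<open>up\<close> says that every zero is approached through negative ones.\<close>

lemma up_crossing_stays_positive:
  fixes h :: "real \<Rightarrow> real"
  assumes c: "continuous_on {s..t} h" and hs: "h s > 0"
    and up: "\<And>z. s < z \<Longrightarrow> z \<le> t \<Longrightarrow> h z = 0 \<Longrightarrow> \<exists>d>0. \<forall>x. z - d < x \<and> x < z \<longrightarrow> h x < 0"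
    and x: "s \<le> x" "x \<le> t"
  shows "h x > 0"
proof (rule ccontr)
  assume "\<not> h x > 0"
  then obtain z where z: "s < z" "z \<le> x" "h z = 0" and pos: "\<And>y. s \<le> y \<Longrightarrow> y < z \<Longrightarrow> 0 < h y"
    using first_nonpositive[of s x h] continuous_on_subset[OF c, of "{s..x}"] hs x by auto
  then obtain d where d: "d > 0" "\<And>x. z - d < x \<Longrightarrow> x < z \<Longrightarrow> h x < 0"
    using up[of z] x by auto
  have "h (max s (z - d/2)) < 0" using d z by (intro d(2)) auto
  moreover have "h (max s (z - d/2)) > 0" using d z by (intro pos) auto
  ultimately show False by linarith
qed

text \<open>An angle that passes the level \<open>(2 j - 1) \<pi>\<close> only upwards attains it at most once, so it counts
  the zeros of its sine on the negative cosine side.\<close>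

locale clock =
  fixes \<theta> x y :: "real \<Rightarrow> real" and S :: real
  assumes S: "0 \<le> S" and cont: "continuous_on {0..S} \<theta>" and start: "\<theta> 0 = 0"
    and xsgn: "\<And>t. 0 \<le> t \<Longrightarrow> t \<le> S \<Longrightarrow> sgn (x t) = sgn (sin (\<theta> t))"
    and ysgn: "\<And>t. 0 \<le> t \<Longrightarrow> t \<le> S \<Longrightarrow> sgn (y t) = sgn (cos (\<theta> t))"
    and down: "\<And>t. 0 < t \<Longrightarrow> t \<le> S \<Longrightarrow> x t = 0 \<Longrightarrow> y t < 0 \<Longrightarrow>
      \<exists>l. (x has_real_derivative l) (at t) \<and> l < 0"
begin

definition level :: "int \<Rightarrow> real" where "level j = (2 * of_int j - 1) * pi"

lemma sin_level: "sin (level j) = 0" and cos_level: "cos (level j) = -1"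
proof -
  have "level j = of_int (2 * j) * pi - pi" by (simp add: level_def algebra_simps)
  moreover have "cos (of_int (2 * j) * pi) = 1" "sin (of_int (2 * j) * pi) = 0"
    using cos_int_2pin[of j] sin_int_2pin[of j] by (simp_all add: mult_ac)
  ultimately show "sin (level j) = 0" "cos (level j) = -1" 
    by (simp_all add: sin_diff cos_diff)
qed

lemma sin_shift: "sin (\<theta> t - level j) = - sin (\<theta> t)"
  by (simp add: sin_diff sin_level cos_level)

lemma level_iff:
  assumes "0 \<le> t" "t \<le> S"
  shows "(x t = 0 \<and> y t < 0) \<longleftrightarrow> (\<exists>j. \<theta> t = level j)"
proof
  assume a: "x t = 0 \<and> y t < 0"
  then have s: "sin (\<theta> t) = 0" and c: "cos (\<theta> t) < 0"
    using xsgn[OF assms] ysgn[OF assms] by (auto simp: sgn_if split: if_splits)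
  then have "cos (\<theta> t) = -1" using sin_zero_abs_cos_one[OF s] by auto
  then obtain n :: int where "\<theta> t = (2 * of_int n + 1) * pi"
    using cos_eq_minus1[of "\<theta> t"] by (auto simp: algebra_simps)
  then show "\<exists>j. \<theta> t = level j" by (intro exI[of _ "n + 1"]) (simp add: level_def)
next
  assume "\<exists>j. \<theta> t = level j"
  then have "sin (\<theta> t) = 0" "cos (\<theta> t) < 0" using sin_level cos_level by auto
  then show "x t = 0 \<and> y t < 0"
    using xsgn[OF assms] ysgn[OF assms] by (auto simp: sgn_if split: if_splits)
qed

text \<open>Within distance pi of a level the sign of the sine tells on which side the angle lies,
  and \<open>x\<close> falls strictly through 0 there: its sign, hence that of the sine, changes
  from plus to minus.\<close>

lemma local_crossing:
  assumes t: "0 < t" "t \<le> S" and lev: "\<theta> t = level j"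
  shows "\<exists>d>0. (\<forall>s. t - d < s \<and> s < t \<and> 0 \<le> s \<longrightarrow> \<theta> s < level j) \<and>
               (\<forall>s. t < s \<and> s < t + d \<and> s \<le> S \<longrightarrow> level j < \<theta> s)"
proof -
  have xy: "x t = 0" "y t < 0" using level_iff[of t] t lev by auto
  then obtain l where l: "(x has_real_derivative l) (at t)" "l < 0" using down t by blast
  obtain d1 where d1: "d1 > 0" "\<And>h. 0 < h \<Longrightarrow> h < d1 \<Longrightarrow> x (t - h) > 0"
    using DERIV_neg_dec_left[OF l] xy by auto
  obtain d2 where d2: "d2 > 0" "\<And>h. 0 < h \<Longrightarrow> h < d2 \<Longrightarrow> x (t + h) < 0"
    using DERIV_neg_dec_right[OF l] xy by auto
  obtain d3 where d3: "d3 > 0" "\<And>s. 0 \<le> s \<Longrightarrow> s \<le> S \<Longrightarrow> dist s t < d3 \<Longrightarrow> dist (\<theta> s) (\<theta> t) < pi"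
    using cont[unfolded continuous_on_iff, rule_format, of t pi] t by auto
  let ?d = "min d1 (min d2 d3)"
  have "\<theta> s < level j" if s: "t - ?d < s" "s < t" "0 \<le> s" for s
  proof -
    have "x s > 0" using d1(2)[of "t - s"] s by auto
    then have "sin (\<theta> s) > 0" using xsgn[of s] s t by (auto simp: sgn_if split: if_splits)
    then have "sin (\<theta> s - level j) < 0" by (simp add: sin_shift)
    moreover have "\<bar>\<theta> s - level j\<bar> < pi" using d3(2)[of s] s t lev by (auto simp: dist_real_def)
    ultimately show ?thesis using sin_ge_zero[of "\<theta> s - level j"]
      by (cases "0 \<le> \<theta> s - level j") linarith+
  qed
  moreover have "level j < \<theta> s" if s: "t < s" "s < t + ?d" "s \<le> S" for s
  proof -
    have "x s < 0" using d2(2)[of "s - t"] s by auto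
    then have "sin (\<theta> s) < 0" using xsgn[of s] s t by (auto simp: sgn_if split: if_splits)
    then have "sin (level j - \<theta> s) < 0" using sin_shift[of s j] sin_minus[of "\<theta> s - level j"] by simp
    moreover have "\<bar>\<theta> s - level j\<bar> < pi" using d3(2)[of s] s t lev by (auto simp: dist_real_def)
    ultimately show ?thesis using sin_ge_zero[of "level j - \<theta> s"]
      by (cases "0 \<le> level j - \<theta> s") linarith+
  qed
  ultimately show ?thesis using d1(1) d2(1) d3(1) by (intro exI[of _ ?d]) auto
qed

lemma above_after:
  assumes t: "0 < t" "t \<le> S" and lev: "\<theta> t = level j" and s: "t < s" "s \<le> S"
  shows "level j < \<theta> s"
proof -
  obtain d where d: "d > 0" "\<And>s. t < s \<Longrightarrow> s < t + d \<Longrightarrow> s \<le> S \<Longrightarrow> level j < \<theta> s"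
    using local_crossing[OF t lev] by blast
  define p where "p = min s (t + d/2)"
  have p: "t < p" "p \<le> s" "level j < \<theta> p" using d s unfolding p_def by auto
  have "0 < \<theta> s - level j"
  proof (rule up_crossing_stays_positive[where s = p and t = s and x = s])
    show "continuous_on {p..s} (\<lambda>s. \<theta> s - level j)"
      using p t s by (intro continuous_intros continuous_on_subset[OF cont]) auto
    fix z assume z: "p < z" "z \<le> s" "\<theta> z - level j = 0"
    then obtain e where "e > 0" and e: "\<And>s. z - e < s \<Longrightarrow> s < z \<Longrightarrow> 0 \<le> s \<Longrightarrow> \<theta> s < level j"
      using local_crossing[of z j] p t s by auto
    then show "\<exists>d>0. \<forall>x. z - d < x \<and> x < z \<longrightarrow> \<theta> x - level j < 0"
      using z p t by (intro exI[of _ "min e z"]) auto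
  qed (use p in auto)
  then show ?thesis by simp
qed

text \<open>A value at or above the level before \<open>t\<close> would force an earlier passage by
  the intermediate value theorem, after which the angle stays above, although just before
  \<open>t\<close> it is below. A passage at time 0 is excluded because 0 is not a level.\<close>

lemma below_before:
  assumes t: "0 < t" "t \<le> S" and lev: "\<theta> t = level j" and s: "0 \<le> s" "s < t"
  shows "\<theta> s < level j"
proof -
  obtain d where d: "d > 0" "\<And>s. t - d < s \<Longrightarrow> s < t \<Longrightarrow> 0 \<le> s \<Longrightarrow> \<theta> s < level j"
    using local_crossing[OF t lev] by blast
  define p where "p = max s (t - d/2)"
  have p: "s \<le> p" "p < t" "\<theta> p < level j" using d s unfolding p_def by auto
  have no: "\<theta> z \<noteq> level j" if "0 < z" "z \<le> p" for z
  proof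
    assume "\<theta> z = level j"
    then have "level j \<le> \<theta> p" using above_after[of z j p] that p t by (cases "z = p") auto
    then show False using p by simp
  qed
  show ?thesis
  proof (rule ccontr)
    assume "\<not> \<theta> s < level j"
    then obtain z where z: "s \<le> z" "z \<le> p" "\<theta> z = level j"
      using IVT2'[of \<theta> p "level j" s] p s t continuous_on_subset[OF cont, of "{s..p}"] by auto
    with no[of z] s have "z = 0" by force
    moreover have "level j \<noteq> 0"
      using cos_level[of j] by auto
    ultimately show False using z start by simp
  qed
qed

lemma levels_positive:
  assumes t: "0 < t" "t \<le> S" and lev: "\<theta> t = level j"
  shows "1 \<le> j" "level j \<le> \<theta> S"
proof -
  have "0 < level j" using below_before[OF t lev, of 0] t start by simp
  then have "0 < 2 * real_of_int j - 1" by (simp add: level_def zero_less_mult_iff)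
  then show "1 \<le> j" by linarith
  show "level j \<le> \<theta> S" using above_after[OF t lev, of S] t lev by (cases "t = S") auto
qed

lemma level_mono: "level i \<le> level j \<longleftrightarrow> i \<le> j"
  by (simp add: level_def)

definition ticks :: "real set" where
  "ticks = {t \<in> {0<..S}. x t = 0 \<and> y t < 0}"

lemma inj_ticks: "inj_on \<theta> ticks"
proof (rule inj_onI)
  fix s t assume s: "s \<in> ticks" and t: "t \<in> ticks" and eq: "\<theta> s = \<theta> t"
  obtain j where "\<theta> s = level j" using s level_iff[of s] by (auto simp: ticks_def)
  then show "s = t"
    using above_after[of s j t] above_after[of t j s] s t eq by (force simp: ticks_def)
qed

text \<open>The angle is injective on ticks and maps them onto the levels 1 to M: continuity gives
  each of these levels, and a level once passed stays below the final angle.\<close>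

lemma card_ticks_eq:
  assumes M: "\<theta> S = level M" "0 < M"
  shows "card ticks = nat M"
proof -
  have "\<theta> ` ticks = level ` {1..M}"
  proof
    show "\<theta> ` ticks \<subseteq> level ` {1..M}"
    proof
      fix a assume "a \<in> \<theta> ` ticks"
      then obtain t where t: "0 < t" "t \<le> S" "x t = 0" "y t < 0" and a: "a = \<theta> t" by (auto simp: ticks_def)
      then obtain j where j: "\<theta> t = level j" using level_iff[of t] by auto
      show "a \<in> level ` {1..M}"
        using levels_positive[OF t(1,2) j] M level_mono j a by auto
    qed
    show "level ` {1..M} \<subseteq> \<theta> ` ticks"
    proof
      fix a assume "a \<in> level ` {1..M}"
      then obtain j where j: "1 \<le> j" "j \<le> M" and a: "a = level j" by auto
      have "0 < level j" using j by (simp add: level_def)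
      then obtain t where t: "0 \<le> t" "t \<le> S" "\<theta> t = level j"
        using IVT'[of \<theta> 0 "level j" S] cont start S M j level_mono by auto
      then have "0 < t" using \<open>0 < level j\<close> start by (cases "t = 0") auto
      then show "a \<in> \<theta> ` ticks" using t a level_iff[of t] unfolding ticks_def by force
    qed
  qed
  then have "card ticks = card (level ` {1..M})" using card_image[OF inj_ticks] by simp
  also have "\<dots> = card {1..M}" by (rule card_image) (auto intro!: inj_onI simp: level_def)
  finally show ?thesis by simp
qed

text \<open>Pigeonhole for the right end of the shooting interval: distinct ticks occupy distinct
  positive levels, all at most the final angle. A finite subset suffices, so \<open>ticks\<close>
  itself need not be known to be finite.\<close>

lemma ticks_lower_bound:
  assumes A: "A \<subseteq> ticks" "finite A" and M: "1 \<le> M" "nat M \<le> card A"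
  shows "level M \<le> \<theta> S"
proof (rule ccontr)
  assume n: "\<not> level M \<le> \<theta> S"
  have "\<theta> ` A \<subseteq> level ` {1..M - 1}"
  proof
    fix a assume "a \<in> \<theta> ` A"
    then obtain t where t: "0 < t" "t \<le> S" "x t = 0" "y t < 0" and a: "a = \<theta> t"
      using A by (auto simp: ticks_def)
    then obtain j where j: "\<theta> t = level j" using level_iff[of t] by auto
    have "level j < level M" using levels_positive[OF t(1,2) j] n by simp
    then have "j < M" using level_mono[of M j] by simp
    then show "a \<in> level ` {1..M - 1}" using levels_positive[OF t(1,2) j] j a by auto
  qed
  then have "card (\<theta> ` A) \<le> card (level ` {1..M - 1})" by (intro card_mono) auto
  also have "\<dots> \<le> card {1..M - 1}" by (rule card_image_le) auto
  finally have "card (\<theta> ` A) \<le> nat (M - 1)" by simp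
  moreover have "card (\<theta> ` A) = card A" using inj_on_subset[OF inj_ticks A(1)] by (rule card_image)
  ultimately show False using M by linarith
qed

end

section \<open>The equation in stretched time\<close>

text \<open>The roots at time 0 are \<open>a\<close>, \<open>b\<close> and \<open>- (a + b)\<close>;
  those at pi are \<open>a + b\<close>, \<open>- b\<close> and \<open>- a\<close>. The assumption
  \<open>gap\<close> is \<open>- a + sqrt (2 * b * (a + b)) < - b\<close> after squaring, i.e. the
  homoclinic orbit dips below the middle root at pi.\<close>

locale duffing =
  fixes a b lam :: real
  assumes b_pos: "0 < b" and roots: "a * b * (a + b) = 1"
    and lam_eq: "lam = a^2 + a * b + b^2" and gap: "4 * a * b + b^2 < a^2" and a_pos: "0 < a"
begin

definition f :: "real \<Rightarrow> real" where "f u = u^3 - lam * u"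
definition G :: "real \<Rightarrow> real" where "G u = u^4 / 4 - lam * u^2 / 2"
text \<open>Beyond the largest root \<open>a + b\<close> at time pi by a margin of 1, so that at and
  outside the clamping bounds the force has a strict sign at all times.\<close>

definition R :: real where "R = a + b + 1"

text \<open>Clamping the argument to \<open>[-R, R]\<close> makes the equation globally Lipschitz, so no solution blows up;
  the solutions that matter stay inside the interval.\<close>

definition F :: "real \<Rightarrow> real \<Rightarrow> real" where "F t u = f (max (-R) (min R u)) + cos t"
text \<open>The positive critical point of \<open>f\<close>.\<close>

definition rho :: real where "rho = sqrt (lam / 3)"

lemma b_less_a: "4 * b < a"
proof -
  have "0 < b^2" using b_pos by simp
  then have "4 * a * b < a^2" using gap by linarith
  then have "a * (4 * b) < a * a" by (simp add: power2_eq_square mult_ac)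
  then show ?thesis using a_pos by simp
qed

lemma lam_pos: "0 < lam" using b_pos a_pos by (simp add: lam_eq add_pos_pos)

lemma f_plus_one: "f u + 1 = (u - a) * (u - b) * (u + a + b)"
  unfolding f_def unfolding lam_eq roots[symmetric]
  by (simp add: power2_eq_square power3_eq_cube algebra_simps)

lemma f_minus_one: "f u - 1 = (u + a) * (u + b) * (u - a - b)"
  unfolding f_def unfolding lam_eq roots[symmetric]
  by (simp add: power2_eq_square power3_eq_cube algebra_simps)

lemma f_odd: "f (- u) = - f u" by (simp add: f_def)

lemma rho: "0 < rho" "3 * rho^2 = lam" "b < rho" "rho < a"
proof -
  show r0: "0 < rho" and r: "3 * rho^2 = lam" using lam_pos by (auto simp: rho_def)
  have "b * b < a * b" "a * b < a * a" using b_less_a b_pos a_pos by auto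
  then have "3 * b^2 < lam" unfolding lam_eq power2_eq_square by linarith
  then have "b^2 < rho^2" using r by simp
  then show "b < rho" using r0 by (meson less_imp_le power_less_imp_less_base)
  have "a * b < a * a" "b * b < a * b" using b_less_a b_pos a_pos by auto
  then have "lam < 3 * a^2" unfolding lam_eq power2_eq_square by linarith
  then have "rho^2 < a^2" using r by simp
  then show "rho < a" using a_pos by (meson less_imp_le power_less_imp_less_base)
qed

lemma f_diff: "f y - f x = (y - x) * (x^2 + x * y + y^2 - lam)"
  by (simp add: f_def power2_eq_square power3_eq_cube algebra_simps)

lemma f_increasing: assumes "rho \<le> x" "x < y" shows "f x < f y"
proof -
  have "rho * rho \<le> x * x" "rho * rho \<le> x * y" "rho * rho < y * y"
    using assms rho(1) by (auto intro!: mult_mono mult_strict_mono)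
  then have "0 < x^2 + x * y + y^2 - lam" using rho(2) by (simp add: power2_eq_square)
  then have "0 < f y - f x" unfolding f_diff using assms(2) by (intro mult_pos_pos) auto
  then show ?thesis by simp
qed

lemma f_increasing_neg: assumes "y \<le> - rho" "x < y" shows "f x < f y"
  using f_increasing[of "- y" "- x"] assms by (simp add: f_odd)

lemma f_decreasing: assumes "- rho \<le> x" "x < y" "y \<le> rho" shows "f y < f x"
proof -
  have "x^2 + x * y + y^2 < 3 * rho^2"
  proof -
    have "\<bar>x\<bar> \<le> rho" "\<bar>y\<bar> \<le> rho" using assms by auto
    then have x2: "x^2 \<le> rho^2" and y2: "y^2 \<le> rho^2"
      by (auto intro: abs_le_square_iff[THEN iffD1] simp: rho(1) less_imp_le)
    have "0 < (y - x)^2" using assms(2) by simp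
    then have "2 * (x * y) < x^2 + y^2" by (simp add: power2_diff mult_ac)
    then show ?thesis using x2 y2 by linarith
  qed
  then have "x^2 + x * y + y^2 - lam < 0" using rho(2) by simp
  then have "(y - x) * (x^2 + x * y + y^2 - lam) < 0" using assms(2) by (intro mult_pos_neg) auto
  then show ?thesis using f_diff[of y x] by linarith
qed

lemma R_pos: "0 < R" using a_pos b_pos by (simp add: R_def)

lemma f_R: "1 < f R"
proof -
  have "0 < (R + a) * (R + b) * (R - a - b)" using a_pos b_pos by (simp add: R_def add_pos_pos)
  then show ?thesis using f_minus_one[of R] by linarith
qed

lemma F_inside: "\<bar>u\<bar> \<le> R \<Longrightarrow> F t u = f u + cos t" by (auto simp: F_def)

lemma F_above: "R \<le> u \<Longrightarrow> 0 < F t u"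
proof -
  assume "R \<le> u"
  then have "F t u = f R + cos t" using R_pos by (simp add: F_def)
  then show ?thesis using f_R cos_ge_minus_one[of t] by linarith
qed

lemma F_below: "u \<le> - R \<Longrightarrow> F t u < 0"
proof -
  assume "u \<le> - R"
  then have "F t u = - f R + cos t" using R_pos by (simp add: F_def f_odd)
  then show ?thesis using f_R cos_le_one[of t] by linarith
qed

definition lip :: real where "lip = 3 * R^2 + lam"

lemma lip_nonneg: "0 \<le> lip" using lam_pos by (simp add: lip_def)

lemma F_lipschitz: "\<bar>F t x - F t y\<bar> \<le> lip * \<bar>x - y\<bar>"
proof -
  define c where "c = (\<lambda>u. max (-R) (min R u))"
  have c: "\<bar>c u\<bar> \<le> R" for u using R_pos by (auto simp: c_def)
  have "\<bar>c x * c x\<bar> \<le> R * R" "\<bar>c y * c y\<bar> \<le> R * R" "\<bar>c y * c x\<bar> \<le> R * R"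
    unfolding abs_mult using R_pos by (intro mult_mono c abs_ge_zero less_imp_le[OF R_pos])+
  then have 1: "\<bar>(c y)^2 + c y * c x + (c x)^2 - lam\<bar> \<le> lip"
    using lam_pos unfolding lip_def power2_eq_square by linarith
  have 2: "\<bar>c x - c y\<bar> \<le> \<bar>x - y\<bar>" by (auto simp: c_def max_def min_def)
  have "\<bar>F t x - F t y\<bar> = \<bar>f (c x) - f (c y)\<bar>" by (simp add: F_def c_def)
  also have "\<dots> = \<bar>(c y)^2 + c y * c x + (c x)^2 - lam\<bar> * \<bar>c x - c y\<bar>"
    unfolding f_diff abs_mult by simp
  also have "\<dots> \<le> lip * \<bar>x - y\<bar>" using 1 2 lip_nonneg by (intro mult_mono) auto
  finally show ?thesis .
qed

lemma F_bounded: "\<bar>F t u\<bar> \<le> \<bar>f 0\<bar> + lip * R + 1"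
proof -
  define c where "c = max (-R) (min R u)"
  have c: "\<bar>c\<bar> \<le> R" using R_pos by (auto simp: c_def)
  have "F t u = f c + cos t" by (simp add: F_def c_def)
  moreover have "\<bar>f c - f 0\<bar> \<le> lip * \<bar>c\<bar>"
    using F_lipschitz[of 0 c 0] F_inside[OF c, of 0] F_inside[of 0 0] R_pos by simp
  moreover have "lip * \<bar>c\<bar> \<le> lip * R" using c lip_nonneg by (intro mult_left_mono) auto
  moreover have "\<bar>cos t\<bar> \<le> 1" by simp
  ultimately show ?thesis by linarith
qed

lemma F_cos_diff: "\<bar>F s x - F t x\<bar> = \<bar>cos s - cos t\<bar>"
  by (simp add: F_def)

lemma solution_exists:
  "\<exists>v v'. v 0 = \<alpha> \<and> v' 0 = 0 \<and> (\<forall>t. (v has_real_derivative v' t) (at t)) \<and>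
     (\<forall>t. (v' has_real_derivative F (\<epsilon> * t) (v t)) (at t))"
proof -
  have "continuous_on UNIV (\<lambda>(t, x). F (\<epsilon> * t) x)"
    unfolding F_def f_def case_prod_unfold by (intro continuous_intros)
  then show ?thesis
    by (rule second_order_picard[OF _ F_lipschitz F_bounded, of _ \<alpha>]) blast
qed

lemma G_deriv: "(G has_real_derivative f u) (at u)"
  unfolding G_def f_def by (auto intro!: derivative_eq_intros simp: power3_eq_cube)

text \<open>Since \<open>f (- b) = 1\<close>, the point \<open>- b\<close> is critical for the
  potential \<open>G u - u\<close> frozen at time pi; this is the source of the double factor
  \<open>(c + b)^2\<close>. The gap is what keeps an orbit with minimum \<open>c\<close> from
  turning on the rising side of the barrier.\<close>

lemma potential_gap_pi:
  assumes "- (a + b) \<le> c" "c < - b"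
  shows "G c - c < G (- b) + b"
proof -
  have "(G c - c) - (G (-b) + b) = (c + b)^2 * (c^2 - 2 * b * c + 3 * b^2 - 2 * lam) / 4"
  proof -
    have "1 = a * b * (a + b)" using roots by simp
    then have "(G c - c) - (G (-b) + b) = G c - (a * b * (a + b)) * c - (G (-b) + (a * b * (a + b)) * b)"
      by simp
    also have "\<dots> = (c + b)^2 * (c^2 - 2 * b * c + 3 * b^2 - 2 * lam) / 4"
      unfolding G_def unfolding lam_eq by (simp add: power2_eq_square power4_eq_xxxx field_simps)
    finally show ?thesis .
  qed
  moreover have "c^2 - 2 * b * c + 3 * b^2 - 2 * lam < 0"
  proof -
    \<comment> \<open>The sign bounds \<open>c^2\<close> by its chord over the interval from
      \<open>- (a + b)\<close> to \<open>- b\<close>; the resulting linear function is largest at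
      \<open>- (a + b)\<close>, where \<open>4 * b < a\<close> finishes.\<close>
    have "(c + (a + b)) * (c + b) \<le> 0" using assms a_pos by (intro mult_nonneg_nonpos) auto
    then have "c^2 \<le> - (a + 2 * b) * c - (a + b) * b" by (simp add: power2_eq_square algebra_simps)
    moreover have "(a + 4 * b) * (- c) \<le> (a + 4 * b) * (a + b)"
      using assms a_pos b_pos by (intro mult_left_mono) auto
    moreover have "a * (4 * b) < a * a" "(4 * b) * b < a * b" "0 < a * b"
      using b_less_a a_pos b_pos by (auto intro!: mult_strict_left_mono mult_strict_right_mono)
    ultimately show ?thesis unfolding lam_eq by (simp add: power2_eq_square algebra_simps)
  qed
  moreover have "0 < (c + b)^2" using assms by simp
  ultimately have "(G c - c) - (G (-b) + b) < 0"
    by (metis divide_less_0_iff mult_pos_neg zero_less_numeral)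
  then show ?thesis by simp
qed

end

section \<open>Orbits starting in the shooting interval: bounds and energy\<close>

locale orbit = duffing +
  fixes \<epsilon> \<alpha> :: real and v v' :: "real \<Rightarrow> real"
  assumes eps: "0 < \<epsilon>" and \<alpha>: "- sqrt lam \<le> \<alpha>" "\<alpha> < - b"
    and init: "v 0 = \<alpha>" "v' 0 = 0"
    and v: "\<And>t. (v has_real_derivative v' t) (at t)"
    and v': "\<And>t. (v' has_real_derivative F (\<epsilon> * t) (v t)) (at t)"
begin

definition S :: real where "S = pi / \<epsilon>"

lemma S_pos: "0 < S" and eps_S: "\<epsilon> * S = pi" using eps by (auto simp: S_def)

lemma eps_le_pi: "t \<le> S \<Longrightarrow> \<epsilon> * t \<le> pi"
  using eps eps_S by (metis mult_left_mono less_imp_le)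

lemma v_cont: "continuous_on A v"
  using v DERIV_isCont continuous_at_imp_continuous_on by blast

lemma v'_cont: "continuous_on A v'"
  using v' DERIV_isCont continuous_at_imp_continuous_on by blast

lemma alpha_lower: "- (a + b) < \<alpha>"
proof -
  have "lam < (a + b)^2" using a_pos b_pos by (simp add: lam_eq power2_eq_square algebra_simps)
  then have "sqrt lam < a + b" using a_pos b_pos by (intro real_less_lsqrt) auto
  then show ?thesis using \<alpha> by linarith
qed

lemma alpha_inside: "\<bar>\<alpha>\<bar> < R" using alpha_lower \<alpha> b_pos a_pos by (auto simp: R_def)

text \<open>If v reached R, its maximum over \<open>{0..t}\<close> would be critical, even when
  attained at \<open>t\<close>, yet the force there points upwards; symmetrically for - R. Hence the
  clamp is inactive up to any critical time.\<close>

lemma bounded_before_critical: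
  assumes t: "0 < t" "v' t = 0" and s: "0 \<le> s" "s \<le> t"
  shows "\<bar>v s\<bar> < R"
proof -
  have "v s < R"
  proof (rule ccontr)
    assume n: "\<not> v s < R"
    obtain m where m: "0 \<le> m" "m \<le> t" and max: "\<And>x. 0 \<le> x \<Longrightarrow> x \<le> t \<Longrightarrow> v x \<le> v m"
      using continuous_attains_sup[of "{0..t}" v] v_cont t by auto
    have vm: "R \<le> v m" using max[OF s] n by simp
    then have m0: "0 < m" using m alpha_inside init by (cases "m = 0") auto
    have "v' m = 0"
    proof (cases "m = t")
      case False
      then show ?thesis
        by (intro DERIV_local_max[OF v, of "min m (t - m)"]) (use m0 m max in auto)
    qed (use t in simp)
    then obtain d where d: "d > 0" "\<And>x. m - d < x \<Longrightarrow> x < m \<Longrightarrow> v m < v x"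
      using convex_left_of_critical[OF v v' _ F_above[OF vm]] by meson
    have "v m < v (max 0 (m - d/2))" using d m0 by auto
    moreover have "v (max 0 (m - d/2)) \<le> v m" by (rule max) (use m d in auto)
    ultimately show False by linarith
  qed
  moreover have "- R < v s"
  proof (rule ccontr)
    assume n: "\<not> - R < v s"
    obtain m where m: "0 \<le> m" "m \<le> t" and min: "\<And>x. 0 \<le> x \<Longrightarrow> x \<le> t \<Longrightarrow> v m \<le> v x"
      using continuous_attains_inf[of "{0..t}" v] v_cont t by auto
    have vm: "v m \<le> - R" using min[OF s] n by simp
    then have m0: "0 < m" using m alpha_inside init by (cases "m = 0") auto
    have "v' m = 0"
    proof (cases "m = t")
      case False
      then show ?thesis
        by (intro DERIV_local_min[OF v, of "min m (t - m)"]) (use m0 m min in auto)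
    qed (use t in simp)
    then have "- v' m = 0" by simp
    moreover have "- F (\<epsilon> * m) (v m) > 0" using F_below[OF vm] by simp
    ultimately obtain d where d: "d > 0" "\<And>x. m - d < x \<Longrightarrow> x < m \<Longrightarrow> - v m < - v x"
      using convex_left_of_critical[OF DERIV_minus[OF v] DERIV_minus[OF v'], of m] by auto
    have "v (max 0 (m - d/2)) < v m" using d(2)[of "max 0 (m - d/2)"] d(1) m0 by auto
    moreover have "v m \<le> v (max 0 (m - d/2))" by (rule min) (use m d in auto)
    ultimately show False by linarith
  qed
  ultimately show ?thesis by auto
qed

text \<open>Pairing the forcing with the displacement \<open>v - c\<close> leaves the single term
  \<open>\<epsilon> * sin (\<epsilon> * x) * (v x - c)\<close> in the derivative of the energy. It
  is nonnegative on the half period as long as v stays above its starting value.\<close>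

lemma energy:
  assumes st: "0 \<le> s" "s \<le> t" "t \<le> S" and c: "v s = c" "v' s = 0"
    and range: "\<And>x. s \<le> x \<Longrightarrow> x \<le> t \<Longrightarrow> \<bar>v x\<bar> \<le> R \<and> c \<le> v x"
  shows "G (v t) - G c + (v t - c) * cos (\<epsilon> * t) \<le> (v' t)^2 / 2"
proof -
  define Q where "Q = (\<lambda>x. (v' x)^2 / 2 - (G (v x) - G c) - (v x - c) * cos (\<epsilon> * x))"
  have "Q s \<le> Q t"
  proof (rule DERIV_nonneg_imp_nondecreasing[OF st(2)])
    fix x assume x: "s \<le> x" "x \<le> t"
    have "(Q has_real_derivative (v' x * F (\<epsilon> * x) (v x) - f (v x) * v' x -
        (v' x * cos (\<epsilon> * x) - (v x - c) * (sin (\<epsilon> * x) * \<epsilon>)))) (at x)"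
      unfolding Q_def
      by (auto intro!: derivative_eq_intros v v' DERIV_chain2[OF G_deriv])
    moreover have "v' x * F (\<epsilon> * x) (v x) - f (v x) * v' x -
        (v' x * cos (\<epsilon> * x) - (v x - c) * (sin (\<epsilon> * x) * \<epsilon>)) = (v x - c) * (sin (\<epsilon> * x) * \<epsilon>)"
      using F_inside[of "v x"] range[OF x] by (simp add: algebra_simps)
    moreover have "0 \<le> sin (\<epsilon> * x)" using x st eps eps_le_pi[of x] by (intro sin_ge_zero) auto
    then have "0 \<le> (v x - c) * (sin (\<epsilon> * x) * \<epsilon>)" using range[OF x] eps by auto
    ultimately show "\<exists>y. (Q has_real_derivative y) (at x) \<and> 0 \<le> y" by metis
  qed
  then show ?thesis using c by (simp add: Q_def)
qed

end

section \<open>Continuous dependence, uniqueness and symmetry\<close>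

context duffing begin

lemma stability:
  assumes v: "\<And>t. (v has_real_derivative v' t) (at t)"
    and v': "\<And>t. (v' has_real_derivative F (p t) (v t)) (at t)"
    and w: "\<And>t. (w has_real_derivative w' t) (at t)"
    and w': "\<And>t. (w' has_real_derivative F (q t) (w t)) (at t)"
    and forcing: "\<And>t. 0 \<le> t \<Longrightarrow> t \<le> T \<Longrightarrow> \<bar>cos (p t) - cos (q t)\<bar> \<le> d"
    and t: "0 \<le> t" "t \<le> T" and d: "0 \<le> d"
  shows "(v t - w t)^2 + (v' t - w' t)^2
    \<le> ((v 0 - w 0)^2 + (v' 0 - w' 0)^2 + d^2) * exp ((lip + 2) * t)"
proof (rule second_order_gronwall[where w = "\<lambda>t. v t - w t" and w' = "\<lambda>t. v' t - w' t"
      and w'' = "\<lambda>t. F (p t) (v t) - F (q t) (w t)" and T = T])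
  show "\<bar>F (p s) (v s) - F (q s) (w s)\<bar> \<le> lip * \<bar>v s - w s\<bar> + d" if "0 \<le> s" "s \<le> T" for s
    using F_lipschitz[of "p s" "v s" "w s"] F_cos_diff[of "p s" "w s" "q s"] forcing[OF that]
    by linarith
qed (use t d lip_nonneg in \<open>auto intro: DERIV_diff v v' w w'\<close>)

lemma uniqueness:
  assumes v: "\<And>t. (v has_real_derivative v' t) (at t)"
    and v': "\<And>t. (v' has_real_derivative F (p t) (v t)) (at t)"
    and w: "\<And>t. (w has_real_derivative w' t) (at t)"
    and w': "\<And>t. (w' has_real_derivative F (q t) (w t)) (at t)"
    and forcing: "\<And>t. cos (p t) = cos (q t)"
    and init: "v 0 = w 0" "v' 0 = w' 0" and t: "0 \<le> t"
  shows "v t = w t"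
proof -
  have "(v t - w t)^2 + (v' t - w' t)^2 \<le> 0"
    using stability[OF v v' w w', where T = t and t = t and d = 0] forcing init t by simp
  then show ?thesis by (simp add: sum_power2_le_zero_iff)
qed

lemma reflected:
  assumes v: "\<And>t. (v has_real_derivative v' t) (at t)"
    and v': "\<And>t. (v' has_real_derivative F (\<epsilon> * t) (v t)) (at t)"
  shows "((\<lambda>s. v (c - s)) has_real_derivative - v' (c - t)) (at t)"
    and "((\<lambda>s. - v' (c - s)) has_real_derivative F (\<epsilon> * (c - t)) (v (c - t))) (at t)"
proof -
  have 1: "((\<lambda>s. c - s) has_real_derivative -1) (at t)" by (auto intro!: derivative_eq_intros)
  show "((\<lambda>s. v (c - s)) has_real_derivative - v' (c - t)) (at t)"
    using DERIV_chain2[OF v 1] by simp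
  show "((\<lambda>s. - v' (c - s)) has_real_derivative F (\<epsilon> * (c - t)) (v (c - t))) (at t)"
    using DERIV_minus[OF DERIV_chain2[OF v' 1]] by simp
qed

lemma shifted:
  assumes v: "\<And>t. (v has_real_derivative v' t) (at t)"
    and v': "\<And>t. (v' has_real_derivative F (\<epsilon> * t) (v t)) (at t)"
  shows "((\<lambda>s. v (c + s)) has_real_derivative v' (c + t)) (at t)"
    and "((\<lambda>s. v' (c + s)) has_real_derivative F (\<epsilon> * (c + t)) (v (c + t))) (at t)"
proof -
  have 1: "((\<lambda>s. c + s) has_real_derivative 1) (at t)" by (auto intro!: derivative_eq_intros)
  show "((\<lambda>s. v (c + s)) has_real_derivative v' (c + t)) (at t)"
    using DERIV_chain2[OF v 1] by simp
  show "((\<lambda>s. v' (c + s)) has_real_derivative F (\<epsilon> * (c + t)) (v (c + t))) (at t)"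
    using DERIV_chain2[OF v' 1] by simp
qed

lemma even_solution:
  assumes v: "\<And>t. (v has_real_derivative v' t) (at t)"
    and v': "\<And>t. (v' has_real_derivative F (\<epsilon> * t) (v t)) (at t)" and "v' 0 = 0"
  shows "v (- t) = v t"
proof -
  have "v t = v (0 - t)" if "0 \<le> t" for t
    by (rule uniqueness[OF v v' reflected[OF v v']]) (use assms that in auto)
  from this[of t] this[of "- t"] show ?thesis by (cases "0 \<le> t") auto
qed

text \<open>Even about two points, hence periodic.\<close>

lemma periodic_solution:
  assumes v: "\<And>t. (v has_real_derivative v' t) (at t)"
    and v': "\<And>t. (v' has_real_derivative F (\<epsilon> * t) (v t)) (at t)"
    and crit: "v' 0 = 0" "v' c = 0" and forcing: "sin (\<epsilon> * c) = 0"
  shows "v (t + 2 * c) = v t"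
proof -
  have cos: "cos (\<epsilon> * (c + s)) = cos (\<epsilon> * (c - s))" for s
    using forcing by (simp add: cos_add cos_diff distrib_left right_diff_distrib)
  have "v (c + s) = v (c - s)" if "0 \<le> s" for s
    by (rule uniqueness[OF shifted[OF v v'] reflected[OF v v']]) (use crit that cos in auto)
  then have "v (c + s) = v (c - s)" for s
    by (cases "0 \<le> s") (force dest: spec[of _ "- s"])+
  from this[of "c + t"] show ?thesis
    using even_solution[OF v v' crit(1), of t] by (simp add: algebra_simps)
qed

end

section \<open>Critical points above and below the middle root at pi\<close>

context orbit begin

lemma F_start: "0 < F 0 \<alpha>"
proof -
  have "0 < (\<alpha> - a) * (\<alpha> - b) * (\<alpha> + a + b)"
    using \<alpha> alpha_lower a_pos b_pos by (intro mult_pos_pos mult_neg_neg) auto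
  then show ?thesis using alpha_inside f_plus_one[of \<alpha>] F_inside[of \<alpha> 0] by simp
qed

text \<open>This keeps the planar curve off the origin and gives its passages a direction. Up to
  \<open>rho\<close> the energy gained since the lowest earlier minimum forbids a turn; above
  \<open>rho\<close> the time-reversed orbit would move away upwards and never meet
  \<alpha>.\<close>

lemma critical_concave:
  assumes t: "0 < t" "t \<le> S" "v' t = 0" and above: "- b \<le> v t"
  shows "f (v t) + cos (\<epsilon> * t) < 0"
proof (rule ccontr)
  assume "\<not> ?thesis"
  then have nn: "0 \<le> f (v t) + cos (\<epsilon> * t)" by simp
  have inside: "\<bar>v s\<bar> < R" if "0 \<le> s" "s \<le> t" for s
    by (rule bounded_before_critical[OF t(1,3) that])
  show False
  proof (cases "v t \<le> rho")
    case True
    obtain m where m: "0 \<le> m" "m \<le> t" and min: "\<And>x. 0 \<le> x \<Longrightarrow> x \<le> t \<Longrightarrow> v m \<le> v x"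
      using continuous_attains_inf[of "{0..t}" v] v_cont t by auto
    have mb: "v m < - b" using min[of 0] init \<alpha> t by simp
    then have mt: "m < t" using m above by (cases "m = t") auto
    have crit: "v' m = 0"
    proof (cases "m = 0")
      case False
      then show ?thesis
        by (intro DERIV_local_min[OF v, of "min m (t - m)"]) (use m mt min in auto)
    qed (use init in simp)
    \<comment> \<open>At a minimum the acceleration is nonnegative, while \<open>f + 1\<close> is
      negative below \<open>- (a + b)\<close>; this brings the minimum into the range of
      \<open>potential_gap_pi\<close>.\<close>
    have low: "- (a + b) \<le> v m"
    proof (cases "m = 0")
      case False
      have "0 \<le> F (\<epsilon> * m) (v m)"
      proof (rule ccontr)
        assume "\<not> ?thesis"
        then obtain d where d: "d > 0" "\<And>x. m - d < x \<Longrightarrow> x < m \<Longrightarrow> - v m < - v x"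
          using convex_left_of_critical[OF DERIV_minus[OF v] DERIV_minus[OF v'], of m] crit by auto
        have "v (max 0 (m - d/2)) < v m" using d(2)[of "max 0 (m - d/2)"] d(1) m False by auto
        moreover have "v m \<le> v (max 0 (m - d/2))" by (rule min) (use m d mt in auto)
        ultimately show False by linarith
      qed
      then have "0 \<le> f (v m) + 1"
        using F_inside[of "v m" "\<epsilon> * m"] inside[OF m] cos_le_one[of "\<epsilon> * m"] by linarith
      then have "0 \<le> (v m - a) * (v m - b) * (v m + a + b)" by (simp add: f_plus_one)
      moreover have "0 < (v m - a) * (v m - b)" using mb a_pos b_pos by (intro mult_neg_neg) auto
      ultimately show ?thesis by (simp add: zero_le_mult_iff)
    qed (use alpha_lower init in simp)
    have "G (v t) - G (v m) + (v t - v m) * cos (\<epsilon> * t) \<le> (v' t)^2 / 2"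
      by (rule energy[OF m t(2) refl crit]) (use m inside min in \<open>auto simp: less_imp_le\<close>)
    moreover have "G (- b) + (- b) * cos (\<epsilon> * t) \<le> G (v t) + v t * cos (\<epsilon> * t)"
    proof (rule DERIV_nonneg_imp_nondecreasing[OF above])
      fix u assume u: "- b \<le> u" "u \<le> v t"
      have "f (v t) \<le> f u"
        using f_decreasing[of u "v t"] u True rho by (cases "u = v t") auto
      then have "0 \<le> f u + cos (\<epsilon> * t)" using nn by simp
      moreover have "((\<lambda>u. G u + u * cos (\<epsilon> * t)) has_real_derivative f u + cos (\<epsilon> * t)) (at u)"
        by (auto intro!: derivative_eq_intros G_deriv)
      ultimately show "\<exists>y. ((\<lambda>u. G u + u * cos (\<epsilon> * t)) has_real_derivative y) (at u) \<and> 0 \<le> y"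
        by blast
    qed
    moreover have "G (v m) - v m < G (- b) + b" by (rule potential_gap_pi[OF low mb])
    \<comment> \<open>This term carries the gap from time pi to time t: with C for
      \<open>cos (\<epsilon> * t)\<close>, \<open>G (v m) + v m * C < G (- b) - b * C \<le> G (v t)
      + v t * C \<le> G (v m) + v m * C\<close>, a contradiction.\<close>
    moreover have "0 \<le> (- b - v m) * (1 + cos (\<epsilon> * t))"
      using mb cos_ge_minus_one[of "\<epsilon> * t"] by (intro mult_nonneg_nonneg) linarith+
    ultimately show False using t by (simp add: algebra_simps)
  next
    case False
    then have above_rho: "rho \<le> v t" by simp
    define w where "w = (\<lambda>s. v (t - s) - v t)"
    have w: "(w has_real_derivative - v' (t - s)) (at s)" for s
      unfolding w_def by (auto intro!: derivative_eq_intros reflected(1)[OF v v'])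
    note w' = reflected(2)[OF v v', of t]
    have f_mono: "f (v t) \<le> f (v (t - s))" if "0 \<le> w s" for s
      using f_increasing[OF above_rho, of "v (t - s)"] that by (cases "v (t - s) = v t") (auto simp: w_def)
    have cos_less: "cos (\<epsilon> * t) < cos (\<epsilon> * (t - s))" if "0 < s" "s \<le> t" for s
      by (rule cos_monotone_0_pi) (use that t eps eps_le_pi[of t] in auto)
    have F_in: "F (\<epsilon> * (t - s)) (v (t - s)) = f (v (t - s)) + cos (\<epsilon> * (t - s))"
      if "0 \<le> s" "s \<le> t" for s
      using F_inside[of "v (t - s)"] inside[of "t - s"] that by simp
    define r where "r = min t (1 / (lip + 1))"
    have r: "0 < r" "r \<le> t" "r \<le> 1 / (lip + 1)" using t lip_nonneg by (auto simp: r_def)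
    have "lip * r < 1"
    proof -
      have "lip * r \<le> lip * (1 / (lip + 1))" by (rule mult_left_mono[OF r(3) lip_nonneg])
      also have "\<dots> < 1" using lip_nonneg by (simp add: field_simps)
      finally show ?thesis .
    qed
    moreover have "r \<le> 1" using r(3) lip_nonneg by (smt (verit) divide_le_eq_1)
    ultimately have small: "lip * r * r < 1"
      using r lip_nonneg by (metis mult_left_le mult_nonneg_nonneg less_imp_le order_le_less_trans)
    have wc: "continuous_on A w" for A
      using w DERIV_isCont continuous_at_imp_continuous_on by blast
    text \<open>A negative minimum \<open>-\<mu>\<close> of \<open>w\<close> on \<open>[0, r]\<close> would force \<open>w'' \<ge> - lip \<mu>\<close> there,
      hence \<open>\<mu> \<le> lip \<mu> r\<^sup>2 / 2\<close>, which is impossible for small \<open>r\<close>.\<close>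
    have init_nonneg: "0 \<le> w s" if s: "0 \<le> s" "s \<le> r" for s
    proof (rule ccontr)
      assume neg: "\<not> 0 \<le> w s"
      obtain m where m: "0 \<le> m" "m \<le> r" and min: "\<And>x. 0 \<le> x \<Longrightarrow> x \<le> r \<Longrightarrow> w m \<le> w x"
        using continuous_attains_inf[of "{0..r}" w] wc r by auto
      define \<mu> where "\<mu> = - w m"
      have \<mu>: "0 < \<mu>" using min[OF s] neg by (simp add: \<mu>_def)
      have F_low: "- lip * \<mu> \<le> F (\<epsilon> * (t - x)) (v (t - x))" if x: "0 \<le> x" "x \<le> r" for x
      proof -
        have "- lip * \<mu> \<le> f (v (t - x)) - f (v t)"
        proof (cases "0 \<le> w x")
          case True
          then show ?thesis using f_mono[OF True] lip_nonneg \<mu> by (smt (verit) mult_nonneg_nonneg mult_minus_left)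
        next
          case False
          have "\<bar>F 0 (v (t - x)) - F 0 (v t)\<bar> \<le> lip * \<bar>w x\<bar>"
            unfolding w_def by (rule F_lipschitz)
          moreover have "\<bar>w x\<bar> \<le> \<mu>" using False min[OF x] by (simp add: \<mu>_def)
          then have "lip * \<bar>w x\<bar> \<le> lip * \<mu>" by (rule mult_left_mono[OF _ lip_nonneg])
          moreover have "\<bar>v (t - x)\<bar> \<le> R" "\<bar>v t\<bar> \<le> R"
            using inside[of "t - x"] inside[of t] x r t by auto
          ultimately show ?thesis by (simp add: F_inside) 
        qed
        moreover have "cos (\<epsilon> * t) \<le> cos (\<epsilon> * (t - x))"
          using cos_less[of x] x r by (cases "x = 0") auto
        ultimately show ?thesis using F_in[of x] x r nn by linarith
      qed
      have w'_low: "- lip * \<mu> * x \<le> - v' (t - x)" if x: "0 \<le> x" "x \<le> r" for x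
      proof -
        have "- v' (t - 0) + lip * \<mu> * 0 \<le> - v' (t - x) + lip * \<mu> * x"
        proof (rule DERIV_nonneg_imp_nondecreasing[OF x(1)])
          fix z assume z: "0 \<le> z" "z \<le> x"
          have "((\<lambda>z. - v' (t - z) + lip * \<mu> * z) has_real_derivative
              F (\<epsilon> * (t - z)) (v (t - z)) + lip * \<mu>) (at z)"
            by (rule DERIV_add[OF w']) (auto intro!: derivative_eq_intros)
          then show "\<exists>y. ((\<lambda>z. - v' (t - z) + lip * \<mu> * z) has_real_derivative y) (at z) \<and> 0 \<le> y"
            using F_low[of z] z x by (intro exI[of _ "F (\<epsilon> * (t - z)) (v (t - z)) + lip * \<mu>"]) auto
        qed
        then show ?thesis using t by simp
      qed
      have "w 0 + lip * \<mu> * 0^2 / 2 \<le> w m + lip * \<mu> * m^2 / 2"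
      proof (rule DERIV_nonneg_imp_nondecreasing[OF m(1)])
        fix z assume z: "0 \<le> z" "z \<le> m"
        have "((\<lambda>z. w z + lip * \<mu> * z^2 / 2) has_real_derivative - v' (t - z) + lip * \<mu> * z) (at z)"
          by (auto intro!: derivative_eq_intros w)
        then show "\<exists>y. ((\<lambda>z. w z + lip * \<mu> * z^2 / 2) has_real_derivative y) (at z) \<and> 0 \<le> y"
          using w'_low[of z] z m by (intro exI[of _ "- v' (t - z) + lip * \<mu> * z"]) auto
      qed
      moreover have "w 0 = 0" "w m = - \<mu>" by (simp_all add: w_def \<mu>_def)
      ultimately have "\<mu> \<le> \<mu> * (lip * m^2 / 2)" by (simp add: mult_ac)
      then have "1 \<le> lip * m^2 / 2" using \<mu> by simp
      moreover have "lip * (m * m) \<le> lip * (r * r)"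
        using m r lip_nonneg by (intro mult_left_mono mult_mono) auto
      ultimately show False using small by (simp add: power2_eq_square)
    qed
    have "0 < - v' (t - s)" if "0 < s" "s \<le> t" for s
    proof (rule escape_above[OF w w' _ _ r(1) init_nonneg _ that])
      fix s assume s: "0 < s" "s \<le> t" "0 \<le> w s"
      show "0 < F (\<epsilon> * (t - s)) (v (t - s))"
        using F_in[of s] f_mono[OF s(3)] cos_less[OF s(1,2)] s nn by linarith
    qed (use t in \<open>auto simp: w_def\<close>)
    then have "w 0 < w t"
      by (intro DERIV_pos_imp_increasing_open[OF t(1) _ wc]) (use w in \<open>meson less_imp_le\<close>)
    then show False using init \<alpha> above b_pos by (simp add: w_def)
  qed
qed

text \<open>Such a maximum lies at or below \<open>- rho\<close>, where \<open>f\<close> is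
  increasing. From then on a lower position and a later time both make the force more negative, so
  the orbit falls with nonzero speed up to S, against \<open>stop\<close>.\<close>

lemma no_low_maximum:
  assumes t: "0 < t" "t < S" and d: "0 < d" and max: "\<And>s. \<bar>s - t\<bar> < d \<Longrightarrow> v s \<le> v t"
    and low: "v t < - b" and stop: "v' S = 0"
  shows False
proof -
  have crit: "v' t = 0"
    by (rule DERIV_local_max[OF v d]) (use max in \<open>auto simp: abs_minus_commute\<close>)
  have inside: "\<bar>v s\<bar> < R" if "0 \<le> s" "s \<le> S" for s
    by (rule bounded_before_critical[OF S_pos stop that])
  have F_in: "F (\<epsilon> * s) (v s) = f (v s) + cos (\<epsilon> * s)" if "0 \<le> s" "s \<le> S" for s
    using F_inside inside[OF that] by simp
  have conc: "f (v t) + cos (\<epsilon> * t) \<le> 0"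
  proof (rule ccontr)
    assume "\<not> ?thesis"
    then have "0 < F (\<epsilon> * t) (v t)" using F_in[of t] t by simp
    then obtain e where e: "e > 0" "\<And>x. t - e < x \<Longrightarrow> x < t \<Longrightarrow> v t < v x"
      using convex_left_of_critical[OF v v' crit] by meson
    have "v t < v (t - min (d/2) (e/2))" using d e by (intro e(2)) auto
    moreover have "v (t - min (d/2) (e/2)) \<le> v t" using d e by (intro max) auto
    ultimately show False by linarith
  qed
  \<comment> \<open>Between \<open>- rho\<close> and \<open>- b\<close> one has
    \<open>f > f (- b) = 1\<close>, so the force would be positive whatever the forcing, against
    \<open>conc\<close>.\<close>
  have low_rho: "v t \<le> - rho"
  proof (rule ccontr)
    assume "\<not> ?thesis"
    then have "f (- b) < f (v t)" using f_decreasing[of "v t" "- b"] low rho b_pos by auto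
    moreover have "f (- b) = 1" using f_minus_one[of "- b"] by simp
    ultimately show False using conc cos_ge_minus_one[of "\<epsilon> * t"] by linarith
  qed
  define w where "w = (\<lambda>s. v t - v (t + s))"
  have w: "(w has_real_derivative - v' (t + s)) (at s)" for s
    unfolding w_def by (auto intro!: derivative_eq_intros shifted(1)[OF v v'])
  note w' = DERIV_minus[OF shifted(2)[OF v v', of t]]
  have "0 < - v' (t + (S - t))"
  proof (rule escape_above[OF w w'])
    show "0 < d/2" using d by simp
    show "0 \<le> w s" if "0 \<le> s" "s \<le> d/2" for s
      using max[of "t + s"] that d by (simp add: w_def)
    fix s assume s: "0 < s" "s \<le> S - t" "0 \<le> w s"
    have "f (v (t + s)) \<le> f (v t)"
      using f_increasing_neg[OF low_rho, of "v (t + s)"] s by (cases "v (t + s) = v t") (auto simp: w_def)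
    moreover have "cos (\<epsilon> * (t + s)) < cos (\<epsilon> * t)"
      by (rule cos_monotone_0_pi) (use s t eps eps_le_pi[of "t + s"] in auto)
    ultimately show "0 < - F (\<epsilon> * (t + s)) (v (t + s))" using F_in[of "t + s"] s t conc by simp
  qed (use t crit in \<open>auto simp: w_def\<close>)
  then show False using stop by simp
qed

end

section \<open>The two ends of the shooting interval\<close>

text \<open>The mean value theorem on \<open>[n, n + 1]\<close> yields points tending to infinity at
  which \<open>h'\<close> tends to 0. Applied to a velocity as well, it shows that the limit of an
  orbit is an equilibrium.\<close>

lemma derivative_square_limit:
  fixes h h' :: "real \<Rightarrow> real"
  assumes h: "\<And>t. (h has_real_derivative h' t) (at t)"
    and L: "(h \<longlongrightarrow> L) at_top" and e: "((\<lambda>t. (h' t)^2) \<longlongrightarrow> e) at_top"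
  shows "e = 0"
proof -
  have "\<exists>z. real n < z \<and> h (real n + 1) - h (real n) = h' z" for n
    using MVT2[of "real n" "real n + 1" h h'] h by auto
  then obtain z where z: "\<And>n. real n < z n" "\<And>n. h (real n + 1) - h (real n) = h' (z n)"
    by metis
  have zt: "filterlim z at_top sequentially"
    by (rule filterlim_at_top_mono[OF filterlim_real_sequentially])
      (use z(1) in \<open>auto intro: always_eventually less_imp_le\<close>)
  have n1: "filterlim (\<lambda>n. real n + 1) at_top sequentially"
    by (rule filterlim_at_top_mono[OF filterlim_real_sequentially]) auto
  have "(\<lambda>n. h (real n + 1) - h (real n)) \<longlonglongrightarrow> L - L"
    by (intro tendsto_diff filterlim_compose[OF L] n1 filterlim_real_sequentially)
  then have "(\<lambda>n. h' (z n)) \<longlonglongrightarrow> 0" unfolding z(2) by simp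
  then have "(\<lambda>n. (h' (z n))^2) \<longlonglongrightarrow> 0" by simp
  moreover have "(\<lambda>n. (h' (z n))^2) \<longlonglongrightarrow> e" by (rule filterlim_compose[OF e zt])
  ultimately show ?thesis by (rule LIMSEQ_unique[symmetric])
qed

lemma bounded_increasing_tendsto:
  fixes h :: "real \<Rightarrow> real"
  assumes mono: "\<And>s t. 0 \<le> s \<Longrightarrow> s \<le> t \<Longrightarrow> h s \<le> h t" and bdd: "\<And>t. 0 \<le> t \<Longrightarrow> h t \<le> B"
  obtains L where "(h \<longlongrightarrow> L) at_top" "\<And>t. 0 \<le> t \<Longrightarrow> h t \<le> L" "L \<le> B"
proof -
  define L where "L = Sup (h ` {0..})"
  have bd: "bdd_above (h ` {0..})" using bdd by (auto intro!: bdd_aboveI[of _ B])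
  have up: "h t \<le> L" if "0 \<le> t" for t
    unfolding L_def using bd that by (intro cSup_upper) auto
  have "L \<le> B" unfolding L_def using bdd by (intro cSup_least) auto
  moreover have "(h \<longlongrightarrow> L) at_top"
  proof (rule increasing_tendsto)
    show "\<forall>\<^sub>F t in at_top. h t \<le> L"
      using eventually_ge_at_top[of 0] by eventually_elim (rule up)
    fix x assume "x < L"
    then obtain s where s: "0 \<le> s" "x < h s"
      unfolding L_def using less_cSup_iff[OF _ bd, of x] by auto
    show "\<forall>\<^sub>F t in at_top. x < h t"
      using eventually_ge_at_top[of s] by eventually_elim (use s mono in force)
  qed
  ultimately show thesis using that up by blast
qed

section \<open>The left end of the shooting interval\<close>

context orbit begin

text \<open>Here \<open>G (v x) - G \<alpha>\<close> is the square
  \<open>((v x)^2 - lam)^2 / 4\<close>, and the cosine is at least 1/2 until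
  \<open>\<epsilon> * x = pi / 3\<close>. Thus \<open>(v' x)^2 \<ge> v x - \<alpha>\<close>, which
  drives v beyond R by that time if \<epsilon> is small; no critical point can follow.\<close>

lemma no_critical_from_left_end:
  assumes left: "\<alpha> = - sqrt lam" and fast: "4 * (R + sqrt lam) < (pi / (3 * \<epsilon>))^2"
    and t: "0 < t" "t \<le> S"
  shows "v' t \<noteq> 0"
proof
  assume crit: "v' t = 0"
  have sq: "\<alpha>^2 = lam" using left lam_pos by simp
  have "(v' has_real_derivative F 0 \<alpha>) (at 0)" using v'[of 0] init by simp
  then obtain d where d: "d > 0" "\<And>h. 0 < h \<Longrightarrow> h < d \<Longrightarrow> 0 < v' h"
    using DERIV_pos_inc_right[OF _ F_start, of v' 0] init by auto
  define s where "s = min (d/2) (t/2)"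
  have s: "0 < s" "s \<le> t" "0 < v' s" using d t by (auto simp: s_def)
  obtain z where z: "s < z" "z \<le> t" "v' z = 0" and zpos: "\<And>x. s \<le> x \<Longrightarrow> x < z \<Longrightarrow> 0 < v' x"
    using first_nonpositive[OF v'_cont s(3,2)] crit by auto
  have pos: "0 < v' x" if "0 < x" "x < z" for x
    using zpos[of x] d(2)[of x] that d(1) by (cases "s \<le> x") (auto simp: s_def)
  have inc: "\<alpha> < v x" if "0 < x" "x \<le> z" for x
  proof -
    have "v 0 < v x"
      by (rule DERIV_pos_imp_increasing_open[OF that(1) _ v_cont]) (use v pos that in force)
    then show ?thesis using init by simp
  qed
  have inside: "\<bar>v x\<bar> < R" if "0 \<le> x" "x \<le> z" for x
    by (rule bounded_before_critical[of z]) (use z s that in auto)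
  have en: "(v x - \<alpha>) / 2 \<le> (v' x)^2 / 2" if x: "0 < x" "x \<le> z" "\<epsilon> * x \<le> pi / 3" for x
  proof -
    have "G (v x) - G \<alpha> + (v x - \<alpha>) * cos (\<epsilon> * x) \<le> (v' x)^2 / 2"
    proof (rule energy[of 0])
      show "\<bar>v y\<bar> \<le> R \<and> \<alpha> \<le> v y" if "0 \<le> y" "y \<le> x" for y
        using inside[of y] inc[of y] that x init by (cases "y = 0") auto
    qed (use x z t init in auto)
    moreover have "G (v x) - G \<alpha> = ((v x)^2 - \<alpha>^2)^2 / 4"
      unfolding G_def unfolding sq[symmetric] by (simp add: power2_eq_square power4_eq_xxxx field_simps)
    then have "0 \<le> G (v x) - G \<alpha>" by (metis divide_nonneg_pos zero_le_power2 zero_less_numeral)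
    moreover have "cos (pi / 3) \<le> cos (\<epsilon> * x)"
      using x eps by (intro cos_monotone_0_pi_le) auto
    then have "(v x - \<alpha>) * (1 / 2) \<le> (v x - \<alpha>) * cos (\<epsilon> * x)"
      using inc[OF x(1,2)] by (intro mult_left_mono) (auto simp: cos_60)
    ultimately show ?thesis by simp
  qed
  show False
  proof (cases "\<epsilon> * z \<le> pi / 3")
    case True
    then show False using en[of z] inc[of z] z s by auto
  next
    case False
    define T where "T = pi / (3 * \<epsilon>)"
    have T: "0 < T" "T < z" "\<epsilon> * T = pi / 3" using False eps by (auto simp: T_def field_simps)
    \<comment> \<open>The energy bound integrated: \<open>sqrt (v x - \<alpha>)\<close> has slope at
      least 1/2. It is not differentiable at 0, so only the open interval is used for the
      derivative.\<close>
    have "sqrt (v 0 - \<alpha>) - 0 / 2 \<le> sqrt (v T - \<alpha>) - T / 2"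
    proof (rule DERIV_nonneg_imp_increasing_open[OF less_imp_le[OF T(1)]])
      show "continuous_on {0..T} (\<lambda>x. sqrt (v x - \<alpha>) - x / 2)"
        by (intro continuous_intros v_cont) auto
      fix x assume x: "0 < x" "x < T"
      have gt: "0 < v x - \<alpha>" using inc[of x] x T by simp
      have D: "((\<lambda>x. sqrt (v x - \<alpha>) - x / 2) has_real_derivative
          inverse (sqrt (v x - \<alpha>)) / 2 * v' x - 1 / 2) (at x)"
      proof (rule DERIV_diff)
        show "((\<lambda>x. sqrt (v x - \<alpha>)) has_real_derivative inverse (sqrt (v x - \<alpha>)) / 2 * v' x) (at x)"
          by (rule DERIV_chain2[where g = "\<lambda>x. v x - \<alpha>", OF DERIV_real_sqrt[OF gt]])
            (auto intro!: derivative_eq_intros v)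
        show "((\<lambda>x. x / 2) has_real_derivative 1 / 2) (at x)" by (rule DERIV_cdivide[OF DERIV_ident])
      qed
      have "\<epsilon> * x \<le> pi / 3" using x T eps by (metis less_imp_le mult_left_mono)
      then have "v x - \<alpha> \<le> (v' x)^2" using en[of x] x T by simp
      moreover have "0 < v' x" using pos x T by simp
      ultimately have "sqrt (v x - \<alpha>) \<le> v' x" by (intro real_le_lsqrt) auto
      then have "0 \<le> inverse (sqrt (v x - \<alpha>)) / 2 * v' x - 1 / 2"
        using gt by (simp add: field_simps)
      with D show "\<exists>y. ((\<lambda>x. sqrt (v x - \<alpha>) - x / 2) has_real_derivative y) (at x) \<and> 0 \<le> y" by blast
    qed
    then have "T / 2 \<le> sqrt (v T - \<alpha>)" using init by simp
    then have "(T / 2)^2 \<le> (sqrt (v T - \<alpha>))^2" using T by (intro power_mono) auto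
    then have "T^2 / 4 \<le> v T - \<alpha>" using inc[of T] T by (simp add: power_divide)
    then have "R < v T" using fast left by (simp add: T_def)
    then show False using inside[of T] T by simp
  qed
qed

end

section \<open>The equation with forcing frozen at time 0\<close>

context duffing begin

definition P :: "real \<Rightarrow> real" where "P u = G u + u"

lemma P_deriv: "(P has_real_derivative (u - a) * (u - b) * (u + a + b)) (at u)"
proof -
  have "(P has_real_derivative f u + 1) (at u)"
    unfolding P_def by (intro derivative_intros G_deriv)
  then show ?thesis by (simp add: f_plus_one)
qed

lemma P_increasing: assumes "- (a + b) \<le> x" "x < y" "y \<le> b" shows "P x < P y"
proof (rule DERIV_pos_imp_increasing_open[OF assms(2)])
  fix u assume u: "x < u" "u < y"
  have "0 < (u - a) * (u - b) * (u + a + b)"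
    using u assms a_pos b_less_a b_pos by (intro mult_pos_pos mult_neg_neg) auto
  then show "\<exists>l. (P has_real_derivative l) (at u) \<and> 0 < l" using P_deriv by blast
qed (use P_deriv DERIV_isCont continuous_at_imp_continuous_on in blast)

text \<open>The point \<open>a\<close> is the saddle, hence the double factor. The other zeros,
  \<open>- a\<close> +/- \<open>sqrt (2 * b * (a + b))\<close>, are the remaining points on the
  saddle's energy level; the larger one is the turning point of the homoclinic orbit.\<close>

lemma P_minus_P_a: "P u - P a = (u - a)^2 * ((u + a)^2 - 2 * b * (a + b)) / 4"
proof -
  have "1 = a * b * (a + b)" using roots by simp
  then have "P u - P a = G u + a * b * (a + b) * u - (G a + a * b * (a + b) * a)"
    unfolding P_def by simp
  also have "\<dots> = (u - a)^2 * ((u + a)^2 - 2 * b * (a + b)) / 4"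
    unfolding G_def unfolding lam_eq by (simp add: power2_eq_square power4_eq_xxxx field_simps)
  finally show ?thesis .
qed

lemma frozen_energy:
  assumes V: "\<And>t. (V has_real_derivative V' t) (at t)"
    and V': "\<And>t. (V' has_real_derivative F (0 * t) (V t)) (at t)" and init: "V' 0 = 0"
    and t: "0 \<le> t" and inside: "\<And>s. 0 \<le> s \<Longrightarrow> s \<le> t \<Longrightarrow> \<bar>V s\<bar> \<le> R"
  shows "(V' t)^2 / 2 = P (V t) - P (V 0)"
proof -
  have "(V' t)^2 / 2 - P (V t) = (V' 0)^2 / 2 - P (V 0)"
  proof (cases "t = 0")
    case False
    have D: "((\<lambda>t. (V' t)^2 / 2 - P (V t)) has_real_derivative 0) (at x)" if "0 \<le> x" "x \<le> t" for x
    proof -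
      have "((\<lambda>t. (V' t)^2 / 2 - P (V t)) has_real_derivative
         V' x * F 0 (V x) - (V x - a) * (V x - b) * (V x + a + b) * V' x) (at x)"
        using V'[of x] by (auto intro!: derivative_eq_intros DERIV_chain2[OF P_deriv] V)
      moreover have "F 0 (V x) = (V x - a) * (V x - b) * (V x + a + b)"
        using F_inside[OF inside[OF that], of 0] f_plus_one by simp
      ultimately show ?thesis by (simp add: mult_ac)
    qed
    show ?thesis
    proof (rule DERIV_isconst_end[where b = t and a = 0 and f = "\<lambda>t. (V' t)^2 / 2 - P (V t)"])
      show "continuous_on {0..t} (\<lambda>t. (V' t)^2 / 2 - P (V t))"
        by (rule continuous_at_imp_continuous_on) (use DERIV_isCont[OF D] in auto)
    qed (use D t False in auto)
  qed simp
  then show ?thesis using init by simp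
qed

text \<open>The assumptions put \<alpha> inside the homoclinic loop, so
  \<open>P a < P \<alpha>\<close> and the saddle is out of reach. Without a turning point V would
  increase to an equilibrium on the level of \<alpha>; as \<open>P\<close> increases on
  \<open>[\<alpha>, b]\<close>, this limit would lie strictly between \<open>b\<close> and
  \<open>a\<close>, where there is no equilibrium.\<close>

lemma frozen_turning_point:
  assumes V: "\<And>t. (V has_real_derivative V' t) (at t)"
    and V': "\<And>t. (V' has_real_derivative F (0 * t) (V t)) (at t)"
    and init: "V 0 = \<alpha>" "V' 0 = 0"
    and \<alpha>: "- a < \<alpha>" "\<alpha> < - b" "2 * b * (a + b) < (\<alpha> + a)^2"
  obtains T where "0 < T" "V' T = 0" "b < V T" "F 0 (V T) < 0"
proof -
  have Vc: "continuous_on A V" for A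
    using V DERIV_isCont continuous_at_imp_continuous_on by blast
  have V'c: "continuous_on A V'" for A
    using V' DERIV_isCont continuous_at_imp_continuous_on by blast
  have \<alpha>R: "\<bar>\<alpha>\<bar> \<le> R" using \<alpha> a_pos b_pos by (auto simp: R_def)
  have "0 < (\<alpha> - a) * (\<alpha> - b) * (\<alpha> + a + b)"
    using \<alpha> a_pos b_pos by (intro mult_pos_pos mult_neg_neg) auto
  then have start: "0 < F 0 \<alpha>" using F_inside[OF \<alpha>R, of 0] by (simp add: f_plus_one)
  have "(V' has_real_derivative F 0 \<alpha>) (at 0)" using V'[of 0] init by simp
  then obtain d where d: "d > 0" "\<And>h. 0 < h \<Longrightarrow> h < d \<Longrightarrow> 0 < V' h"
    using DERIV_pos_inc_right[OF _ start, of V' 0] init by auto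
  have Pa: "P a < P \<alpha>"
  proof -
    have "0 < (\<alpha> - a)^2 * ((\<alpha> + a)^2 - 2 * b * (a + b))"
      using \<alpha> a_pos b_pos by (intro mult_pos_pos) auto
    then show ?thesis using P_minus_P_a[of \<alpha>] by linarith
  qed
  have inc: "V x \<le> V y" if "0 \<le> x" "x \<le> y" "\<And>z. 0 < z \<Longrightarrow> z < y \<Longrightarrow> 0 < V' z" for x y
    by (rule DERIV_nonneg_imp_increasing_open[OF that(2) _ Vc]) (use V that in \<open>force intro: less_imp_le\<close>)
  have below: "V y < a" if y: "0 \<le> y" "\<And>z. 0 < z \<Longrightarrow> z < y \<Longrightarrow> 0 < V' z" for y
  proof (rule ccontr)
    assume "\<not> V y < a"
    then obtain x where x: "0 \<le> x" "x \<le> y" "V x = a"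
      using IVT'[of V 0 a y] y init \<alpha> a_pos b_pos Vc by auto
    have "(V' x)^2 / 2 = P (V x) - P (V 0)"
    proof (rule frozen_energy[OF V V' init(2) x(1)])
      fix s assume s: "0 \<le> s" "s \<le> x"
      have "V 0 \<le> V s" "V s \<le> V x" using s x y by (auto intro!: inc)
      then show "\<bar>V s\<bar> \<le> R" using x init \<alpha> a_pos b_pos by (auto simp: R_def)
    qed
    then have "(V' x)^2 / 2 < 0" using x init Pa by simp
    then show False using zero_le_power2[of "V' x"] by linarith
  qed
  have energy: "(V' y)^2 / 2 = P (V y) - P \<alpha>" if y: "0 \<le> y" "\<And>z. 0 < z \<Longrightarrow> z < y \<Longrightarrow> 0 < V' z" for y
  proof -
    have "(V' y)^2 / 2 = P (V y) - P (V 0)"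
    proof (rule frozen_energy[OF V V' init(2) y(1)])
      fix s assume s: "0 \<le> s" "s \<le> y"
      have "V 0 \<le> V s" "V s \<le> V y" "V y < a" using s y by (auto intro!: inc below)
      then show "\<bar>V s\<bar> \<le> R" using init \<alpha> a_pos b_pos by (auto simp: R_def)
    qed
    then show ?thesis using init by simp
  qed
  have Vd: "\<alpha> < V (d/2)"
  proof -
    have "V 0 < V (d/2)"
      by (rule DERIV_pos_imp_increasing_open[OF _ _ Vc]) (use d V in \<open>auto intro!: exI\<close>)
    then show ?thesis using init by simp
  qed
  have "\<exists>t\<ge>d/2. V' t \<le> 0"
  proof (rule ccontr)
    assume "\<not> (\<exists>t\<ge>d/2. V' t \<le> 0)"
    then have pos: "0 < V' t" if "0 < t" for t using d(2)[of t] that d(1) by (cases "d/2 \<le> t") force+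
    obtain L where L: "(V \<longlongrightarrow> L) at_top" "\<And>t. 0 \<le> t \<Longrightarrow> V t \<le> L" "L \<le> a"
    proof (rule bounded_increasing_tendsto[of V a])
      show "V x \<le> V y" if "0 \<le> x" "x \<le> y" for x y by (rule inc) (use that pos in auto)
      show "V t \<le> a" if "0 \<le> t" for t by (rule less_imp_le, rule below) (use that pos in auto)
    qed blast
    have "\<alpha> < L" using L(2)[of "d/2"] Vd d by simp
    have LR: "\<bar>L\<bar> \<le> R" using \<open>\<alpha> < L\<close> L \<alpha> a_pos b_pos by (auto simp: R_def)
    have "isCont P L" using P_deriv DERIV_isCont by blast
    then have "((\<lambda>t. P (V t)) \<longlongrightarrow> P L) at_top" using L(1) by (rule isCont_tendsto_compose)
    then have "((\<lambda>t. 2 * (P (V t) - P \<alpha>)) \<longlongrightarrow> 2 * (P L - P \<alpha>)) at_top" by (intro tendsto_intros)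
    moreover have "\<forall>\<^sub>F t in at_top. 2 * (P (V t) - P \<alpha>) = (V' t)^2"
      using eventually_ge_at_top[of 0] by eventually_elim (use energy pos in force)
    ultimately have lim1: "((\<lambda>t. (V' t)^2) \<longlongrightarrow> 2 * (P L - P \<alpha>)) at_top"
      by (rule Lim_transform_eventually)
    then have PL: "P L = P \<alpha>" using derivative_square_limit[OF V L(1) lim1] by simp
    have "L \<noteq> a" using PL Pa by auto
    have "b < L" using P_increasing[of \<alpha> L] PL \<open>\<alpha> < L\<close> \<alpha> b_pos by force
    have neg: "(L - a) * (L - b) * (L + a + b) < 0"
      using \<open>b < L\<close> \<open>L \<noteq> a\<close> L(3) a_pos b_pos by (intro mult_neg_pos) auto
    have V'0: "(V' \<longlongrightarrow> 0) at_top" using lim1 PL by simp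
    have "isCont (\<lambda>u. (F 0 u)^2) L"
      unfolding F_def f_def by (intro continuous_intros)
    then have "((\<lambda>t. (F 0 (V t))^2) \<longlongrightarrow> (F 0 L)^2) at_top" using L(1) by (rule isCont_tendsto_compose)
    moreover have "(V' has_real_derivative F 0 (V t)) (at t)" for t using V'[of t] by simp
    ultimately have "(F 0 L)^2 = 0" using V'0 by (intro derivative_square_limit[of V' "\<lambda>t. F 0 (V t)"])
    then have "F 0 L = 0" by (simp only: power_eq_0_iff)
    moreover have "F 0 L = f L + 1" using F_inside[OF LR, of 0] by simp
    ultimately show False using neg f_plus_one[of L] by linarith
  qed
  then obtain t where t: "d/2 \<le> t" "V' t \<le> 0" by blast
  have "0 < V' (d/2)" using d by simp
  then obtain T where T: "d/2 < T" "V' T = 0" and Tpos: "\<And>x. d/2 \<le> x \<Longrightarrow> x < T \<Longrightarrow> 0 < V' x"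
    using first_nonpositive[OF V'c _ t] by blast
  have pos: "0 < V' x" if "0 < x" "x < T" for x
    using Tpos[of x] d(2)[of x] that d(1) by (cases "d/2 \<le> x") auto
  have T0: "0 < T" using T d by linarith
  have "V (d/2) \<le> V T" by (rule inc) (use T d pos in auto)
  then have aT: "\<alpha> < V T" using Vd by simp
  have Ta: "V T < a" by (rule below) (use T0 pos in auto)
  have "P (V T) = P \<alpha>" using energy[of T] T0 T pos by simp
  then have bT: "b < V T" using P_increasing[of \<alpha> "V T"] aT \<alpha> b_pos by force
  have "(V T - a) * (V T - b) * (V T + a + b) < 0"
    using bT Ta a_pos b_pos by (intro mult_neg_pos) auto
  moreover have "\<bar>V T\<bar> \<le> R" using bT Ta a_pos b_pos by (auto simp: R_def)
  ultimately have "F 0 (V T) < 0" using F_inside[of "V T" 0] f_plus_one[of "V T"] by simp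
  then show thesis using that T0 T bT by blast
qed

end

section \<open>Shooting\<close>

lemma continuous_on_Times_lipschitz:
  fixes h :: "real \<Rightarrow> real \<Rightarrow> real"
  assumes lip: "\<And>\<alpha> \<beta> t. \<alpha> \<in> I \<Longrightarrow> \<beta> \<in> I \<Longrightarrow> t \<in> J \<Longrightarrow> \<bar>h \<alpha> t - h \<beta> t\<bar> \<le> C * \<bar>\<alpha> - \<beta>\<bar>"
    and c: "\<And>\<alpha>. \<alpha> \<in> I \<Longrightarrow> continuous_on J (h \<alpha>)"
  shows "continuous_on (I \<times> J) (\<lambda>p. h (fst p) (snd p))"
proof (clarsimp simp: continuous_on_def)
  fix \<alpha> t assume a: "\<alpha> \<in> I" and t: "t \<in> J"
  let ?F = "at (\<alpha>, t) within I \<times> J"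
  have fst: "((\<lambda>p. fst p) \<longlongrightarrow> \<alpha>) ?F" and snd: "((\<lambda>p. snd p) \<longlongrightarrow> t) ?F"
    by (auto intro!: tendsto_eq_intros)
  have ev: "\<forall>\<^sub>F p in ?F. p \<in> I \<times> J" by (auto simp: eventually_at_filter)
  have "((\<lambda>p. h (fst p) (snd p) - h \<alpha> (snd p)) \<longlongrightarrow> 0) ?F"
  proof (rule Lim_null_comparison)
    show "\<forall>\<^sub>F p in ?F. norm (h (fst p) (snd p) - h \<alpha> (snd p)) \<le> C * \<bar>fst p - \<alpha>\<bar>"
      using ev by eventually_elim (use lip a in auto)
    show "((\<lambda>p. C * \<bar>fst p - \<alpha>\<bar>) \<longlongrightarrow> 0) ?F"
      using tendsto_mult_right_zero[OF tendsto_rabs_zero[OF LIM_zero[OF fst]]] .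
  qed
  moreover have "((\<lambda>p. h \<alpha> (snd p)) \<longlongrightarrow> h \<alpha> t) ?F"
    by (rule continuous_on_tendsto_compose[OF c[OF a] snd t]) (use ev in \<open>auto elim: eventually_mono\<close>)
  ultimately have "((\<lambda>p. (h (fst p) (snd p) - h \<alpha> (snd p)) + h \<alpha> (snd p)) \<longlongrightarrow> 0 + h \<alpha> t) ?F"
    by (rule tendsto_add)
  then show "((\<lambda>p. h (fst p) (snd p)) \<longlongrightarrow> h \<alpha> t) ?F" by simp
qed

lemma one_minus_cos_le: "\<bar>cos (x::real) - 1\<bar> \<le> \<bar>x\<bar>"
proof -
  have "cos x = 1 - 2 * (sin (x/2))^2" using cos_double_sin[of "x/2"] by simp
  moreover have "(sin (x/2))^2 = \<bar>sin (x/2)\<bar> * \<bar>sin (x/2)\<bar>" by (simp add: power2_eq_square)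
  moreover have "\<bar>sin (x/2)\<bar> * \<bar>sin (x/2)\<bar> \<le> \<bar>x/2\<bar> * 1"
    using abs_sin_x_le_abs_x[of "x/2"] by (intro mult_mono) auto
  ultimately show ?thesis by simp
qed

context duffing begin

text \<open>Evenness about 0 and about the turning time makes twice that time a period. The points
  \<open>p\<close> and \<open>r\<close> straddle the maximum, and the inequalities there are strict
  so as to survive a small perturbation.\<close>

lemma frozen_oscillation:
  assumes V: "\<And>t. (V has_real_derivative V' t) (at t)"
    and V': "\<And>t. (V' has_real_derivative F (0 * t) (V t)) (at t)"
    and init: "V 0 = \<alpha>" "V' 0 = 0"
    and \<alpha>: "- a < \<alpha>" "\<alpha> < - b" "2 * b * (a + b) < (\<alpha> + a)^2"
  obtains p r T where "0 < p" "p < r" "r < p + T" "V' p > 0" "V' r < 0" "V p > - b"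
    "\<And>t. V (t + T) = V t" "\<And>t. V' (t + T) = V' t"
proof -
  obtain T where T: "0 < T" "V' T = 0" "b < V T" "F 0 (V T) < 0"
    using frozen_turning_point[OF V V' init \<alpha>] by blast
  have V'T: "(V' has_real_derivative F 0 (V T)) (at T)" using V'[of T] by simp
  obtain d1 where d1: "d1 > 0" "\<And>h. 0 < h \<Longrightarrow> h < d1 \<Longrightarrow> V' (T - h) > 0"
    using DERIV_neg_dec_left[OF V'T T(4)] T by auto
  obtain d2 where d2: "d2 > 0" "\<And>h. 0 < h \<Longrightarrow> h < d2 \<Longrightarrow> V' (T + h) < 0"
    using DERIV_neg_dec_right[OF V'T T(4)] T by auto
  have "isCont V T" using V DERIV_isCont by blast
  then obtain d3 where d3: "d3 > 0" "\<And>x. dist x T < d3 \<Longrightarrow> dist (V x) (V T) < V T + b"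
    unfolding continuous_at_eps_delta using T b_pos by (metis add_pos_pos less_trans)
  define d where "d = min (min d1 d2) (min d3 T) / 2"
  have d: "0 < d" "d < d1" "d < d2" "d < d3" "d < T" using d1 d2 d3 T by (auto simp: d_def)
  have per: "V (t + 2 * T) = V t" for t
    by (rule periodic_solution[OF V V' init(2) T(2)]) simp
  have "V' (t + 2 * T) = V' t" for t
  proof -
    have "((\<lambda>s. V (2 * T + s)) has_real_derivative V' (2 * T + t)) (at t)"
      by (rule shifted(1)[OF V V'])
    moreover have "(\<lambda>s. V (2 * T + s)) = V" using per by (auto simp: add.commute)
    ultimately show ?thesis using V[of t] by (auto dest: DERIV_unique simp: add.commute)
  qed
  moreover have "V (T - d) > - b"
    using d3(2)[of "T - d"] d by (auto simp: dist_real_def)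
  ultimately show thesis
    using that[of "T - d" "T + d" "2 * T"] d1(2)[of d] d2(2)[of d] d per by auto
qed

lemma many_critical_points:
  assumes \<alpha>: "- a < \<alpha>" "\<alpha> < - b" "2 * b * (a + b) < (\<alpha> + a)^2"
  shows "\<exists>\<epsilon>1>0. \<forall>\<epsilon> v v'. \<epsilon> < \<epsilon>1 \<and> orbit a b lam \<epsilon> \<alpha> v v' \<longrightarrow>
    (\<exists>A \<subseteq> {0<..pi / \<epsilon>}. finite A \<and> card A = N \<and> (\<forall>t\<in>A. v' t = 0 \<and> - b < v t))"
proof -
  obtain V V' where init: "V 0 = \<alpha>" "V' 0 = 0"
    and V: "\<And>t. (V has_real_derivative V' t) (at t)"
    and V': "\<And>t. (V' has_real_derivative F (0 * t) (V t)) (at t)"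
    using solution_exists[of \<alpha> 0] by blast
  obtain p r T where pr: "0 < p" "p < r" "r < p + T" and signs: "V' p > 0" "V' r < 0" "V p > - b"
    and per: "\<And>t. V (t + T) = V t" "\<And>t. V' (t + T) = V' t"
    using frozen_oscillation[OF V V' init \<alpha>] by blast
  have T: "0 < T" using pr by simp
  have pers: "V (t + real k * T) = V t \<and> V' (t + real k * T) = V' t" for t k
  proof (induction k)
    case (Suc k)
    have "t + real (Suc k) * T = (t + real k * T) + T" by (simp add: algebra_simps)
    then show ?case using per[of "t + real k * T"] Suc by (simp add: add.assoc)
  qed simp
  define E where "E = r + real N * T"
  have E: "0 < E" using pr T by (simp add: E_def add_pos_nonneg)
  define \<mu> where "\<mu> = min (V' p) (min (- V' r) (V p + b))"
  have \<mu>: "0 < \<mu>" using signs by (simp add: \<mu>_def)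
  have \<mu>_le: "\<mu> \<le> V' p" "\<mu> \<le> - V' r" "\<mu> \<le> V p + b" by (auto simp: \<mu>_def)
  \<comment> \<open>The exponential is larger than the square root that Gronwall gives, so that the
    bound becomes the square \<open>(\<epsilon> * C)^2\<close>. Below, \<open>\<mu> / C\<close>
    secures closeness and \<open>pi / E\<close> makes the N periods fit before
    \<open>pi / \<epsilon>\<close>.\<close>
  define C where "C = E * exp ((lip + 2) * E)"
  have C: "0 < C" using E by (simp add: C_def)
  define \<epsilon>1 where "\<epsilon>1 = min (\<mu> / C) (pi / E)"
  show ?thesis
  proof (intro exI[of _ \<epsilon>1] conjI allI impI)
    show "0 < \<epsilon>1" using \<mu> C E by (simp add: \<epsilon>1_def)
    fix \<epsilon> v v' assume "\<epsilon> < \<epsilon>1 \<and> orbit a b lam \<epsilon> \<alpha> v v'"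
    then have e1: "\<epsilon> < \<epsilon>1" and orb: "orbit a b lam \<epsilon> \<alpha> v v'" by auto
    interpret o: orbit a b lam \<epsilon> \<alpha> v v' by (rule orb)
    have eC: "\<epsilon> * C < \<mu>" and ES: "E \<le> pi / \<epsilon>"
      using e1 C E o.eps by (auto simp: \<epsilon>1_def field_simps)
    have close: "\<bar>v t - V t\<bar> < \<mu> \<and> \<bar>v' t - V' t\<bar> < \<mu>" if t: "0 \<le> t" "t \<le> E" for t
    proof -
      have "(v t - V t)^2 + (v' t - V' t)^2
          \<le> ((v 0 - V 0)^2 + (v' 0 - V' 0)^2 + (\<epsilon> * E)^2) * exp ((lip + 2) * t)"
      proof (rule stability[OF o.v o.v' V V' _ t])
        fix s assume s: "0 \<le> s" "s \<le> E"
        have "\<bar>cos (\<epsilon> * s) - 1\<bar> \<le> \<bar>\<epsilon> * s\<bar>" by (rule one_minus_cos_le)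
        also have "\<dots> \<le> \<epsilon> * E" using s o.eps by (simp add: abs_mult)
        finally show "\<bar>cos (\<epsilon> * s) - cos (0 * s)\<bar> \<le> \<epsilon> * E" by simp
      qed (use o.eps E in auto)
      also have "\<dots> \<le> (\<epsilon> * E)^2 * (exp ((lip + 2) * E))^2"
      proof -
        have "(lip + 2) * t \<le> (lip + 2) * E" using t lip_nonneg by (intro mult_left_mono) auto
        then have 1: "exp ((lip + 2) * t) \<le> exp ((lip + 2) * E)" by simp
        have "1 \<le> exp ((lip + 2) * E)" using lip_nonneg E by simp
        then have "exp ((lip + 2) * E) * 1 \<le> exp ((lip + 2) * E) * exp ((lip + 2) * E)"
          by (intro mult_left_mono) auto
        with 1 have "exp ((lip + 2) * t) \<le> (exp ((lip + 2) * E))^2"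
          unfolding power2_eq_square by linarith
        then show ?thesis using init o.init by (simp add: mult_left_mono)
      qed
      also have "\<dots> = (\<epsilon> * C)^2" by (simp add: C_def power_mult_distrib mult_ac)
      also have "\<dots> < \<mu>^2" using eC o.eps C by (intro power_strict_mono) auto
      finally have lt: "(v t - V t)^2 + (v' t - V' t)^2 < \<mu>^2" .
      then have "\<bar>v t - V t\<bar>^2 < \<mu>^2" "\<bar>v' t - V' t\<bar>^2 < \<mu>^2"
        using zero_le_power2[of "v t - V t"] zero_le_power2[of "v' t - V' t"]
        unfolding power2_abs by linarith+
      then show ?thesis using power2_less_imp_less less_imp_le[OF \<mu>] by blast
    qed
    have "\<exists>t. p + real k * T < t \<and> t < r + real k * T \<and> v' t = 0 \<and> - b < v t" if k: "k < N" for k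
    proof -
      let ?p = "p + real k * T" and ?r = "r + real k * T"
      have "real k * T \<le> real N * T" using k T by (intro mult_right_mono) auto
      then have range: "0 \<le> ?p" "?p < ?r" "?r \<le> E" using pr T by (auto simp: E_def)
      have vp: "0 < v' ?p" "- b < v ?p" and vr: "v' ?r < 0"
      proof -
        have "\<bar>v ?p - V p\<bar> < \<mu>" "\<bar>v' ?p - V' p\<bar> < \<mu>" "\<bar>v' ?r - V' r\<bar> < \<mu>"
          using close[of ?p] close[of ?r] range pers[of p k] pers[of r k] by auto
        then show "0 < v' ?p" "- b < v ?p" "v' ?r < 0" using \<mu>_le by linarith+
      qed
      obtain m where m: "?p \<le> m" "m \<le> ?r" and max: "\<And>x. ?p \<le> x \<Longrightarrow> x \<le> ?r \<Longrightarrow> v x \<le> v m"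
        using continuous_attains_sup[of "{?p..?r}" v] o.v_cont range by auto
      have "m \<noteq> ?p"
      proof
        assume eq: "m = ?p"
        obtain d where d: "d > 0" "\<And>h. 0 < h \<Longrightarrow> h < d \<Longrightarrow> v ?p < v (?p + h)"
          using DERIV_pos_inc_right[OF o.v vp(1)] by blast
        define h where "h = min (d/2) (?r - ?p)"
        have "0 < h" "h < d" "?p + h \<le> ?r" using d range by (auto simp: h_def)
        then show False using d(2)[of h] max[of "?p + h"] eq by auto
      qed
      moreover have "m \<noteq> ?r"
      proof
        assume eq: "m = ?r"
        obtain d where d: "d > 0" "\<And>h. 0 < h \<Longrightarrow> h < d \<Longrightarrow> v ?r < v (?r - h)"
          using DERIV_neg_dec_left[OF o.v vr] by blast
        define h where "h = min (d/2) (?r - ?p)"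
        have "0 < h" "h < d" "?p \<le> ?r - h" using d range by (auto simp: h_def)
        then show False using d(2)[of h] max[of "?r - h"] eq by auto
      qed
      ultimately have mi: "?p < m" "m < ?r" using m by auto
      have "v' m = 0"
        by (rule DERIV_local_max[OF o.v, of "min (m - ?p) (?r - m)"]) (use mi max in auto)
      moreover have "- b < v m" using max[of ?p] range vp by auto
      ultimately show ?thesis using mi by blast
    qed
    then obtain \<tau> where \<tau>: "\<And>k. k < N \<Longrightarrow> p + real k * T < \<tau> k \<and> \<tau> k < r + real k * T \<and>
        v' (\<tau> k) = 0 \<and> - b < v (\<tau> k)"
      by metis
    have less: "\<tau> i < \<tau> j" if "i < j" "j < N" for i j
    proof -
      have "(real i + 1) * T \<le> real j * T" using that T by (intro mult_right_mono) auto
      then show ?thesis using \<tau>[of i] \<tau>[of j] that pr by (auto simp: algebra_simps)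
    qed
    have inj: "inj_on \<tau> {..<N}"
      by (rule inj_onI) (metis less lessThan_iff linorder_neqE_nat less_irrefl)
    show "\<exists>A\<subseteq>{0<..pi / \<epsilon>}. finite A \<and> card A = N \<and> (\<forall>t\<in>A. v' t = 0 \<and> - b < v t)"
    proof (intro exI[of _ "\<tau> ` {..<N}"] conjI)
      show "\<tau> ` {..<N} \<subseteq> {0<..pi / \<epsilon>}"
      proof clarify
        fix k assume k: "k < N"
        have "real k * T \<le> real N * T" "0 \<le> real k * T" using k T by (auto intro: mult_right_mono)
        then have "0 < \<tau> k" "\<tau> k \<le> pi / \<epsilon>" using \<tau>[OF k] ES pr unfolding E_def by linarith+
        then show "\<tau> k \<in> {0<..pi / \<epsilon>}" by simp
      qed
      show "card (\<tau> ` {..<N}) = N" using card_image[OF inj] by simp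
    qed (use \<tau> in auto)
  qed
qed

lemma shooting:
  "\<exists>\<epsilon>0>0. \<forall>\<epsilon>. 0 < \<epsilon> \<and> \<epsilon> < \<epsilon>0 \<longrightarrow> (\<forall>M::nat. 0 < M \<and> M \<le> N \<longrightarrow>
    (\<exists>\<alpha> v v'. orbit a b lam \<epsilon> \<alpha> v v' \<and> \<alpha> \<noteq> - sqrt lam \<and> v' (pi / \<epsilon>) = 0 \<and> - b < v (pi / \<epsilon>) \<and>
      card {t \<in> {0<..pi / \<epsilon>}. v' t = 0 \<and> - b < v t} = M))"
proof -
  have "2 * b * (a + b) < (a - b)^2" using gap by (simp add: power2_eq_square algebra_simps)
  then have "sqrt (2 * b * (a + b)) < a - b" using b_less_a b_pos by (intro real_less_lsqrt) auto
  then have "- a + sqrt (2 * b * (a + b)) < - b" by simp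
  then obtain \<alpha>s where s: "- a + sqrt (2 * b * (a + b)) < \<alpha>s" "\<alpha>s < - b" using dense by blast
  have "0 < sqrt (2 * b * (a + b))" using a_pos b_pos by simp
  then have s1: "- a < \<alpha>s" using s by linarith
  have "(sqrt (2 * b * (a + b)))^2 < (\<alpha>s + a)^2"
    using s a_pos b_pos by (intro power_strict_mono) auto
  then have s2: "2 * b * (a + b) < (\<alpha>s + a)^2" using a_pos b_pos by simp
  have "a < sqrt lam"
    using a_pos b_pos by (intro real_less_rsqrt) (simp add: lam_eq add_pos_pos)
  then have left: "- sqrt lam < \<alpha>s" using s1 by simp
  obtain \<epsilon>1 where e1: "\<epsilon>1 > 0" and many: "\<And>\<epsilon> v v'. \<epsilon> < \<epsilon>1 \<Longrightarrow> orbit a b lam \<epsilon> \<alpha>s v v' \<Longrightarrow>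
    \<exists>A \<subseteq> {0<..pi / \<epsilon>}. finite A \<and> card A = N \<and> (\<forall>t\<in>A. v' t = 0 \<and> - b < v t)"
    using many_critical_points[OF s1 s(2) s2, of N] by blast
  \<comment> \<open>Solving the hypothesis \<open>fast\<close> of
    \<open>no_critical_from_left_end\<close> for \<epsilon> gives the bound
    \<open>pi / (3 * C)\<close>.\<close>
  define C where "C = sqrt (4 * (R + sqrt lam))"
  have "0 < 4 * (R + sqrt lam)" using R_pos lam_pos by (intro mult_pos_pos add_pos_pos) auto
  then have C: "0 < C" "C^2 = 4 * (R + sqrt lam)" unfolding C_def by (auto simp del: mult_pos_pos)
  define \<epsilon>0 where "\<epsilon>0 = min \<epsilon>1 (pi / (3 * C))"
  show ?thesis
  proof (rule exI[of _ \<epsilon>0], intro conjI allI impI)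
    show "0 < \<epsilon>0" using e1 C by (simp add: \<epsilon>0_def)
    fix \<epsilon> and M :: nat assume "0 < \<epsilon> \<and> \<epsilon> < \<epsilon>0" and M: "0 < M \<and> M \<le> N"
    then have eps: "0 < \<epsilon>" "\<epsilon> < \<epsilon>1" "\<epsilon> < pi / (3 * C)" by (auto simp: \<epsilon>0_def)
    have "C < pi / (3 * \<epsilon>)" using eps C by (simp add: field_simps)
    then have "C^2 < (pi / (3 * \<epsilon>))^2" using C by (intro power_strict_mono) auto
    then have fast: "4 * (R + sqrt lam) < (pi / (3 * \<epsilon>))^2" using C by simp
    define S where "S = pi / \<epsilon>"
    have S: "0 < S" using eps by (simp add: S_def)
    obtain v v' where sol: "\<And>\<alpha>. v \<alpha> 0 = \<alpha> \<and> v' \<alpha> 0 = 0 \<and>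
        (\<forall>t. (v \<alpha> has_real_derivative v' \<alpha> t) (at t)) \<and>
        (\<forall>t. (v' \<alpha> has_real_derivative F (\<epsilon> * t) (v \<alpha> t)) (at t))"
      using solution_exists[of _ \<epsilon>] by metis
    define I where "I = {- sqrt lam..\<alpha>s}"
    have orb: "orbit a b lam \<epsilon> \<alpha> (v \<alpha>) (v' \<alpha>)" if "\<alpha> \<in> I" for \<alpha>
      by unfold_locales (use sol[of \<alpha>] that eps s in \<open>auto simp: I_def\<close>)
    have S_eq: "orbit.S \<epsilon> = S" if "\<alpha> \<in> I" for \<alpha>
      using orbit.S_def[OF orb[OF that]] by (simp add: S_def)
    define K where "K = exp ((lip + 2) * S)"
    have near: "\<bar>v \<alpha> t - v \<beta> t\<bar> \<le> K * \<bar>\<alpha> - \<beta>\<bar> \<and> \<bar>v' \<alpha> t - v' \<beta> t\<bar> \<le> K * \<bar>\<alpha> - \<beta>\<bar>"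
      if t: "t \<in> {0..S}" for \<alpha> \<beta> t
    proof -
      have "(v \<alpha> t - v \<beta> t)^2 + (v' \<alpha> t - v' \<beta> t)^2
          \<le> ((v \<alpha> 0 - v \<beta> 0)^2 + (v' \<alpha> 0 - v' \<beta> 0)^2 + 0^2) * exp ((lip + 2) * t)"
        by (rule stability[where p = "\<lambda>t. \<epsilon> * t" and q = "\<lambda>t. \<epsilon> * t" and T = S])
          (use sol[of \<alpha>] sol[of \<beta>] t in auto)
      also have "\<dots> = (\<alpha> - \<beta>)^2 * exp ((lip + 2) * t)" using sol[of \<alpha>] sol[of \<beta>] by simp
      also have "\<dots> \<le> (\<alpha> - \<beta>)^2 * K^2"
      proof -
        have "(lip + 2) * t \<le> (lip + 2) * S" using t lip_nonneg by (intro mult_left_mono) auto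
        then have 1: "exp ((lip + 2) * t) \<le> K" by (simp add: K_def)
        have "1 \<le> K" using lip_nonneg S by (simp add: K_def)
        then have "K * 1 \<le> K * K" by (intro mult_left_mono) auto
        with 1 have "exp ((lip + 2) * t) \<le> K^2" unfolding power2_eq_square by linarith
        then show ?thesis by (simp add: mult_left_mono)
      qed
      also have "\<dots> = (K * \<bar>\<alpha> - \<beta>\<bar>)^2" by (simp add: power_mult_distrib mult_ac)
      finally have le: "(v \<alpha> t - v \<beta> t)^2 + (v' \<alpha> t - v' \<beta> t)^2 \<le> (K * \<bar>\<alpha> - \<beta>\<bar>)^2" .
      have K0: "0 \<le> K * \<bar>\<alpha> - \<beta>\<bar>" by (simp add: K_def)
      have "\<bar>v \<alpha> t - v \<beta> t\<bar>^2 \<le> (K * \<bar>\<alpha> - \<beta>\<bar>)^2" "\<bar>v' \<alpha> t - v' \<beta> t\<bar>^2 \<le> (K * \<bar>\<alpha> - \<beta>\<bar>)^2"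
        using le zero_le_power2[of "v \<alpha> t - v \<beta> t"] zero_le_power2[of "v' \<alpha> t - v' \<beta> t"]
        unfolding power2_abs by linarith+
      then show ?thesis using power2_le_imp_le[OF _ K0] by blast
    qed
    have vc: "continuous_on A (v \<alpha>)" and v'c: "continuous_on A (v' \<alpha>)" if "\<alpha> \<in> I" for \<alpha> A
      using orbit.v_cont[OF orb[OF that]] orbit.v'_cont[OF orb[OF that]] by auto
    have joint: "continuous_on (I \<times> {0..S}) (\<lambda>p. v (fst p) (snd p))"
       "continuous_on (I \<times> {0..S}) (\<lambda>p. v' (fst p) (snd p))"
      by (rule continuous_on_Times_lipschitz[where C = K]; use near vc v'c in auto)+
    define g where "g = (\<lambda>p. Complex (- b - v (fst p) (snd p)) (v' (fst p) (snd p)))"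
    have gc: "continuous_on (I \<times> {0..S}) g"
      unfolding g_def by (intro continuous_intros joint)
    have crit: "v' \<alpha> t = 0 \<Longrightarrow> - b \<le> v \<alpha> t \<Longrightarrow> F (\<epsilon> * t) (v \<alpha> t) < 0 \<and> - b < v \<alpha> t"
      if \<alpha>: "\<alpha> \<in> I" and t: "0 < t" "t \<le> S" for \<alpha> t
    proof -
      assume z: "v' \<alpha> t = 0" and above: "- b \<le> v \<alpha> t"
      interpret o: orbit a b lam \<epsilon> \<alpha> "v \<alpha>" "v' \<alpha>" by (rule orb[OF \<alpha>])
      have conc: "f (v \<alpha> t) + cos (\<epsilon> * t) < 0"
        by (rule o.critical_concave) (use t z above o.S_def S_def in auto)
      moreover have "\<bar>v \<alpha> t\<bar> < R" by (rule o.bounded_before_critical[OF t(1) z]) (use t in auto)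
      moreover have "v \<alpha> t \<noteq> - b"
      proof
        assume "v \<alpha> t = - b"
        then have "f (v \<alpha> t) = 1" using f_minus_one[of "- b"] by simp
        then show False using conc cos_ge_minus_one[of "\<epsilon> * t"] by linarith
      qed
      ultimately show ?thesis using above F_inside[of "v \<alpha> t" "\<epsilon> * t"] by auto
    qed
    \<comment> \<open>At time 0 the real part \<open>- b - \<alpha>\<close> is positive; later a
      zero would be a critical point at height exactly \<open>- b\<close>, which \<open>crit\<close>
      rules out.\<close>
    have gnz: "g p \<noteq> 0" if p: "p \<in> I \<times> {0..S}" for p
    proof -
      obtain \<alpha> t where pe: "p = (\<alpha>, t)" and \<alpha>: "\<alpha> \<in> I" and t: "0 \<le> t" "t \<le> S" using p by auto
      show ?thesis
      proof (cases "t = 0")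
        case True
        then show ?thesis using sol[of \<alpha>] \<alpha> s by (auto simp: g_def pe complex_eq_iff I_def)
      next
        case False
        then show ?thesis using crit[OF \<alpha>, of t] t by (auto simp: g_def pe complex_eq_iff)
      qed
    qed
    \<comment> \<open>One logarithm on the whole rectangle, rather than one for each \<alpha>, makes
      the final angle continuous in \<alpha>.\<close>
    have "contractible (I \<times> {0..S})"
      by (intro convex_imp_contractible convex_Times) (auto simp: I_def)
    then obtain l where lc: "continuous_on (I \<times> {0..S}) l"
      and l: "\<And>p. p \<in> I \<times> {0..S} \<Longrightarrow> g p = exp (l p)"
      using continuous_logarithm_on_contractible[OF gc _ gnz] by blast
    \<comment> \<open>The argument at time 0 is a multiple of 2 pi by \<open>base\<close>;
      subtracting it makes every angle start at 0 without changing sine and cosine.\<close>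
    define \<theta> where "\<theta> = (\<lambda>\<alpha> t. Im (l (\<alpha>, t)) - Im (l (\<alpha>, 0)))"
    have base: "sin (Im (l (\<alpha>, 0))) = 0 \<and> cos (Im (l (\<alpha>, 0))) = 1" if "\<alpha> \<in> I" for \<alpha>
    proof -
      have "exp (l (\<alpha>, 0)) = Complex (- b - \<alpha>) 0"
        using l[of "(\<alpha>, 0)"] that S sol[of \<alpha>] by (simp add: g_def)
      then have "exp (Re (l (\<alpha>, 0))) * sin (Im (l (\<alpha>, 0))) = 0"
        "exp (Re (l (\<alpha>, 0))) * cos (Im (l (\<alpha>, 0))) = - b - \<alpha>"
        by (metis Im_exp complex.sel(2), metis Re_exp complex.sel(1))
      moreover have "0 < - b - \<alpha>" using that s by (auto simp: I_def)
      ultimately have "sin (Im (l (\<alpha>, 0))) = 0" "0 < cos (Im (l (\<alpha>, 0)))"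
        by (simp, metis exp_gt_zero zero_less_mult_pos)
      then show ?thesis using sin_zero_abs_cos_one by fastforce
    qed
    have clk: "clock (\<theta> \<alpha>) (v' \<alpha>) (\<lambda>t. - b - v \<alpha> t) S" if \<alpha>: "\<alpha> \<in> I" for \<alpha>
    proof
      show "0 \<le> S" using S by simp
      show "\<theta> \<alpha> 0 = 0" by (simp add: \<theta>_def)
      show "continuous_on {0..S} (\<theta> \<alpha>)"
        unfolding \<theta>_def
        by (intro continuous_intros continuous_on_compose2[OF lc]) (use \<alpha> S in auto)
      fix t assume t: "0 \<le> t" "t \<le> S"
      have sc: "sin (\<theta> \<alpha> t) = sin (Im (l (\<alpha>, t)))" "cos (\<theta> \<alpha> t) = cos (Im (l (\<alpha>, t)))"
        using base[OF \<alpha>] by (simp_all add: \<theta>_def sin_diff cos_diff)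
      have "exp (l (\<alpha>, t)) = Complex (- b - v \<alpha> t) (v' \<alpha> t)"
        using l[of "(\<alpha>, t)"] \<alpha> t by (simp add: g_def)
      then have "v' \<alpha> t = exp (Re (l (\<alpha>, t))) * sin (\<theta> \<alpha> t)"
        "- b - v \<alpha> t = exp (Re (l (\<alpha>, t))) * cos (\<theta> \<alpha> t)"
        unfolding sc by (metis Im_exp complex.sel(2), metis Re_exp complex.sel(1))
      then show "sgn (v' \<alpha> t) = sgn (sin (\<theta> \<alpha> t))" "sgn (- b - v \<alpha> t) = sgn (cos (\<theta> \<alpha> t))"
        by (simp_all add: sgn_mult)
    next
      fix t assume t: "0 < t" "t \<le> S" "v' \<alpha> t = 0" "- b - v \<alpha> t < 0"
      then show "\<exists>l. (v' \<alpha> has_real_derivative l) (at t) \<and> l < 0"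
        using crit[OF \<alpha>, of t] sol[of \<alpha>] by auto
    qed
    note level_def = clock.level_def[OF clk]
    define lev where "lev = (2 * real M - 1) * pi"
    have lev: "clock.level (int M) = lev" if "\<alpha> \<in> I" for \<alpha>
      using level_def[OF that] by (simp add: lev_def)
    have ends: "- sqrt lam \<in> I" "\<alpha>s \<in> I" using left by (auto simp: I_def)
    \<comment> \<open>Since \<open>lev\<close> is at least pi, the angle would have to pass pi,
      which means a critical point of the orbit from \<open>- sqrt lam\<close>.\<close>
    have low: "\<theta> (- sqrt lam) S < lev"
    proof (rule ccontr)
      assume n: "\<not> \<theta> (- sqrt lam) S < lev"
      interpret c: clock "\<theta> (- sqrt lam)" "v' (- sqrt lam)" "\<lambda>t. - b - v (- sqrt lam) t" S
        by (rule clk[OF ends(1)])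
      have "1 * pi \<le> (2 * real M - 1) * pi" using M by (intro mult_right_mono) auto
      then have "pi \<le> lev" by (simp add: lev_def)
      then obtain t where t: "0 \<le> t" "t \<le> S" "\<theta> (- sqrt lam) t = pi"
        using IVT'[of "\<theta> (- sqrt lam)" 0 pi S] c.cont c.start n S by auto
      have "t \<noteq> 0" using t c.start by auto
      moreover have "c.level 1 = pi" by (simp add: c.level_def)
      then have "v' (- sqrt lam) t = 0" using c.level_iff[of t] t by metis
      ultimately show False
        using orbit.no_critical_from_left_end[OF orb[OF ends(1)] refl fast, of t] t
          S_eq[OF ends(1)] by auto
    qed
    have high: "lev \<le> \<theta> \<alpha>s S"
    proof -
      interpret c: clock "\<theta> \<alpha>s" "v' \<alpha>s" "\<lambda>t. - b - v \<alpha>s t" S by (rule clk[OF ends(2)])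
      obtain A where A: "A \<subseteq> {0<..pi / \<epsilon>}" "finite A" "card A = N" "\<forall>t\<in>A. v' \<alpha>s t = 0 \<and> - b < v \<alpha>s t"
        using many[OF eps(2) orb[OF ends(2)]] by blast
      have "A \<subseteq> {0<..S}" using A by (simp add: S_def)
      then have "A \<subseteq> c.ticks" using A by (auto simp: c.ticks_def)
      then have "c.level (int M) \<le> \<theta> \<alpha>s S" using A M by (intro c.ticks_lower_bound) auto
      then show ?thesis using lev[OF ends(2)] by simp
    qed
    have "continuous_on I (\<lambda>\<alpha>. \<theta> \<alpha> S)"
      unfolding \<theta>_def by (intro continuous_intros continuous_on_compose2[OF lc]) (use S in auto)
    then obtain \<alpha> where \<alpha>: "\<alpha> \<in> I" "\<theta> \<alpha> S = lev"
      using IVT'[of "\<lambda>\<alpha>. \<theta> \<alpha> S" "- sqrt lam" lev \<alpha>s] low high left by (auto simp: I_def)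
    interpret c: clock "\<theta> \<alpha>" "v' \<alpha>" "\<lambda>t. - b - v \<alpha> t" S by (rule clk[OF \<alpha>(1)])
    have top: "\<theta> \<alpha> S = c.level (int M)" using \<alpha> lev by simp
    have "c.ticks = {t \<in> {0<..S}. v' \<alpha> t = 0 \<and> - b < v \<alpha> t}"
      by (auto simp: c.ticks_def)
    then have "card {t \<in> {0<..S}. v' \<alpha> t = 0 \<and> - b < v \<alpha> t} = M"
      using c.card_ticks_eq[OF top] M by simp
    moreover have "v' \<alpha> S = 0" "- b < v \<alpha> S" using c.level_iff[of S] top S by auto
    moreover have "\<alpha> \<noteq> - sqrt lam" using low \<alpha> by auto
    ultimately show "\<exists>\<alpha> v v'. orbit a b lam \<epsilon> \<alpha> v v' \<and> \<alpha> \<noteq> - sqrt lam \<and> v' (pi / \<epsilon>) = 0 \<and>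
        - b < v (pi / \<epsilon>) \<and> card {t \<in> {0<..pi / \<epsilon>}. v' t = 0 \<and> - b < v t} = M"
      using orb[OF \<alpha>(1)] by (intro exI[of _ \<alpha>] exI[of _ "v \<alpha>"] exI[of _ "v' \<alpha>"]) (auto simp: S_def)
  qed
qed

end

section \<open>Return to the original time scale\<close>

lemma eventually_nhds_abs:
  "eventually P (nhds (t::real)) \<longleftrightarrow> (\<exists>d>0. \<forall>s. \<bar>s - t\<bar> < d \<longrightarrow> P s)"
  by (simp add: eventually_nhds_metric dist_real_def)

context orbit begin

lemma local_max_at_rescaled:
  "local_max_at (\<lambda>t. v (t / \<epsilon>)) t \<longleftrightarrow> (\<exists>d>0. \<forall>s. \<bar>s - t / \<epsilon>\<bar> < d \<longrightarrow> v s \<le> v (t / \<epsilon>))"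
proof
  assume "local_max_at (\<lambda>t. v (t / \<epsilon>)) t"
  then obtain d where d: "d > 0" "\<And>x. \<bar>x - t\<bar> < d \<Longrightarrow> v (x / \<epsilon>) \<le> v (t / \<epsilon>)"
    unfolding local_max_at_def eventually_nhds_abs by blast
  show "\<exists>d>0. \<forall>s. \<bar>s - t / \<epsilon>\<bar> < d \<longrightarrow> v s \<le> v (t / \<epsilon>)"
  proof (intro exI[of _ "d / \<epsilon>"] conjI allI impI)
    fix s assume "\<bar>s - t / \<epsilon>\<bar> < d / \<epsilon>"
    then have "\<bar>s - t / \<epsilon>\<bar> * \<epsilon> < d" using eps by (simp add: pos_less_divide_eq)
    moreover have "\<bar>s * \<epsilon> - t\<bar> = \<bar>s - t / \<epsilon>\<bar> * \<epsilon>"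
      using eps by (simp add: abs_mult_pos left_diff_distrib)
    ultimately show "v s \<le> v (t / \<epsilon>)" using d(2)[of "s * \<epsilon>"] eps by simp
  qed (use d eps in simp)
next
  assume "\<exists>d>0. \<forall>s. \<bar>s - t / \<epsilon>\<bar> < d \<longrightarrow> v s \<le> v (t / \<epsilon>)"
  then obtain d where d: "d > 0" "\<And>s. \<bar>s - t / \<epsilon>\<bar> < d \<Longrightarrow> v s \<le> v (t / \<epsilon>)" by blast
  show "local_max_at (\<lambda>t. v (t / \<epsilon>)) t"
    unfolding local_max_at_def eventually_nhds_abs
  proof (intro exI[of _ "d * \<epsilon>"] conjI allI impI)
    fix x assume "\<bar>x - t\<bar> < d * \<epsilon>"
    moreover have "\<bar>x / \<epsilon> - t / \<epsilon>\<bar> = \<bar>x - t\<bar> / \<epsilon>" using eps by (simp add: diff_divide_distrib[symmetric])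
    ultimately show "v (x / \<epsilon>) \<le> v (t / \<epsilon>)" using d(2)[of "x / \<epsilon>"] eps by (simp add: pos_divide_less_eq)
  qed (use d eps in simp)
qed

lemma concave_critical_maximum:
  assumes "v' t = 0" "F (\<epsilon> * t) (v t) < 0"
  shows "\<exists>d>0. \<forall>s. \<bar>s - t\<bar> < d \<longrightarrow> v s \<le> v t"
proof -
  note minus = DERIV_minus[OF v] DERIV_minus[OF v']
  have 1: "- v' t = 0" "0 < - F (\<epsilon> * t) (v t)" using assms by auto
  obtain d where d: "d > 0" "\<And>s. t - d < s \<Longrightarrow> s < t \<Longrightarrow> - v t < - v s"
    using convex_left_of_critical[OF minus 1] by blast
  obtain e where e: "e > 0" "\<And>s. t < s \<Longrightarrow> s < t + e \<Longrightarrow> - v t < - v s"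
    using convex_right_of_critical[OF minus 1] by blast
  have "v s \<le> v t" if "\<bar>s - t\<bar> < min d e" for s
    using d(2)[of s] e(2)[of s] that by (cases s t rule: linorder_cases) auto
  then show ?thesis using d e by (intro exI[of _ "min d e"]) auto
qed

text \<open>Identifies the counted critical points with the local maxima: concavity gives one
  direction, and a maximum below \<open>- b\<close> is excluded by \<open>no_low_maximum\<close>
  before S and by \<open>stop\<close> at S.\<close>

lemma maximum_iff:
  assumes stop: "v' S = 0" "- b < v S" and t: "0 < t" "t \<le> S"
  shows "(\<exists>d>0. \<forall>s. \<bar>s - t\<bar> < d \<longrightarrow> v s \<le> v t) \<longleftrightarrow> v' t = 0 \<and> - b < v t"
proof
  assume "v' t = 0 \<and> - b < v t"
  then have z: "v' t = 0" "- b \<le> v t" by auto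
  have "\<bar>v t\<bar> < R" by (rule bounded_before_critical[OF t(1) z(1)]) (use t in auto)
  then have "F (\<epsilon> * t) (v t) < 0" using critical_concave[OF t z] F_inside by simp
  then show "\<exists>d>0. \<forall>s. \<bar>s - t\<bar> < d \<longrightarrow> v s \<le> v t" by (rule concave_critical_maximum[OF z(1)])
next
  assume "\<exists>d>0. \<forall>s. \<bar>s - t\<bar> < d \<longrightarrow> v s \<le> v t"
  then obtain d where d: "d > 0" "\<And>s. \<bar>s - t\<bar> < d \<Longrightarrow> v s \<le> v t" by blast
  have crit: "v' t = 0"
    by (rule DERIV_local_max[OF v d(1)]) (use d in \<open>auto simp: abs_minus_commute\<close>)
  have "\<not> v t < - b"
  proof
    assume low: "v t < - b"
    then have "t < S" using stop t by (cases "t = S") auto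
    then show False using no_low_maximum[OF t(1) _ d low stop(1)] by blast
  qed
  moreover have "v t \<noteq> - b"
  proof
    assume eq: "v t = - b"
    then have "f (v t) = 1" using f_minus_one[of "- b"] by simp
    moreover have "f (v t) + cos (\<epsilon> * t) < 0" by (rule critical_concave[OF t crit]) (simp add: eq)
    ultimately show False using cos_ge_minus_one[of "\<epsilon> * t"] by linarith
  qed
  ultimately show "v' t = 0 \<and> - b < v t" using crit by auto
qed

lemma rescaled_solution:
  assumes stop: "v' S = 0" "- b < v S" and "\<alpha> \<noteq> - sqrt lam"
    and M: "card {t \<in> {0<..S}. v' t = 0 \<and> - b < v t} = M"
  shows "\<exists>u. forced_solution \<epsilon> lam u \<and> (\<forall>t. u (t + 2 * pi) = u t) \<and>
    card {t \<in> {0<..pi}. local_max_at u t} = M \<and> local_max_at u pi \<and> local_min_at u 0 \<and>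
    - sqrt lam < u 0 \<and> u 0 < - b \<and> - b < u pi \<and> u pi < a + b"
proof -
  define u where "u = (\<lambda>t. v (t / \<epsilon>))"
  have per: "v (t + 2 * S) = v t" for t
    by (rule periodic_solution[OF v v' init(2) stop(1)]) (simp add: eps_S)
  interpret p: periodic_fun_simple v "2 * S" by unfold_locales (rule per)
  have ev: "v (- t) = v t" for t by (rule even_solution[OF v v' init(2)])
  have inside: "\<bar>v t\<bar> < R" if "0 \<le> t" "t \<le> S" for t
    by (rule bounded_before_critical[OF S_pos stop(1) that])
  \<comment> \<open>The unclamped equation must hold for all times: the period \<open>2 * S\<close>
    reduces to one period, and evenness folds its second half onto \<open>{0..S}\<close>.\<close>
  have bdd: "\<bar>v t\<bar> \<le> R" for t
  proof -
    define n where "n = \<lfloor>t / (2 * S)\<rfloor>"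
    define s where "s = t - of_int n * (2 * S)"
    have vs: "v s = v t" unfolding s_def by (rule p.minus_of_int)
    have "of_int n \<le> t / (2 * S)" "t / (2 * S) < of_int n + 1" unfolding n_def by linarith+
    then have "of_int n * (2 * S) \<le> t" "t < (of_int n + 1) * (2 * S)"
      using S_pos by (simp_all add: pos_le_divide_eq pos_divide_less_eq)
    then have s: "0 \<le> s" "s < 2 * S" by (simp_all add: s_def distrib_right)
    show ?thesis
    proof (cases "s \<le> S")
      case True
      then show ?thesis using inside[of s] s vs by simp
    next
      case False
      have "v (2 * S - s) = v s" using per[of "- s"] ev[of s] by (simp add: algebra_simps)
      then show ?thesis using inside[of "2 * S - s"] s False vs by simp
    qed
  qed
  have scale: "((\<lambda>t. t / \<epsilon>) has_real_derivative 1 / \<epsilon>) (at t)" for t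
    by (rule DERIV_cdivide[OF DERIV_ident])
  have "forced_solution \<epsilon> lam u"
    unfolding forced_solution_def
  proof (intro exI conjI allI)
    show "(u has_real_derivative v' (t / \<epsilon>) * (1 / \<epsilon>)) (at t)" for t
      unfolding u_def by (rule DERIV_chain2[OF v scale])
    show "((\<lambda>t. v' (t / \<epsilon>) * (1 / \<epsilon>)) has_real_derivative
        F (\<epsilon> * (t / \<epsilon>)) (v (t / \<epsilon>)) * (1 / \<epsilon>) * (1 / \<epsilon>)) (at t)" for t
      by (rule DERIV_cmult_right[OF DERIV_chain2[OF v' scale]])
    show "\<epsilon>^2 * (F (\<epsilon> * (t / \<epsilon>)) (v (t / \<epsilon>)) * (1 / \<epsilon>) * (1 / \<epsilon>)) = u t ^ 3 - lam * u t + cos t" for t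
      using eps F_inside[OF bdd, of "\<epsilon> * (t / \<epsilon>)" "t / \<epsilon>"] by (simp add: u_def f_def power2_eq_square)
  qed
  moreover have "u (t + 2 * pi) = u t" for t
    using per[of "t / \<epsilon>"] eps by (simp add: u_def S_def add_divide_distrib)
  moreover have "card {t \<in> {0<..pi}. local_max_at u t} = M"
  proof -
    have "{t \<in> {0<..pi}. local_max_at u t} = (\<lambda>s. \<epsilon> * s) ` {t \<in> {0<..S}. v' t = 0 \<and> - b < v t}"
    proof (intro set_eqI iffI)
      fix t assume "t \<in> {t \<in> {0<..pi}. local_max_at u t}"
      then have t: "0 < t" "t \<le> pi" "local_max_at u t" by auto
      have s: "0 < t / \<epsilon>" "t / \<epsilon> \<le> S" using t eps by (auto simp: S_def divide_right_mono)
      have "v' (t / \<epsilon>) = 0 \<and> - b < v (t / \<epsilon>)"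
        using maximum_iff[OF stop s] t(3) local_max_at_rescaled[of t] unfolding u_def by blast
      then show "t \<in> (\<lambda>s. \<epsilon> * s) ` {t \<in> {0<..S}. v' t = 0 \<and> - b < v t}"
        using s eps by (intro image_eqI[of _ _ "t / \<epsilon>"]) auto
    next
      fix t assume "t \<in> (\<lambda>s. \<epsilon> * s) ` {t \<in> {0<..S}. v' t = 0 \<and> - b < v t}"
      then obtain s where s: "0 < s" "s \<le> S" "v' s = 0" "- b < v s" and t: "t = \<epsilon> * s" by auto
      then have "t / \<epsilon> = s" using eps by simp
      then have "local_max_at u t"
        using maximum_iff[OF stop s(1,2)] s local_max_at_rescaled[of t] unfolding u_def by simp
      then show "t \<in> {t \<in> {0<..pi}. local_max_at u t}"
        using s t eps eps_le_pi[of s] by auto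
    qed
    then show ?thesis using M eps by (simp add: card_image inj_on_def)
  qed
  moreover have "local_max_at u pi"
    using maximum_iff[OF stop S_pos order_refl] stop local_max_at_rescaled[of pi]
    unfolding u_def S_def by blast
  moreover have "local_min_at u 0"
  proof -
    have D: "(v' has_real_derivative F 0 \<alpha>) (at 0)" using v'[of 0] init by simp
    obtain d where d: "d > 0" "\<And>s. 0 < s \<Longrightarrow> s < d \<Longrightarrow> v 0 < v s"
      using convex_right_of_critical[OF v D init(2) F_start] by auto
    have "v 0 \<le> v s" if "\<bar>s\<bar> < d" for s
      using d(2)[of "\<bar>s\<bar>"] that ev[of s] by (cases "s = 0") (auto simp: abs_if split: if_splits)
    moreover have "\<bar>x / \<epsilon>\<bar> < d" if "\<bar>x\<bar> < d * \<epsilon>" for x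
      using that eps by (simp add: pos_divide_less_eq)
    ultimately show ?thesis
      unfolding local_min_at_def eventually_nhds_abs u_def
      using d(1) eps by (intro exI[of _ "d * \<epsilon>"]) auto
  qed
  moreover have "u 0 = \<alpha>" "u pi = v S" by (simp_all add: u_def init S_def)
  moreover have "v S < a + b"
  proof -
    have "f (v S) + cos (\<epsilon> * S) < 0"
      by (rule critical_concave[OF S_pos order_refl stop(1)]) (use stop in simp)
    then have "(v S + a) * (v S + b) * (v S - a - b) < 0" by (simp add: eps_S f_minus_one[symmetric])
    moreover have "0 < v S + a" "0 < v S + b" using stop b_less_a b_pos by auto
    ultimately show ?thesis by (auto simp: mult_less_0_iff)
  qed
  ultimately show ?thesis
    using assms(3) \<alpha> stop by (intro exI[of _ u]) auto
qed

end

section \<open>The homoclinic orbit and the critical parameter\<close>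

text \<open>Subtracting the quotient relations of two pairs of roots shows that the three roots sum
  to 0; the sign change of the cosine and the oddness of the cubic negate them at pi.\<close>

lemma roots_at_0_and_pi:
  assumes lam: "lam > lambda0"
  obtains a b where "0 < b" "b < a" "a * b * (a + b) = 1" "lam = a^2 + a * b + b^2"
    "U_upper lam 0 = a" "U_mid lam 0 = b" "cubic_roots lam 0 = {- (a + b), b, a}"
    "U_mid lam pi = - b" "U_upper lam pi = a + b"
proof -
  define a b c where "a = U_upper lam 0" and "b = U_mid lam 0" and "c = U_lower lam 0"
  have ord: "c < b" "b < a" and roots: "cubic_roots lam 0 = {c, b, a}"
    using U_ordered_roots[OF lam, of 0] by (auto simp: a_def b_def c_def)
  have "a \<in> cubic_roots lam 0" "b \<in> cubic_roots lam 0" "c \<in> cubic_roots lam 0"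
    using roots by auto
  then have e: "a^3 - lam * a + 1 = 0" "b^3 - lam * b + 1 = 0" "c^3 - lam * c + 1 = 0"
    by (simp_all add: cubic_roots_def)
  have quot: "x^2 + x * y + y^2 = lam" if "x^3 - lam * x + 1 = 0" "y^3 - lam * y + 1 = 0" "x \<noteq> y" for x y
  proof -
    have "(x - y) * (x^2 + x * y + y^2 - lam) = (x^3 - lam * x + 1) - (y^3 - lam * y + 1)"
      by (simp add: power2_eq_square power3_eq_cube algebra_simps)
    then show ?thesis using that by simp
  qed
  have ab: "a^2 + a * b + b^2 = lam" and cb: "c^2 + c * b + b^2 = lam"
    using quot[OF e(1,2)] quot[OF e(3,2)] ord by auto
  have "(a - c) * (a + b + c) = (a^2 + a * b + b^2) - (c^2 + c * b + b^2)"
    by (simp add: power2_eq_square algebra_simps)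
  then have sum: "a + b + c = 0" using ab cb ord by simp
  then have c: "c = - (a + b)" by simp
  have prod: "a * b * (a + b) = 1"
  proof -
    have "a^3 - (a^2 + a * b + b^2) * a + 1 = 0" using e(1) ab by simp
    then show ?thesis by (simp add: power2_eq_square power3_eq_cube algebra_simps)
  qed
  have a0: "0 < a" "0 < a + b" using ord c by linarith+
  have "0 < a * b * (a + b)" using prod by simp
  then have b0: "0 < b" using a0 by (simp add: zero_less_mult_iff)
  have "cubic_roots lam pi = {U_lower lam pi, U_mid lam pi, U_upper lam pi}"
    and ordpi: "U_lower lam pi < U_mid lam pi" "U_mid lam pi < U_upper lam pi"
    using U_ordered_roots[OF lam, of pi] by auto
  moreover have "cubic_roots lam pi = {- a, - b, a + b}"
  proof -
    have "x \<in> cubic_roots lam pi \<longleftrightarrow> - x \<in> cubic_roots lam 0" for x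
      by (auto simp: cubic_roots_def)
    moreover have "- x = - (a + b) \<longleftrightarrow> x = a + b" "- x = b \<longleftrightarrow> x = - b" "- x = a \<longleftrightarrow> x = - a" for x
      by linarith+
    ultimately show ?thesis unfolding roots c by blast
  qed
  ultimately have eq: "{U_lower lam pi, U_mid lam pi, U_upper lam pi} = {- a, - b, a + b}" by simp
  have o2: "- a < - b" "- b < a + b" using ord b0 a0 by auto
  have up: "U_upper lam pi = a + b"
  proof -
    have "U_upper lam pi = Max {- a, - b, a + b}"
      unfolding U_upper_def using eq \<open>cubic_roots lam pi = {- a, - b, a + b}\<close> by simp
    then show ?thesis using o2 by simp
  qed
  have lo: "U_lower lam pi = - a"
  proof -
    have "U_lower lam pi = Min {- a, - b, a + b}"
      unfolding U_lower_def using \<open>cubic_roots lam pi = {- a, - b, a + b}\<close> by simp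
    then show ?thesis using o2 by simp
  qed
  have "U_mid lam pi \<in> {- a, - b, a + b}" using eq by blast
  then have mid: "U_mid lam pi = - b" using ordpi up lo by auto
  have "cubic_roots lam 0 = {- (a + b), b, a}" using roots unfolding c .
  then show thesis
    by (rule that[OF b0 ord(2) prod ab[symmetric] a_def[symmetric] b_def[symmetric] _ mid up])
qed

text \<open>The unclamped cubic is only locally Lipschitz, but on a compact time interval both
  solutions are bounded by some \<open>B\<close>, so \<open>3 * (B * B) + \<bar>lam\<bar>\<close>
  serves there. The inner \<open>forward\<close> is stated for arbitrary functions so that it also
  applies to the reflected pair.\<close>

lemma cubic_uniqueness:
  fixes V W V' W' :: "real \<Rightarrow> real"
  assumes V: "\<And>t. (V has_real_derivative V' t) (at t)"
    and V': "\<And>t. (V' has_real_derivative V t ^ 3 - lam * V t + 1) (at t)"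
    and W: "\<And>t. (W has_real_derivative W' t) (at t)"
    and W': "\<And>t. (W' has_real_derivative W t ^ 3 - lam * W t + 1) (at t)"
    and init: "V 0 = W 0" "V' 0 = 0" "W' 0 = 0"
  shows "V t = W t"
proof -
  have forward: "V t = W t" if t: "0 \<le> t"
    and V: "\<And>t. (V has_real_derivative V' t) (at t)"
    and V': "\<And>t. (V' has_real_derivative V t ^ 3 - lam * V t + 1) (at t)"
    and W: "\<And>t. (W has_real_derivative W' t) (at t)"
    and W': "\<And>t. (W' has_real_derivative W t ^ 3 - lam * W t + 1) (at t)"
    and init: "V 0 = W 0" "V' 0 = 0" "W' 0 = 0" for t and V V' W W' :: "real \<Rightarrow> real"
  proof -
    have Vc: "continuous_on {0..t} V" using V DERIV_isCont continuous_at_imp_continuous_on by blast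
    have Wc: "continuous_on {0..t} W" using W DERIV_isCont continuous_at_imp_continuous_on by blast
    obtain B where B: "\<And>s. 0 \<le> s \<Longrightarrow> s \<le> t \<Longrightarrow> \<bar>V s\<bar> + \<bar>W s\<bar> \<le> B"
      using continuous_attains_sup[of "{0..t}" "\<lambda>s. \<bar>V s\<bar> + \<bar>W s\<bar>"] t Vc Wc
      by (force intro: continuous_intros)
    have B0: "0 \<le> B" using B[of 0] t by linarith
    have "(V t - W t)^2 + (V' t - W' t)^2
        \<le> ((V 0 - W 0)^2 + (V' 0 - W' 0)^2 + 0^2) * exp ((3 * (B * B) + \<bar>lam\<bar> + 2) * t)"
    proof (rule second_order_gronwall[where w = "\<lambda>t. V t - W t" and w' = "\<lambda>t. V' t - W' t"
          and w'' = "\<lambda>t. (V t ^ 3 - lam * V t + 1) - (W t ^ 3 - lam * W t + 1)" and T = t])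
      fix s assume s: "0 \<le> s" "s \<le> t"
      have VB: "\<bar>V s\<bar> \<le> B" "\<bar>W s\<bar> \<le> B" using B[OF s] by auto
      have "\<bar>V s * V s\<bar> \<le> B * B" "\<bar>V s * W s\<bar> \<le> B * B" "\<bar>W s * W s\<bar> \<le> B * B"
        unfolding abs_mult by (intro mult_mono VB abs_ge_zero B0)+
      then have "\<bar>V s * V s + V s * W s + W s * W s - lam\<bar> \<le> 3 * (B * B) + \<bar>lam\<bar>" by linarith
      then have "\<bar>V s * V s + V s * W s + W s * W s - lam\<bar> * \<bar>V s - W s\<bar>
          \<le> (3 * (B * B) + \<bar>lam\<bar>) * \<bar>V s - W s\<bar>" by (rule mult_right_mono) simp
      moreover have "(V s ^ 3 - lam * V s + 1) - (W s ^ 3 - lam * W s + 1)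
          = (V s * V s + V s * W s + W s * W s - lam) * (V s - W s)"
        by (simp add: power3_eq_cube algebra_simps)
      ultimately show "\<bar>(V s ^ 3 - lam * V s + 1) - (W s ^ 3 - lam * W s + 1)\<bar>
          \<le> (3 * (B * B) + \<bar>lam\<bar>) * \<bar>V s - W s\<bar> + 0" by (simp add: abs_mult)
    next
      show "((\<lambda>t. V t - W t) has_real_derivative V' s - W' s) (at s)" for s
        by (rule DERIV_diff[OF V W])
      show "((\<lambda>t. V' t - W' t) has_real_derivative
          (V s ^ 3 - lam * V s + 1) - (W s ^ 3 - lam * W s + 1)) (at s)" for s
        by (rule DERIV_diff[OF V' W'])
    qed (use t B0 in auto)
    then have "(V t - W t)^2 + (V' t - W' t)^2 \<le> 0" using init by simp
    then show ?thesis by (simp add: sum_power2_le_zero_iff)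
  qed
  show ?thesis
  proof (cases "0 \<le> t")
    case True
    show ?thesis by (rule forward[OF True V V' W W' init])
  next
    case False
    have neg: "((\<lambda>s. - s) has_real_derivative -1) (at s)" for s :: real
      by (auto intro!: derivative_eq_intros)
    have r1: "((\<lambda>s. h (- s)) has_real_derivative - h' (- s)) (at s)"
      if "\<And>t. (h has_real_derivative h' t) (at t)" for h h' :: "real \<Rightarrow> real" and s
      using DERIV_chain2[OF that neg] by simp
    have r2: "((\<lambda>s. - h (- s)) has_real_derivative h' (- s)) (at s)"
      if "\<And>t. (h has_real_derivative h' t) (at t)" for h h' :: "real \<Rightarrow> real" and s
      using DERIV_minus[OF r1[OF that]] by simp
    have "V (- (- t)) = W (- (- t))"
      by (rule forward[OF _ r1[OF V] r2[OF V'] r1[OF W] r2[OF W']]) (use False init in auto)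
    then show ?thesis by simp
  qed
qed

text \<open>For \<open>y = a - V\<close> the energy relation reads \<open>y'\<^sup>2 = y\<^sup>2 (k\<^sup>2 - 2 a y + y\<^sup>2 / 2)\<close>, so \<open>1 / y\<close>
  solves a linear equation; this gives the closed form of the homoclinic orbit.\<close>

lemma V1_at_0:
  assumes b: "0 < b" "b < a" and prod: "a * b * (a + b) = 1" and lam: "lam = a^2 + a * b + b^2"
    and up: "U_upper lam 0 = a"
  shows "V1 lam 0 = - a + sqrt (2 * b * (a + b))"
proof -
  \<comment> \<open>For \<open>z = 1 / y\<close> the relation is
    \<open>z'^2 = k^2 * z^2 - 2 * a * z + 1/2\<close>, so \<open>z'' = k^2 * z - a\<close> and
    \<open>z = (a + h * cosh (k * t)) / k^2\<close> with \<open>h^2 = a^2 - k^2 / 2\<close>. Here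
    \<open>k^2 = 3 * a^2 - lam\<close> is the slope of the cubic at \<open>a\<close>, and
    \<open>w\<close> is \<open>k^2 * z\<close>.\<close>
  define h where "h = sqrt (2 * b * (a + b)) / 2"
  have D: "0 < 2 * b * (a + b)" using b by simp
  have h0: "0 < h" and h2: "h^2 = b * (a + b) / 2"
    using D by (simp_all add: h_def power_divide)
  have h_less: "h < a"
  proof -
    have "b * b < a * a" "b * a < a * a" using b by (auto intro!: mult_strict_mono mult_strict_right_mono)
    then have "b * (a + b) < 2 * (a * a)" by (simp add: algebra_simps)
    moreover have "0 < b * (a + b)" using b by simp
    ultimately have "b * (a + b) / 2 < a * a" by linarith
    then have "h^2 < a^2" by (simp add: h2 power2_eq_square[of a])
    then show ?thesis using b by (intro power2_less_imp_less[of h a]) auto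
  qed
  define k where "k = sqrt (2 * (a^2 - h^2))"
  have k2: "k^2 = 2 * (a^2 - h^2)" and k0: "0 < k"
  proof -
    have "h^2 < a^2" using h0 h_less by (intro power_strict_mono) auto
    then show "k^2 = 2 * (a^2 - h^2)" "0 < k" by (auto simp: k_def)
  qed
  have k2': "k^2 = 3 * a^2 - lam" unfolding k2 h2 lam by (simp add: power2_eq_square field_simps)
  define w where "w = (\<lambda>t. a + h * cosh (k * t))"
  define V where "V = (\<lambda>t. a - k^2 / w t)"
  define V' where "V' = (\<lambda>t. k^2 * (h * k * sinh (k * t)) / (w t)^2)"
  have wpos: "0 < w t" for t
    unfolding w_def using b h0 by (intro add_pos_pos mult_pos_pos cosh_real_pos) auto
  have w: "(w has_real_derivative h * k * sinh (k * t)) (at t)" for t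
    unfolding w_def by (auto intro!: derivative_eq_intros)
  have VD: "(V has_real_derivative V' t) (at t)" for t
    unfolding V_def V'_def
    using wpos[of t] by (auto intro!: derivative_eq_intros w simp: power2_eq_square)
  have V'D: "(V' has_real_derivative V t ^ 3 - lam * V t + 1) (at t)" for t
  proof -
    let ?w = "w t" and ?s = "sinh (k * t)"
    have D1: "(V' has_real_derivative
       (k^2 * (h * k * (cosh (k * t) * k)) * (?w)^2 - k^2 * (h * k * ?s) * (2 * ?w * (h * k * ?s))) / (?w^2 * ?w^2)) (at t)"
      unfolding V'_def
      using wpos[of t] by (auto intro!: derivative_eq_intros w)
    have hc: "h * cosh (k * t) = ?w - a" by (simp add: w_def)
    have hs: "(h * ?s)^2 = (?w - a)^2 - h^2"
      unfolding hc[symmetric] power_mult_distrib using cosh_square_eq[of "k * t"]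
      by (simp add: algebra_simps)
    have wn: "?w \<noteq> 0" using wpos[of t] by simp
    have "(k^2 * (h * k * (cosh (k * t) * k)) * ?w^2 - k^2 * (h * k * ?s) * (2 * ?w * (h * k * ?s)))
      = k^2 * k^2 * ((h * cosh (k * t)) * ?w^2 - 2 * ?w * (h * ?s)^2)"
      by (simp add: power2_eq_square algebra_simps)
    also have "\<dots> = k^2 * k^2 * ((?w - a) * ?w^2 - 2 * ?w * ((?w - a)^2 - h^2))"
      unfolding hc hs ..
    also have "\<dots> = k^2 * ?w * (k^2 * (3 * a * ?w - ?w^2 - k^2))"
      unfolding k2 by (simp add: power2_eq_square algebra_simps)
    finally have num: "(k^2 * (h * k * (cosh (k * t) * k)) * ?w^2 - k^2 * (h * k * ?s) * (2 * ?w * (h * k * ?s)))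
      = k^2 * ?w * (k^2 * (3 * a * ?w - ?w^2 - k^2))" .
    define y where "y = k^2 / ?w"
    have "V t ^ 3 - lam * V t + 1 = (a - y) ^ 3 - lam * (a - y) + 1" by (simp add: V_def y_def)
    also have "\<dots> = - (3 * a^2 - lam) * y + 3 * a * y^2 - y^3 + (a^3 - lam * a + 1)"
      by (simp add: power2_eq_square power3_eq_cube algebra_simps)
    also have "a^3 - lam * a + 1 = 0"
      unfolding lam prod[symmetric] by (simp add: power2_eq_square power3_eq_cube algebra_simps)
    also have "- (3 * a^2 - lam) * y + 3 * a * y^2 - y^3 + 0
        = k^2 * ?w * (k^2 * (3 * a * ?w - ?w^2 - k^2)) / (?w^2 * ?w^2)"
      unfolding k2'[symmetric] y_def using wn by (simp add: field_simps power2_eq_square power3_eq_cube)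
    finally show ?thesis using D1 num by simp
  qed
  have V'0: "V' 0 = 0" by (simp add: V'_def)
  have V0: "V 0 = - a + sqrt (2 * b * (a + b))"
  proof -
    have "k^2 = 2 * (a - h) * (a + h)" unfolding k2 by (simp add: power2_eq_square algebra_simps)
    then have "k^2 / (a + h) = 2 * (a - h)" using b h0 by simp
    then have "V 0 = - a + 2 * h" by (simp add: V_def w_def)
    then show ?thesis by (simp add: h_def)
  qed
  have wtop: "filterlim w at_top at_top"
  proof -
    have "filterlim (\<lambda>t. k * t) at_top at_top"
      using k0 by (intro filterlim_tendsto_pos_mult_at_top[OF tendsto_const]) (auto simp: filterlim_ident)
    then have "filterlim (\<lambda>t. cosh (k * t)) at_top at_top"
      by (rule filterlim_compose[OF cosh_real_at_top])
    then have "filterlim (\<lambda>t. h * cosh (k * t)) at_top at_top"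
      using h0 by (intro filterlim_tendsto_pos_mult_at_top[OF tendsto_const]) auto
    then show ?thesis unfolding w_def by (intro filterlim_tendsto_add_at_top[OF tendsto_const])
  qed
  have Vtop: "(V \<longlongrightarrow> a) at_top"
  proof -
    have "((\<lambda>t. k^2 / w t) \<longlongrightarrow> 0) at_top"
      by (intro tendsto_divide_0[OF tendsto_const] filterlim_at_top_imp_at_infinity wtop)
    then have "(V \<longlongrightarrow> a - 0) at_top" unfolding V_def by (intro tendsto_intros)
    then show ?thesis by simp
  qed
  have Veven: "V (- t) = V t" for t by (simp add: V_def w_def)
  have Vbot: "(V \<longlongrightarrow> a) at_bot"
    using Vtop unfolding filterlim_at_bot_mirror by (simp add: Veven)
  have V0_less: "V 0 < a"
    unfolding V_def using k0 wpos[of 0] by simp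
  have "is_homoclinic lam V"
    unfolding is_homoclinic_def up
  proof (intro conjI exI[of _ V'])
    show "\<not> V constant_on UNIV"
    proof
      assume "V constant_on UNIV"
      then obtain c where "V t = c" for t by (auto simp: constant_on_def)
      then have "V = (\<lambda>_. c)" "c < a" using V0_less by auto
      then show False using Vtop by (simp add: tendsto_const_iff)
    qed
  qed (use VD V'D V'0 Vtop Vbot in auto)
  moreover have "W = V" if hom: "is_homoclinic lam W" for W
  proof -
    obtain W' where W: "\<And>t. (W has_real_derivative W' t) (at t)"
      and W': "\<And>t. (W' has_real_derivative W t ^ 3 - lam * W t + 1) (at t)" and W'0: "W' 0 = 0"
      and Wtop: "(W \<longlongrightarrow> a) at_top" and nc: "\<not> W constant_on UNIV"
      using hom unfolding is_homoclinic_def up by blast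
    \<comment> \<open>The potential normalised to vanish at the saddle. Energy conservation and the
      limit at infinity force \<open>Q (W 0) = 0\<close>, which leaves three candidates for
      \<open>W 0\<close>: the saddle gives a constant, and the lowest root is excluded next.\<close>
    define Q where "Q = (\<lambda>x. (x - a)^2 * ((x + a)^2 - 2 * b * (a + b)) / 4)"
    have QD: "(Q has_real_derivative x^3 - lam * x + 1) (at x)" for x
    proof -
      have "(Q has_real_derivative (2 * (x - a) * ((x + a)^2 - 2 * b * (a + b)) + (x - a)^2 * (2 * (x + a))) / 4) (at x)"
        unfolding Q_def by (auto intro!: derivative_eq_intros)
      also have "(2 * (x - a) * ((x + a)^2 - 2 * b * (a + b)) + (x - a)^2 * (2 * (x + a))) / 4
          = x^3 - lam * x + a * b * (a + b)"
        unfolding lam by (simp add: power2_eq_square power3_eq_cube field_simps)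
      finally show ?thesis unfolding prod .
    qed
    have "((\<lambda>t. (W' t)^2 / 2 - Q (W t)) has_real_derivative 0) (at t)" for t
      by (auto intro!: derivative_eq_intros W W' DERIV_chain2[OF QD])
    then have energy: "(W' t)^2 / 2 - Q (W t) = (W' 0)^2 / 2 - Q (W 0)" for t
      using DERIV_isconst_all[of "\<lambda>t. (W' t)^2 / 2 - Q (W t)" t 0] by simp
    then have W'2: "(W' t)^2 = 2 * (Q (W t) - Q (W 0))" for t
    proof -
      have "(W' t)^2 / 2 = Q (W t) - Q (W 0)" using energy[of t] W'0 by simp
      then show ?thesis by (simp add: divide_eq_eq)
    qed
    have "isCont Q a" using QD DERIV_isCont by blast
    then have "((\<lambda>t. Q (W t)) \<longlongrightarrow> Q a) at_top" using Wtop by (rule isCont_tendsto_compose)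
    then have "((\<lambda>t. (W' t)^2) \<longlongrightarrow> 2 * (Q a - Q (W 0))) at_top" unfolding W'2 by (intro tendsto_intros)
    then have "2 * (Q a - Q (W 0)) = 0" by (rule derivative_square_limit[OF W Wtop])
    then have Q0: "Q (W 0) = 0" by (simp add: Q_def)
    have "W 0 \<noteq> a"
    proof
      assume eq: "W 0 = a"
      have "a^3 - lam * a + 1 = 0"
        unfolding lam prod[symmetric] by (simp add: power2_eq_square power3_eq_cube algebra_simps)
      then have c: "((\<lambda>_. 0) has_real_derivative a^3 - lam * a + 1) (at t)" for t :: real by simp
      have "W t = a" for t
        by (rule cubic_uniqueness[OF W W' DERIV_const c eq W'0 refl])
      then show False using nc by (auto simp: constant_on_def)
    qed
    then have "(W 0 + a)^2 = (sqrt (2 * b * (a + b)))^2" using Q0 D by (simp add: Q_def)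
    then have "W 0 + a = sqrt (2 * b * (a + b)) \<or> W 0 + a = - sqrt (2 * b * (a + b))"
      by (simp only: power2_eq_iff)
    \<comment> \<open>From the lowest root the orbit would have to cross \<open>- a\<close> on its
      way to \<open>a\<close>, but \<open>Q (- a) < 0\<close> while \<open>2 * Q (W t)\<close> is a
      square.\<close>
    moreover have "W 0 + a \<noteq> - sqrt (2 * b * (a + b))"
    proof
      assume "W 0 + a = - sqrt (2 * b * (a + b))"
      then have low: "W 0 < - a" using real_sqrt_gt_zero[OF D] by linarith
      have "\<forall>\<^sub>F t in at_top. - a < W t" using order_tendstoD(1)[OF Wtop, of "- a"] b by simp
      then obtain n where "\<And>t. n \<le> t \<Longrightarrow> - a < W t" unfolding eventually_at_top_linorder by blast
      then have t: "0 \<le> t" "- a < W t" if "t = max n 0" for t using that by auto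
      define t where "t = max n 0"
      note t = t[OF t_def]
      have "continuous_on {0..t} W" using W DERIV_isCont continuous_at_imp_continuous_on by blast
      then obtain s where "W s = - a" using IVT'[of W 0 "- a" t] low t by auto
      then have "Q (W s) < 0" using b D by (simp add: Q_def)
      moreover have "0 \<le> 2 * (Q (W s) - Q (W 0))" unfolding W'2[symmetric] by simp
      then have "0 \<le> Q (W s)" unfolding Q0 by simp
      ultimately show False by simp
    qed
    ultimately have "W 0 = V 0" using V0 by simp
    then show "W = V" using cubic_uniqueness[OF W W' VD V'D _ W'0 V'0] by blast
  qed
  ultimately have "V1 lam = V" unfolding V1_def by (intro the_equality)
  then show ?thesis using V0 by simp
qed

lemma dip_condition:
  fixes a b :: real
  assumes "0 < b" "b < a"
  shows "- a + sqrt (2 * b * (a + b)) < - b \<longleftrightarrow> 4 * a * b + b^2 < a^2"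
proof -
  have "- a + sqrt (2 * b * (a + b)) < - b \<longleftrightarrow> sqrt (2 * b * (a + b)) < a - b" by auto
  also have "\<dots> \<longleftrightarrow> sqrt (2 * b * (a + b)) < sqrt ((a - b)^2)" using assms by simp
  also have "\<dots> \<longleftrightarrow> 2 * b * (a + b) < (a - b)^2" by (rule real_sqrt_less_iff)
  also have "\<dots> \<longleftrightarrow> 4 * a * b + b^2 < a^2" by (simp add: power2_eq_square algebra_simps)
  finally show ?thesis .
qed

text \<open>The infimum only provides some smaller parameter in the set, and only once the set is
  known to be nonempty; monotonicity of both positive roots then carries the inequality up to
  \<open>lam\<close>.\<close>

lemma above_Lambda_crit:
  assumes "lam > Lambda_crit"
  shows "lambda0 < lam \<and> 4 * U_upper lam 0 * U_mid lam 0 + (U_mid lam 0)^2 < (U_upper lam 0)^2"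
proof -
  let ?S = "{lam. lam > lambda0 \<and> V1 lam 0 < U_mid lam pi}"
  have S_iff: "l \<in> ?S \<longleftrightarrow> l > lambda0 \<and> 4 * U_upper l 0 * U_mid l 0 + (U_mid l 0)^2 < (U_upper l 0)^2" for l
  proof (cases "l > lambda0")
    case True
    then obtain a b where ab: "0 < b" "b < a" "a * b * (a + b) = 1" "l = a^2 + a * b + b^2"
      "U_upper l 0 = a" "U_mid l 0 = b" "U_mid l pi = - b" by (rule roots_at_0_and_pi)
    then show ?thesis using True V1_at_0[OF ab(1-5)] dip_condition[OF ab(1,2)] by simp
  qed simp
  have nine: "9 / 2 > lambda0"
  proof (rule ccontr)
    assume "\<not> ?thesis"
    then have "(9 / 2) ^ 3 \<le> lambda0 ^ 3" by (intro power_mono) auto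
    then show False unfolding lambda0_cubed by (simp add: power3_eq_cube)
  qed
  \<comment> \<open>A value for which 2 is an exact root; it must be the larger positive one,
    because \<open>a * b * (a + b) = 1\<close>.\<close>
  have "9 / 2 \<in> ?S"
  proof -
    obtain a b where ab: "0 < b" "b < a" "a * b * (a + b) = 1" 
      "U_upper (9/2) 0 = a" "U_mid (9/2) 0 = b" "cubic_roots (9/2) 0 = {- (a + b), b, a}"
      using nine by (rule roots_at_0_and_pi)
    have "2 \<in> cubic_roots (9/2) 0" by (simp add: cubic_roots_def)
    then have "b = 2 \<or> a = 2" using ab by auto
    moreover have "b \<noteq> 2"
    proof
      assume "b = 2"
      then have "1 * 1 < (a * b) * (a + b)" using ab by (intro mult_strict_mono) auto
      then show False using ab by simp
    qed
    ultimately have a: "a = 2" by simp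
    then have "4 * b + 2 * b^2 = 1" using ab by (simp add: power2_eq_square algebra_simps)
    moreover have "0 < b^2" using ab by simp
    ultimately have "8 * b + b^2 < 4" by linarith
    then have "4 * a * b + b^2 < a^2" unfolding a by simp
    then show ?thesis unfolding S_iff using nine ab by simp
  qed
  then have "?S \<noteq> {}" by blast
  then obtain l where l: "l \<in> ?S" "l < lam"
    using cInf_lessD[of ?S lam] assms unfolding Lambda_crit_def by blast
  have l0: "l > lambda0" using l by simp
  have lam0: "lam > lambda0" using l0 l by simp
  obtain a b where ab: "0 < b" "b < a" "a * b * (a + b) = 1" "lam = a^2 + a * b + b^2"
    "U_upper lam 0 = a" "U_mid lam 0 = b"
    using lam0 by (rule roots_at_0_and_pi)
  obtain a' b' where ab': "0 < b'" "b' < a'" "a' * b' * (a' + b') = 1" "l = a'^2 + a' * b' + b'^2"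
    "U_upper l 0 = a'" "U_mid l 0 = b'" "cubic_roots l 0 = {- (a' + b'), b', a'}"
    using l0 by (rule roots_at_0_and_pi)
  \<comment> \<open>At a positive root for \<open>l\<close> the cubic for \<open>lam\<close> equals
    \<open>- (lam - l) * x < 0\<close>, and on the positive axis it is negative only between
    \<open>b\<close> and \<open>a\<close>.\<close>
  have between: "b < x \<and> x < a" if x: "x \<in> cubic_roots l 0" "0 < x" for x
  proof -
    have "x^3 - lam * x + a * b * (a + b) = (x^3 - l * x + 1) - (lam - l) * x"
      using ab by (simp add: algebra_simps)
    also have "\<dots> < 0" using x l by (simp add: cubic_roots_def)
    also have "x^3 - lam * x + a * b * (a + b) = (x - a) * (x - b) * (x + a + b)"
      unfolding ab(4) by (simp add: power2_eq_square power3_eq_cube algebra_simps)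
    finally have "(x - a) * (x - b) * (x + a + b) < 0" .
    moreover have "0 < x + a + b" using x ab by simp
    ultimately have "(x - a) * (x - b) < 0" by (simp add: mult_less_0_iff)
    then show ?thesis using ab by (auto simp: mult_less_0_iff)
  qed
  have "a' < a" "b < b'" using between[of a'] between[of b'] ab' by auto
  have gap': "4 * a' * b' + b'^2 < a'^2" using l S_iff[of l] ab' by simp
  \<comment> \<open>In the form \<open>5 * b^2 < (a - 2 * b)^2\<close> the inequality is visibly
    preserved when \<open>a\<close> grows and \<open>b\<close> shrinks, provided the base of the
    square is positive.\<close>
  have "2 * b' < a'"
  proof (rule ccontr)
    assume "\<not> 2 * b' < a'"
    then have "a' * a' \<le> a' * (2 * b')" using ab' by (intro mult_left_mono) auto
    moreover have "0 < a' * b'" "0 < b'^2" using ab' by auto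
    ultimately show False using gap' by (simp add: power2_eq_square)
  qed
  then have "(a' - 2 * b')^2 < (a - 2 * b)^2" using \<open>a' < a\<close> \<open>b < b'\<close> by (intro power_strict_mono) auto
  moreover have "b^2 < b'^2" using \<open>b < b'\<close> ab by (intro power_strict_mono) auto
  ultimately have "4 * a * b + b^2 < a^2" using gap' by (simp add: power2_eq_square algebra_simps)
  then show ?thesis using lam0 ab by simp
qed

theorem theorem28:
  fixes lam :: real and N :: nat
  assumes "lam > Lambda_crit" and "N > 0"
  shows "\<exists>\<epsilon>0>0. \<forall>\<epsilon>. 0 < \<epsilon> \<and> \<epsilon> < \<epsilon>0 \<longrightarrow>
           (\<forall>M::nat. 0 < M \<and> M \<le> N \<longrightarrow>
             (\<exists>u::real \<Rightarrow> real.
                forced_solution \<epsilon> lam u \<and>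
                (\<forall>t. u (t + 2 * pi) = u t) \<and>
                card {t \<in> {0<..pi}. local_max_at u t} = M \<and>
                local_max_at u pi \<and>
                local_min_at u 0 \<and>
                - sqrt lam < u 0 \<and> u 0 < U_mid lam pi \<and>
                U_mid lam pi < u pi \<and> u pi < U_upper lam pi))"
proof -
  have lam0: "lambda0 < lam"
    and gap: "4 * U_upper lam 0 * U_mid lam 0 + (U_mid lam 0)^2 < (U_upper lam 0)^2"
    using above_Lambda_crit[OF assms(1)] by auto
  obtain a b where ab: "0 < b" "b < a" "a * b * (a + b) = 1" "lam = a^2 + a * b + b^2"
    "U_upper lam 0 = a" "U_mid lam 0 = b" and at_pi: "U_mid lam pi = - b" "U_upper lam pi = a + b"
    using lam0 by (rule roots_at_0_and_pi)
  interpret duffing a b lam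
    by unfold_locales (use ab gap in auto)
  obtain \<epsilon>0 where e0: "\<epsilon>0 > 0" and shoot: "\<And>\<epsilon> M. 0 < \<epsilon> \<Longrightarrow> \<epsilon> < \<epsilon>0 \<Longrightarrow> 0 < M \<Longrightarrow> M \<le> N \<Longrightarrow>
    \<exists>\<alpha> v v'. orbit a b lam \<epsilon> \<alpha> v v' \<and> \<alpha> \<noteq> - sqrt lam \<and> v' (pi / \<epsilon>) = 0 \<and> - b < v (pi / \<epsilon>) \<and>
      card {t \<in> {0<..pi / \<epsilon>}. v' t = 0 \<and> - b < v t} = M"
    using shooting[of N] by blast
  show ?thesis
  proof (rule exI[of _ \<epsilon>0], intro conjI e0 allI impI)
    fix \<epsilon> and M :: nat assume "0 < \<epsilon> \<and> \<epsilon> < \<epsilon>0" "0 < M \<and> M \<le> N"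
    then obtain \<alpha> v v' where orb: "orbit a b lam \<epsilon> \<alpha> v v'" and "\<alpha> \<noteq> - sqrt lam" "v' (pi / \<epsilon>) = 0"
      "- b < v (pi / \<epsilon>)" "card {t \<in> {0<..pi / \<epsilon>}. v' t = 0 \<and> - b < v t} = M"
      using shoot[of \<epsilon> M] by blast
    then show "\<exists>u::real \<Rightarrow> real. forced_solution \<epsilon> lam u \<and> (\<forall>t. u (t + 2 * pi) = u t) \<and>
        card {t \<in> {0<..pi}. local_max_at u t} = M \<and> local_max_at u pi \<and> local_min_at u 0 \<and>
        - sqrt lam < u 0 \<and> u 0 < U_mid lam pi \<and> U_mid lam pi < u pi \<and> u pi < U_upper lam pi"
      unfolding at_pi using orbit.rescaled_solution[OF orb] orbit.S_def[OF orb] by simp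
  qed
qed

end
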